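(* Let $\Phi:\Delta\to\mathbb{R}^{n\times n}$, $\Delta=\{(t,\tau)\in\mathbb{R}\times\mathbb{R}:t\ge\tau\}$, be measurable and locally essentially bounded, and let $f,\tilde f:\mathbb{R}\times\mathbb{R}^n\to\mathbb{R}^n$ satisfy the Filippov Condition. Let measurable functions $f_\mu,\tilde f_\mu:\mathbb{R}\times\mathbb{R}^n\to\mathbb{R}^n$ be parameterized by $\mu\in\mathcal{M}$, where $\mathcal{M}$ is an open set of a complete metric space, and let $f=f_{\mu_0}$, $\tilde f=\tilde f_{\mu_0}$ for some $\mu_0\in\mathcal{M}$. Suppose that for any $\alpha>0$, any $r>0$ and any $\mu\in\mathcal{M}$ there exists $m_\mu\in L^\infty((-\alpha,\alpha);\mathbb{R}_+)$ (which may depend on $\alpha,r$) such that the set $$E(t,x)=\left\{z\in\mathbb{R}^n:\ \|x-z\|\le m_\mu(t),\ \|f_\mu(t,x)-f(t,z)\|\le m_\mu(t),\ \|\tilde f_\mu(t,x)-\tilde f(t,z)\|\le m_\mu(t)\right\}$$ is of positive measure for almost all $t\in(-\alpha,\alpha)$ and almost all $x\in\mathcal{B}(r)$. Let (for these $\alpha,r$) $\sup_{\mu\in\mathcal{M}}\|m_\mu\|_{L^\infty}<+\infty$ and $\|m_\mu\|_{L^1}\to0$ as $\mu\to\mu_0$. Suppose that, for a given $t^0\in\mathbb{R}$, a given $x^0\in\mathbb{R}^n$ and $T>0$, all Filippov solutions of the IVP $$\dot x(t)=f(t,x(t))+\int_{t^0}^t\Phi(t,\tau)\tilde f(\tau,x(\tau))\,d\tau,\quad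 t>t^0,\qquad x(t^0)=x^0\qquad(\ast)$$ exist on $[t^0,t^0+T]$. Then for any $\varepsilon>0$ there exist $\delta\in(0,\varepsilon)$, $\alpha>0$ with $[t^0,t^0+T]\subset(-\alpha,\alpha)$, and $r>0$ such that, with $m_\mu$ taken for these $\alpha,r$, any Filippov solution $x_\mu$ on $[t^0_\mu,t^0+T]$ of the IVP $$\dot x_\mu(t)=f_\mu(t,x_\mu(t))+\int_{t^0_\mu}^t\Phi(t,\tau)\tilde f_\mu(\tau,x_\mu(\tau))\,d\tau,\quad t>t^0_\mu,\qquad x_\mu(t^0_\mu)=x^0_\mu,$$ with $t^0_\mu\in[t^0,t^0+\delta]$, $x^0_\mu\in x^0+\mathcal{B}(\delta)$ and $\|m_\mu\|_{L^1(t^0,t^0+T)}\le\delta$, satisfies $$\sup_{t\in[t^0+\delta,\,t^0+T]}\|x(t)-x_\mu(t)\|\le\varepsilon$$ for some Filippov solution $x$ of $(\ast)$.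
   Context: $\|\cdot\|$ is the Euclidean norm and $\mathcal{B}(r)\subset\mathbb{R}^n$ is the open ball of radius $r>0$ centered at $0$. A function is locally essentially bounded on a set if its norm has finite essential supremum over every compact subset of that set. Filippov Condition: $g:\mathbb{R}\times\mathbb{R}^n\to\mathbb{R}^n$ is measurable and for any $\alpha,r>0$ there exists $m\in L^1((-\alpha,\alpha);\mathbb{R})$ such that $\|g(t,x)\|\le m(t)$ for almost all $t\in(-\alpha,\alpha)$ and almost all $x\in\mathcal{B}(r)$. Filippov regularization: $K[g](t,x)=\bigcap_{\delta>0}\bigcap_{\mu(M)=0}\overline{\mathrm{co}}\,g(t,x+\mathcal{B}(\delta)\setminus M)$, where $\overline{\mathrm{co}}$ is the convex closure and the intersections are over all $\delta>0$ and all $M\subset\mathbb{R}^n$ of Lebesgue measure zero. Filippov solution on an interval $\mathcal{I}$ starting at $t^0$ of the IVP $\dot x(t)=f(t,x(t))+\int_{t^0}^t\Phi(t,\tau)\tilde f(\tau,x(\tau))d\tau$, $x(t^0)=x^0$: an absolutely continuous $x:\mathcal{I}\to\mathbb{R}^n$ with $x(t^0)=x^0$ such that for almost all $t\in\mathcal{I}$, $\dot x(t)\in K[f](t,x(t))+\int_{t^0}^t\Phi(t,\tau)K[\tilde f](\tau,x(\tau))\,d\tau$, with the integral of the set-valued map in the sense of Aumann. The same definition applies with $f_\mu,\tilde f_\mu,t^0_\mu,x^0_\mu$. *)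

theory Defs
  imports "HOL-Analysis.Analysis" "HOL-Probability.Essential_Supremum"
begin

text \<open>Throughout, measurability and null sets are meant in the sense of Lebesgue. Time-dependent
  vector fields take pairs \<open>(t, x)\<close>.\<close>

definition Delta :: "(real \<times> real) set"
  where "Delta = {(t, \<tau>). t \<ge> \<tau>}"

text \<open>For matrix-valued functions, the norm used here is the Frobenius norm; any other matrix norm
  gives the same notion.\<close>

definition locally_ess_bounded_on ::
    "'a::euclidean_space set \<Rightarrow> ('a \<Rightarrow> 'b::real_normed_vector) \<Rightarrow> bool"
  where "locally_ess_bounded_on D h \<longleftrightarrow>
    (\<forall>C. compact C \<and> C \<subseteq> D \<longrightarrow> esssup (lebesgue_on C) (\<lambda>p. ereal (norm (h p))) < \<infinity>)"

definition filippov_condition :: "(real \<times> (real^'n) \<Rightarrow> real^'n) \<Rightarrow> bool"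
  where "filippov_condition g \<longleftrightarrow>
    g \<in> borel_measurable lebesgue \<and>
    (\<forall>\<alpha>>0. \<forall>r>0. \<exists>m. integrable (lebesgue_on {-\<alpha><..<\<alpha>}) m \<and>
       (AE t in lebesgue_on {-\<alpha><..<\<alpha>}. AE x in lebesgue_on (ball 0 r). norm (g (t, x)) \<le> m t))"

definition filippov_reg :: "(real \<times> (real^'n) \<Rightarrow> real^'n) \<Rightarrow> real \<Rightarrow> real^'n \<Rightarrow> (real^'n) set"
  where "filippov_reg g t x =
    (\<Inter>\<delta>\<in>{0<..}. \<Inter>M\<in>null_sets lebesgue.
       closure (convex hull ((\<lambda>y. g (t, y)) ` (ball x \<delta> - M))))"

definition aumann_integral ::
    "'a measure \<Rightarrow> ('a \<Rightarrow> 'b::{banach, second_countable_topology} set) \<Rightarrow> 'b set"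
  where "aumann_integral M F =
    {integral\<^sup>L M \<phi> |\<phi>. integrable M \<phi> \<and> (AE \<tau> in M. \<phi> \<tau> \<in> F \<tau>)}"

text \<open>On an interval \<open>I\<close> that is not compact, this is local absolute continuity; on a compact
  interval it is absolute continuity in the usual sense.\<close>

definition abs_continuous_on :: "real set \<Rightarrow> (real \<Rightarrow> 'a::real_normed_vector) \<Rightarrow> bool"
  where "abs_continuous_on I x \<longleftrightarrow>
    (\<forall>c d. {c..d} \<subseteq> I \<longrightarrow>
      (\<forall>\<epsilon>>0. \<exists>\<eta>>0. \<forall>(k::nat) a b.
         (\<forall>i<k. c \<le> a i \<and> a i \<le> b i \<and> b i \<le> d) \<and>
         disjoint_family_on (\<lambda>i. {a i<..<b i}) {..<k} \<and>
         (\<Sum>i<k. b i - a i) < \<eta> \<longrightarrow>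
         (\<Sum>i<k. norm (x (b i) - x (a i))) < \<epsilon>))"

text \<open>Sums of sets are Minkowski sums.\<close>

definition filippov_solution ::
    "(real \<times> real \<Rightarrow> real^'n^'n) \<Rightarrow> (real \<times> (real^'n) \<Rightarrow> real^'n) \<Rightarrow> (real \<times> (real^'n) \<Rightarrow> real^'n)
     \<Rightarrow> real \<Rightarrow> real^'n \<Rightarrow> real set \<Rightarrow> (real \<Rightarrow> real^'n) \<Rightarrow> bool"
  where "filippov_solution \<Phi> f g t0 x0 I x \<longleftrightarrow>
    is_interval I \<and> t0 \<in> I \<and> I \<subseteq> {t0..} \<and>
    abs_continuous_on I x \<and> x t0 = x0 \<and>
    (AE t in lebesgue_on I. \<exists>v. (x has_vector_derivative v) (at t within I) \<and>
       v \<in> filippov_reg f t (x t) +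
           aumann_integral (lebesgue_on {t0..t})
             (\<lambda>\<tau>. (\<lambda>w. \<Phi> (t, \<tau>) *v w) ` filippov_reg g \<tau> (x \<tau>)))"

text \<open>No solution ceases to exist before time \<open>t1\<close>: each one can be continued up to \<open>t1\<close>.
  The degenerate interval is excluded, so that the existence of a solution is not part of this
  notion.\<close>

definition all_filippov_solutions_exist_until ::
    "(real \<times> real \<Rightarrow> real^'n^'n) \<Rightarrow> (real \<times> (real^'n) \<Rightarrow> real^'n) \<Rightarrow> (real \<times> (real^'n) \<Rightarrow> real^'n)
     \<Rightarrow> real \<Rightarrow> real^'n \<Rightarrow> real \<Rightarrow> bool"
  where "all_filippov_solutions_exist_until \<Phi> f g t0 x0 t1 \<longleftrightarrow>
    (\<forall>I x. filippov_solution \<Phi> f g t0 x0 I x \<and> I \<noteq> {t0} \<and> I \<subseteq> {t0..t1} \<longrightarrow>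
       (\<exists>y. filippov_solution \<Phi> f g t0 x0 {t0..t1} y \<and> (\<forall>t\<in>I. y t = x t)))"

definition L1_norm :: "real set \<Rightarrow> (real \<Rightarrow> real) \<Rightarrow> real"
  where "L1_norm A m = (LINT t|lebesgue_on A. \<bar>m t\<bar>)"

definition Linf_norm :: "real set \<Rightarrow> (real \<Rightarrow> real) \<Rightarrow> ereal"
  where "Linf_norm A m = esssup (lebesgue_on A) (\<lambda>t. ereal \<bar>m t\<bar>)"

definition Linf_nonneg :: "real set \<Rightarrow> (real \<Rightarrow> real) set"
  where "Linf_nonneg A = {m. m \<in> borel_measurable (lebesgue_on A) \<and> Linf_norm A m < \<infinity> \<and>
    (AE t in lebesgue_on A. 0 \<le> m t)}"

definition closeness_set ::
    "(real \<times> (real^'n) \<Rightarrow> real^'n) \<Rightarrow> (real \<times> (real^'n) \<Rightarrow> real^'n) \<Rightarrow>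
     (real \<times> (real^'n) \<Rightarrow> real^'n) \<Rightarrow> (real \<times> (real^'n) \<Rightarrow> real^'n) \<Rightarrow>
     (real \<Rightarrow> real) \<Rightarrow> real \<Rightarrow> real^'n \<Rightarrow> (real^'n) set"
  where "closeness_set f\<mu> g\<mu> f g m t x =
    {z. norm (x - z) \<le> m t \<and> norm (f\<mu> (t, x) - f (t, z)) \<le> m t \<and> norm (g\<mu> (t, x) - g (t, z)) \<le> m t}"

end

theory Submission
  imports Defs "HOL-Complex_Analysis.Great_Picard"
begin

text \<open>The closeness hypothesis says that, up to null sets, the perturbed right-hand sides take at
  \<open>(t, x)\<close> values that are \<open>m\<^sub>\<mu>(t)\<close>-close to values of \<open>f\<close> and \<open>g\<close> at points
  \<open>m\<^sub>\<mu>(t)\<close>-close to \<open>x\<close>. Hence a solution of the perturbed problem solves an inclusion whose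
  right-hand side is an \<open>m\<^sub>\<mu>\<close>-enlargement of the limiting one, and, \<open>m\<^sub>\<mu>\<close> being uniformly
  bounded, its derivative is dominated by one fixed integrable function as long as it stays in a
  fixed ball. Arguing by contradiction, take a sequence of such solutions with \<open>\<delta> \<rightarrow> 0\<close>. A
  subsequence converges uniformly, and convex combinations of the derivatives converge almost
  everywhere (a Mazur argument in a weighted \<open>L\<^sup>2\<close> space), so the limit solves the original
  inclusion; the same argument applies to the selections in the Aumann integral. That the
  approximating solutions stay in a fixed ball is shown step by step in time: every limit extends to
  the whole interval, and the solutions of the original problem are uniformly bounded there, for
  otherwise a diagonal subsequence of solutions would converge up to the first blow-up time \<open>\<sigma>\<close> to
  a solution that extends beyond \<open>\<sigma>\<close> and keeps its neighbours bounded near \<open>\<sigma>\<close>.\<close>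

section \<open>Convex combinations of dominated sequences\<close>

text \<open>The right-hand side contains an Aumann integral over the past, and its closedness is
  never established. \<open>tail_hull_subset\<close> asks only for a convex target, since the
  cluster points of a bounded sequence form a compact set whose hull is compact in finite dimension.
  So it suffices that, at almost every fixed time, each cluster point of the velocities satisfies
  the limiting inclusion. Such a point is split into a cluster point for f and one for the integral,
  and for the latter the same scheme runs once more in the variable \<tau>. The integral also makes
  the inclusion nonlocal: bounds valid in a ball can be used only while the whole past stays there,
  which is why the a priori estimate looks at a first exit time. The radius of that ball is R + 3,
  where R bounds the limiting solutions: one unit because approximate solutions are eventually
  1-close to a limit on the part already treated, one for their growth over the next short interval,
  one to keep the inequality strict.\<close>

lemma cluster_point_subsequence:
  fixes v :: "nat \<Rightarrow> 'a::metric_space"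
  assumes "\<And>N. l \<in> closure (v ` {N..})"
  obtains \<sigma> where "strict_mono (\<sigma> :: nat \<Rightarrow> nat)" "(v \<circ> \<sigma>) \<longlonglongrightarrow> l"
proof -
  have ex: "\<exists>k\<ge>N. dist (v k) l < e" if "e > 0" for N e
    using assms[of N] that unfolding closure_approachable by auto
  have "\<exists>\<sigma>. \<forall>n. dist (v (\<sigma> n)) l < 1 / real (Suc n) \<and> \<sigma> n < \<sigma> (Suc n)"
  proof (rule dependent_nat_choice)
    show "\<exists>x. dist (v x) l < 1 / real (Suc 0)"
      using ex[of 1 0] by auto
  next
    fix x n
    show "\<exists>y. dist (v y) l < 1 / real (Suc (Suc n)) \<and> x < y"
      using ex[of "1 / real (Suc (Suc n))" "Suc x"] by auto
  qed
  then obtain \<sigma> where \<sigma>: "\<And>n. dist (v (\<sigma> n)) l < 1 / real (Suc n)" "\<And>n. \<sigma> n < \<sigma> (Suc n)"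
    by blast
  have "(\<lambda>n. dist (v (\<sigma> n)) l) \<longlonglongrightarrow> 0"
  proof (rule tendsto_sandwich)
    show "\<forall>\<^sub>F n in sequentially. 0 \<le> dist (v (\<sigma> n)) l"
      "\<forall>\<^sub>F n in sequentially. dist (v (\<sigma> n)) l \<le> 1 / real (Suc n)"
      using less_imp_le[OF \<sigma>(1)] by auto
    show "(\<lambda>n. 1 / real (Suc n)) \<longlonglongrightarrow> 0"
      by (rule LIMSEQ_Suc[OF lim_1_over_n])
  qed auto
  then have "(v \<circ> \<sigma>) \<longlonglongrightarrow> l"
    unfolding o_def by (subst tendsto_dist_iff)
  with \<sigma>(2) show thesis
    by (intro that[of \<sigma>]) (auto simp: strict_mono_Suc_iff)
qed

text \<open>A point outside the compact hull of the cluster set is strictly separated from it by a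
  hyperplane. A whole tail of the sequence must then lie on the far side of the hyperplane, and so
  must the closed convex hull of that tail.\<close>

lemma tail_hull_subset:
  fixes v :: "nat \<Rightarrow> 'a::euclidean_space"
  assumes "convex C" and bdd: "bounded (range v)"
    and C: "\<And>\<sigma> l. strict_mono (\<sigma> :: nat \<Rightarrow> nat) \<Longrightarrow> (v \<circ> \<sigma>) \<longlonglongrightarrow> l \<Longrightarrow> l \<in> C"
    and w: "\<And>N. w \<in> closure (convex hull (v ` {N..}))"
  shows "w \<in> C"
proof -
  define L where "L = (\<Inter>N. closure (v ` {N..}))"
  have "L \<subseteq> closure (range v)"
    unfolding L_def by (metis INT_lower UNIV_I atLeast_0)
  then have "compact L"
    using bdd bounded_closure bounded_subset unfolding compact_eq_bounded_closed L_def
    by (metis (no_types, lifting) closed_INT closed_closure)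
  have "L \<subseteq> C"
  proof
    fix l assume "l \<in> L"
    then obtain \<sigma> where "strict_mono (\<sigma> :: nat \<Rightarrow> nat)" "(v \<circ> \<sigma>) \<longlonglongrightarrow> l"
      using cluster_point_subsequence[of l v] unfolding L_def by blast
    then show "l \<in> C" by (rule C)
  qed
  have "w \<in> convex hull L"
  proof (rule ccontr)
    assume "w \<notin> convex hull L"
    moreover have "closed (convex hull L)"
      using \<open>compact L\<close> by (simp add: compact_convex_hull compact_imp_closed)
    ultimately obtain p \<beta> where p: "p \<bullet> w < \<beta>" "\<And>x. x \<in> convex hull L \<Longrightarrow> \<beta> < p \<bullet> x"
      using separating_hyperplane_closed_point[OF convex_convex_hull] by blast
    \<comment> \<open>Otherwise infinitely many terms lie on the side of w, and by boundedness they
      have a cluster point there; it belongs to L, against the separation.\<close>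
    have "\<exists>N. \<forall>k\<ge>N. \<beta> \<le> p \<bullet> v k"
    proof (rule ccontr)
      assume "\<nexists>N. \<forall>k\<ge>N. \<beta> \<le> p \<bullet> v k"
      then have inf: "infinite {k. p \<bullet> v k < \<beta>}"
        unfolding infinite_nat_iff_unbounded_le by (auto simp: not_le)
      define \<sigma> where "\<sigma> = enumerate {k. p \<bullet> v k < \<beta>}"
      have \<sigma>: "strict_mono \<sigma>" "\<And>k. p \<bullet> v (\<sigma> k) < \<beta>"
        using strict_mono_enumerate[OF inf] enumerate_in_set[OF inf] unfolding \<sigma>_def by auto
      have "bounded (range (v \<circ> \<sigma>))"
        using bdd by (rule bounded_subset) auto
      then obtain l \<tau> where l: "strict_mono (\<tau> :: nat \<Rightarrow> nat)" "((v \<circ> \<sigma>) \<circ> \<tau>) \<longlonglongrightarrow> l"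
        using bounded_imp_convergent_subsequence[of "v \<circ> \<sigma>"] by blast
      have "l \<in> L"
        unfolding L_def
      proof
        fix N
        have "\<forall>\<^sub>F n in sequentially. ((v \<circ> \<sigma>) \<circ> \<tau>) n \<in> closure (v ` {N..})"
          using eventually_ge_at_top[of N]
        proof eventually_elim
          case (elim n)
          have "N \<le> \<sigma> (\<tau> n)"
            using elim strict_mono_imp_increasing[OF \<sigma>(1), of "\<tau> n"]
              strict_mono_imp_increasing[OF l(1), of n] by linarith
          then show ?case by (auto intro!: subsetD[OF closure_subset])
        qed
        then show "l \<in> closure (v ` {N..})"
          using l(2) Lim_in_closed_set[OF closed_closure] by (metis sequentially_bot)
      qed
      then have "\<beta> < p \<bullet> l" by (intro p(2) hull_inc)
      moreover have "p \<bullet> l \<le> \<beta>"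
        by (rule tendsto_upperbound[OF tendsto_inner[OF tendsto_const l(2)]])
          (auto intro!: always_eventually less_imp_le[OF \<sigma>(2)])
      ultimately show False by simp
    qed
    then obtain N where N: "\<And>k. k \<ge> N \<Longrightarrow> \<beta> \<le> p \<bullet> v k" by blast
    have "closure (convex hull (v ` {N..})) \<subseteq> {x. \<beta> \<le> p \<bullet> x}"
      using N by (intro closure_minimal hull_minimal)
        (auto simp: closed_halfspace_ge convex_halfspace_ge)
    with w[of N] p(1) show False by auto
  qed
  also have "\<dots> \<subseteq> C"
    using \<open>L \<subseteq> C\<close> \<open>convex C\<close> by (rule hull_minimal)
  finally show ?thesis .
qed

text \<open>Midpoints suffice for the parallelogram argument below, and no coefficient bookkeeping is
  needed; the function type is not an instance of \<open>real_vector\<close>, so \<open>convex hull\<close> is not available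
  on it.\<close>

inductive_set midpoint_tail :: "(nat \<Rightarrow> 'a \<Rightarrow> 'b::real_vector) \<Rightarrow> nat \<Rightarrow> ('a \<Rightarrow> 'b) set"
  for \<phi> N where
  base: "k \<ge> N \<Longrightarrow> \<phi> k \<in> midpoint_tail \<phi> N"
| mid: "u \<in> midpoint_tail \<phi> N \<Longrightarrow> w \<in> midpoint_tail \<phi> N \<Longrightarrow>
    (\<lambda>x. (1/2) *\<^sub>R (u x + w x)) \<in> midpoint_tail \<phi> N"

lemma midpoint_tail_antimono:
  assumes "M \<le> N" shows "midpoint_tail \<phi> N \<subseteq> midpoint_tail \<phi> M"
proof
  fix u assume "u \<in> midpoint_tail \<phi> N"
  then show "u \<in> midpoint_tail \<phi> M"
    by induction (use assms in \<open>auto intro: midpoint_tail.intros\<close>)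
qed

lemma midpoint_in_convex:
  assumes "convex C" "u \<in> C" "w \<in> C"
  shows "(1/2) *\<^sub>R (u + w) \<in> C"
  using convexD[OF assms, of "1/2" "1/2"] by (simp add: scaleR_add_right)

lemma midpoint_tail_hull:
  assumes "u \<in> midpoint_tail \<phi> N"
  shows "u x \<in> convex hull ((\<lambda>k. \<phi> k x) ` {N..})"
  using assms by induction (auto intro: hull_inc midpoint_in_convex)

text \<open>Near-minimizers over the tails of \<open>q u = \<integral> \<bar>u\<bar>\<^sup>2 / (1 + \<bar>h\<bar>)\<close>, which is finite because
  \<open>\<bar>u\<bar> \<le> h\<close>, form a Cauchy sequence by the parallelogram law. The weight keeps the argument valid for
  an \<open>h\<close> that is only integrable.\<close>

lemma dominated_mazur:
  fixes \<phi> :: "nat \<Rightarrow> 'a \<Rightarrow> 'b::euclidean_space"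
  assumes meas[measurable]: "\<And>k. \<phi> k \<in> borel_measurable M"
    and dom: "\<And>k. AE x in M. norm (\<phi> k x) \<le> h x"
    and h[measurable]: "integrable M h"
  obtains \<psi> where "integrable M \<psi>" "AE x in M. norm (\<psi> x) \<le> h x"
    "\<And>N. AE x in M. \<psi> x \<in> closure (convex hull ((\<lambda>k. \<phi> k x) ` {N..}))"
    "\<And>A l. A \<in> sets M \<Longrightarrow> (\<lambda>k. (\<integral>x. indicator A x *\<^sub>R \<phi> k x \<partial>M)) \<longlonglongrightarrow> l \<Longrightarrow>
       (\<integral>x. indicator A x *\<^sub>R \<psi> x \<partial>M) = l"
proof -
  have hm[measurable]: "h \<in> borel_measurable M" using h by auto
  have ae: "AE x in M. \<forall>k. norm (\<phi> k x) \<le> h x"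
    using dom by (simp add: AE_all_countable)
  let ?H = "midpoint_tail \<phi>"
  have Hm[measurable]: "u \<in> borel_measurable M" if "u \<in> ?H N" for u N
    using that by induction auto
  have Hb: "norm (u x) \<le> h x" if "u \<in> ?H N" "\<forall>k. norm (\<phi> k x) \<le> h x" for u N x
  proof -
    have "u x \<in> convex hull ((\<lambda>k. \<phi> k x) ` {N..})"
      by (rule midpoint_tail_hull[OF that(1)])
    also have "\<dots> \<subseteq> cball 0 (h x)"
      by (intro hull_minimal) (use that(2) in auto)
    finally show ?thesis by simp
  qed
  define q where "q u = (\<integral>x. (norm (u x))\<^sup>2 / (1 + \<bar>h x\<bar>) \<partial>M)" for u :: "'a \<Rightarrow> 'b"
  have qint: "integrable M (\<lambda>x. (norm (u x))\<^sup>2 / (1 + \<bar>h x\<bar>))"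
    if [measurable]: "u \<in> borel_measurable M" and "\<And>x. \<forall>k. norm (\<phi> k x) \<le> h x \<Longrightarrow> norm (u x) \<le> h x" for u
  proof (rule Bochner_Integration.integrable_bound[OF h])
    show "AE x in M. norm ((norm (u x))\<^sup>2 / (1 + \<bar>h x\<bar>)) \<le> norm (h x)"
      using ae
    proof eventually_elim
      case (elim x)
      then have "norm (u x) \<le> h x" by (rule that(2))
      \<comment> \<open>Dividing this by the weight leaves an integrand of at most
        \<open>\<bar>h x\<bar>\<close>.\<close>
      then have "(norm (u x))\<^sup>2 \<le> \<bar>h x\<bar> * (1 + \<bar>h x\<bar>)"
        unfolding power2_eq_square by (intro mult_mono) auto
      then show ?case by (simp add: pos_divide_le_eq)
    qed
  qed auto
  have q0: "q u \<ge> 0" for u unfolding q_def by simp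
  have par: "q (\<lambda>x. (1/2) *\<^sub>R (u x + w x)) + q (\<lambda>x. (1/2) *\<^sub>R (u x - w x)) = (q u + q w) / 2"
    if u: "u \<in> ?H N" and w: "w \<in> ?H K" for u w N K
  proof -
    note [measurable] = Hm[OF u] Hm[OF w]
    have n: "norm ((1/2) *\<^sub>R (u x + w x)) \<le> h x" "norm ((1/2) *\<^sub>R (u x - w x)) \<le> h x"
      if "\<forall>k. norm (\<phi> k x) \<le> h x" for x
      using Hb[OF u that] Hb[OF w that] norm_triangle_ineq[of "u x" "w x"]
        norm_triangle_ineq4[of "u x" "w x"] by auto
    have i1: "integrable M (\<lambda>x. (norm ((1/2) *\<^sub>R (u x + w x)))\<^sup>2 / (1 + \<bar>h x\<bar>))"
      by (intro qint n(1)) auto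
    have i2: "integrable M (\<lambda>x. (norm ((1/2) *\<^sub>R (u x - w x)))\<^sup>2 / (1 + \<bar>h x\<bar>))"
      by (intro qint n(2)) auto
    have i3: "integrable M (\<lambda>x. (norm (u x))\<^sup>2 / (1 + \<bar>h x\<bar>))"
      by (intro qint Hb[OF u]) auto
    have i4: "integrable M (\<lambda>x. (norm (w x))\<^sup>2 / (1 + \<bar>h x\<bar>))"
      by (intro qint Hb[OF w]) auto
    have e: "(norm ((1/2) *\<^sub>R (u x + w x)))\<^sup>2 / (1 + \<bar>h x\<bar>) + (norm ((1/2) *\<^sub>R (u x - w x)))\<^sup>2 / (1 + \<bar>h x\<bar>)
      = ((norm (u x))\<^sup>2 / (1 + \<bar>h x\<bar>) + (norm (w x))\<^sup>2 / (1 + \<bar>h x\<bar>)) / 2" for x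
      unfolding add_divide_distrib[symmetric] power2_norm_eq_inner
      by (simp add: inner_simps inner_commute field_simps)
    show ?thesis
      unfolding q_def Bochner_Integration.integral_add[OF i1 i2, symmetric]
        Bochner_Integration.integral_add[OF i3 i4, symmetric] e by simp
  qed
  \<comment> \<open>The tails shrink, so these infima increase; their limit D makes near-minimizers
    taken from different tails comparable.\<close>
  define d where "d N = (INF u\<in>?H N. q u)" for N
  have bb: "bdd_below (q ` ?H N)" for N using q0 by (intro bdd_belowI2[of _ 0]) auto
  have ne: "?H N \<noteq> {}" for N using midpoint_tail.base[of N N \<phi>] by auto
  have dle: "d N \<le> q u" if "u \<in> ?H N" for u N
    unfolding d_def using that bb by (intro cINF_lower) auto
  have "incseq d"
    unfolding d_def
    by (intro incseq_SucI cINF_superset_mono ne bb midpoint_tail_antimono) auto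
  moreover have "d N \<le> (\<integral>x. \<bar>h x\<bar> \<partial>M)" for N
  proof -
    have "d N \<le> q (\<phi> N)" by (intro dle midpoint_tail.base) auto
    also have "\<dots> \<le> (\<integral>x. \<bar>h x\<bar> \<partial>M)"
      unfolding q_def
    proof (rule integral_mono_AE)
      show "integrable M (\<lambda>x. (norm (\<phi> N x))\<^sup>2 / (1 + \<bar>h x\<bar>))" by (intro qint) auto
      show "AE x in M. (norm (\<phi> N x))\<^sup>2 / (1 + \<bar>h x\<bar>) \<le> \<bar>h x\<bar>"
        using ae
      proof eventually_elim
        case (elim x)
        then have "norm (\<phi> N x) \<le> h x" by blast
        then have "(norm (\<phi> N x))\<^sup>2 \<le> \<bar>h x\<bar> * (1 + \<bar>h x\<bar>)"
          unfolding power2_eq_square by (intro mult_mono) auto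
        then show ?case by (simp add: pos_divide_le_eq)
      qed
    qed (use h in auto)
    finally show ?thesis .
  qed
  ultimately obtain D where D: "d \<longlonglongrightarrow> D" "\<And>N. d N \<le> D"
    using incseq_convergent by blast
  have exN: "\<exists>N\<ge>K. D - d N < e" if "e > 0" for K e
  proof -
    from order_tendstoD(1)[OF D(1), of "D - e"] that
    have "\<forall>\<^sub>F N in sequentially. D - e < d N" by simp
    with eventually_ge_at_top[of K] have "\<forall>\<^sub>F N in sequentially. N \<ge> K \<and> D - d N < e"
      by eventually_elim auto
    then show ?thesis unfolding eventually_sequentially by auto
  qed
  \<comment> \<open>The rate 1/4 leaves room for the factor 2^j inserted below, which converts
    smallness of integrals into geometric decay at a point.\<close>
  have "\<exists>\<nu>. \<forall>j. D - d (\<nu> j) < (1/4)^j \<and> \<nu> j < \<nu> (Suc j)"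
  proof (rule dependent_nat_choice)
    show "\<exists>x. D - d x < (1/4)^0" using exN[of 1 0] by auto
    show "\<exists>y. D - d y < (1/4)^Suc n \<and> x < y" for x n
      using exN[of "(1/4)^Suc n" "Suc x"] by (auto simp: Suc_le_eq)
  qed
  then obtain \<nu> where \<nu>: "\<And>j. D - d (\<nu> j) < (1/4)^j" "\<And>j. \<nu> j < \<nu> (Suc j)" by blast
  then have sm: "strict_mono \<nu>" by (simp add: strict_mono_Suc_iff)
  have "\<exists>u\<in>?H (\<nu> j). q u < d (\<nu> j) + (1/4)^j" for j
    using cINF_less_iff[OF ne bb, of "\<nu> j" "d (\<nu> j) + (1/4)^j"] unfolding d_def by simp
  then obtain w where w: "\<And>j. w j \<in> ?H (\<nu> j)" "\<And>j. q (w j) < d (\<nu> j) + (1/4)^j"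
    by metis
  note wm[measurable] = Hm[OF w(1)]
  define e where "e j x = (norm ((1/2) *\<^sub>R (w j x - w (Suc j) x)))\<^sup>2 / (1 + \<bar>h x\<bar>)" for j x
  have e0: "0 \<le> e j x" for j x unfolding e_def by simp
  have ei: "integrable M (e j)" for j
    unfolding e_def
  proof (rule qint)
    fix x assume a: "\<forall>k. norm (\<phi> k x) \<le> h x"
    show "norm ((1/2) *\<^sub>R (w j x - w (Suc j) x)) \<le> h x"
      using Hb[OF w(1) a, of j] Hb[OF w(1) a, of "Suc j"] norm_triangle_ineq4[of "w j x" "w (Suc j) x"]
      by auto
  qed auto
  \<comment> \<open>Both near-minimizers belong to the earlier tail, hence so does their midpoint,
    whose q is at least \<open>d (\<nu> j)\<close>. By the parallelogram law little is left for the
    difference.\<close>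
  have eq: "(\<integral>x. e j x \<partial>M) \<le> 2 * (1/4)^j" for j
  proof -
    have w': "w (Suc j) \<in> ?H (\<nu> j)"
      using midpoint_tail_antimono[of "\<nu> j" "\<nu> (Suc j)"] w(1)[of "Suc j"] \<nu>(2)[of j] by auto
    have "(\<integral>x. e j x \<partial>M) = (q (w j) + q (w (Suc j))) / 2 - q (\<lambda>x. (1/2) *\<^sub>R (w j x + w (Suc j) x))"
    proof -
      have "(\<integral>x. e j x \<partial>M) = q (\<lambda>x. (1/2) *\<^sub>R (w j x - w (Suc j) x))"
        unfolding q_def e_def ..
      with par[OF w(1) w', of j] show ?thesis by linarith
    qed
    moreover have "d (\<nu> j) \<le> q (\<lambda>x. (1/2) *\<^sub>R (w j x + w (Suc j) x))"
      by (intro dle midpoint_tail.mid w(1) w')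
    moreover have "q (w (Suc j)) < D + (1/4)^j"
    proof -
      have "(1/4::real)^Suc j \<le> (1/4)^j" by simp
      with w(2)[of "Suc j"] D(2)[of "\<nu> (Suc j)"] show ?thesis by linarith
    qed
    moreover have "q (w j) < d (\<nu> j) + (1/4)^j" "D - d (\<nu> j) < (1/4)^j"
      using w(2) \<nu>(1) by auto
    moreover have "(1/4::real)^j \<ge> 0" by simp
    \<comment> \<open>The arithmetic alone: the sum is below (D' - e') / 2 + p, hence below 3p/2,
      with p standing for (1/4)^j.\<close>
    moreover have "x \<le> 2 * p" if "x = (a + b) / 2 - c" "e' \<le> c" "b < D' + p" "a < e' + p" "D' - e' < p" "p \<ge> 0"
      for x a b c p D' e' :: real
    proof -
      have "2 * x = a + b - 2 * c" using that(1) by simp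
      then show ?thesis using that(2-) by linarith
    qed
    ultimately show ?thesis by blast
  qed
  have s2: "summable (\<lambda>j. 2^j * (2 * (1/4)^j) :: real)"
  proof -
    have "(\<lambda>j. 2^j * (2 * (1/4)^j) :: real) = (\<lambda>j. 2 * (1/2)^j)"
      by (rule ext) (simp add: power_one_over field_simps flip: power_mult_distrib)
    then show ?thesis by (simp add: summable_mult summable_geometric)
  qed
  \<comment> \<open>The integrals of 2^j e_j are summable, so the series itself converges at almost
    every x. There 2^j e_j is bounded, and consecutive w_j differ by at most a constant times
    sqrt(1/2)^j; the weight is only a constant once x is fixed.\<close>
  have "AE x in M. summable (\<lambda>j. 2^j * e j x)"
  proof -
    have "(\<integral>\<^sup>+x. (\<Sum>j. ennreal (2^j * e j x)) \<partial>M) = (\<Sum>j. (\<integral>\<^sup>+x. ennreal (2^j * e j x) \<partial>M))"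
      by (rule nn_integral_suminf) (simp add: e_def)
    also have "\<dots> = (\<Sum>j. ennreal (2^j * (\<integral>x. e j x \<partial>M)))"
      by (subst nn_integral_eq_integral) (use ei e0 in auto)
    also have "\<dots> \<le> (\<Sum>j. ennreal (2^j * (2 * (1/4)^j)))"
      by (intro suminf_le allI ennreal_leI mult_left_mono eq) auto
    also have "\<dots> = ennreal (\<Sum>j. 2^j * (2 * (1/4)^j))"
      by (rule suminf_ennreal2) (use s2 in auto)
    also have "\<dots> < \<infinity>" by simp
    finally have "AE x in M. (\<Sum>j. ennreal (2^j * e j x)) \<noteq> \<infinity>"
      by (intro nn_integral_PInf_AE) (auto simp: e_def)
    then show ?thesis
      by eventually_elim (auto intro!: summable_suminf_not_top e0 mult_nonneg_nonneg)
  qed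
  then have conv: "AE x in M. convergent (\<lambda>j. w j x)"
  proof eventually_elim
    case (elim x)
    from summable_LIMSEQ_zero[OF elim] have "bounded (range (\<lambda>j. 2^j * e j x))"
      using convergent_imp_bounded by blast
    then obtain B where B: "\<And>j. 2^j * e j x \<le> B" "B > 0"
      unfolding bounded_pos by (auto simp: abs_le_iff)
    have "norm (w (Suc j) x - w j x) \<le> sqrt (4 * B * (1 + \<bar>h x\<bar>)) * sqrt (1/2) ^ j" for j
    proof -
      have "2^j * ((norm (w (Suc j) x - w j x))\<^sup>2 / 4 / (1 + \<bar>h x\<bar>)) \<le> B"
        using B(1)[of j] unfolding e_def by (simp add: norm_minus_commute power_divide power_mult_distrib)
      then have "(norm (w (Suc j) x - w j x))\<^sup>2 \<le> 4 * B * (1 + \<bar>h x\<bar>) * (1/2)^j"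
        by (simp add: field_simps power_one_over add_nonneg_pos)
      then have "norm (w (Suc j) x - w j x) \<le> sqrt (4 * B * (1 + \<bar>h x\<bar>) * (1/2)^j)"
        by (rule real_le_rsqrt)
      then show ?thesis by (simp add: real_sqrt_mult real_sqrt_power)
    qed
    moreover have "summable (\<lambda>j. sqrt (4 * B * (1 + \<bar>h x\<bar>)) * sqrt (1/2) ^ j)"
      by (intro summable_mult summable_geometric) simp
    ultimately have "summable (\<lambda>j. w (Suc j) x - w j x)"
      by (rule summable_comparison_test'[where N = 0, rotated])
    then have "convergent (\<lambda>n. \<Sum>j<n. w (Suc j) x - w j x)"
      by (simp add: summable_iff_convergent)
    then have "convergent (\<lambda>n. w n x - w 0 x)"
      by (simp add: sum_lessThan_telescope[of "\<lambda>j. w j x"])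
    then show ?case by (simp add: convergent_diff_const_right_iff)
  qed
  define \<psi> where "\<psi> x = lim (\<lambda>j. w j x)" for x
  have [measurable]: "\<psi> \<in> borel_measurable M"
    unfolding \<psi>_def by (rule borel_measurable_lim_metric) auto
  have lim: "AE x in M. (\<lambda>j. w j x) \<longlonglongrightarrow> \<psi> x"
    using conv unfolding \<psi>_def by (simp add: convergent_LIMSEQ_iff)
  have wb: "AE x in M. norm (w j x) \<le> h x" for j
    using ae by eventually_elim (rule Hb[OF w(1)])
  have "integrable M \<psi>"
    by (rule integrable_dominated_convergence[OF _ _ h lim wb]) auto
  moreover have "AE x in M. norm (\<psi> x) \<le> h x"
    using ae lim
  proof eventually_elim
    case (elim x)
    show ?case
      by (rule tendsto_upperbound[OF tendsto_norm[OF elim(2)]]) (use Hb[OF w(1) elim(1)] in auto)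
  qed
  moreover have "AE x in M. \<psi> x \<in> closure (convex hull ((\<lambda>k. \<phi> k x) ` {N..}))" for N
    using lim
  proof eventually_elim
    case (elim x)
    have "\<forall>\<^sub>F j in sequentially. w j x \<in> closure (convex hull ((\<lambda>k. \<phi> k x) ` {N..}))"
      using eventually_ge_at_top[of N]
    proof eventually_elim
      case (elim j)
      have "N \<le> \<nu> j" using elim strict_mono_imp_increasing[OF sm, of j] by linarith
      then have "convex hull ((\<lambda>k. \<phi> k x) ` {\<nu> j..}) \<subseteq> convex hull ((\<lambda>k. \<phi> k x) ` {N..})"
        by (intro hull_mono image_mono) auto
      then show ?case
        using midpoint_tail_hull[OF w(1)[of j], of x] closure_subset by blast
    qed
    then show ?case
      using elim Lim_in_closed_set[OF closed_closure] by (metis sequentially_bot)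
  qed
  moreover have "(\<integral>x. indicator A x *\<^sub>R \<psi> x \<partial>M) = l"
    if [measurable]: "A \<in> sets M" and l: "(\<lambda>k. (\<integral>x. indicator A x *\<^sub>R \<phi> k x \<partial>M)) \<longlonglongrightarrow> l" for A l
  proof -
    have ib: "integrable M (\<lambda>x. indicator A x *\<^sub>R u x)" if u: "u \<in> ?H N" for u N
    proof (rule Bochner_Integration.integrable_bound[OF h])
      show "AE x in M. norm (indicator A x *\<^sub>R u x) \<le> norm (h x)"
        using ae
      proof eventually_elim
        case (elim x)
        then have "norm (u x) \<le> h x" by (rule Hb[OF u])
        then show ?case by (auto simp: indicator_def)
      qed
    qed (use Hm[OF u] in auto)
    have "(\<lambda>j. (\<integral>x. indicator A x *\<^sub>R w j x \<partial>M)) \<longlonglongrightarrow> (\<integral>x. indicator A x *\<^sub>R \<psi> x \<partial>M)"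
    proof (rule integral_dominated_convergence)
      show "AE x in M. (\<lambda>j. indicator A x *\<^sub>R w j x) \<longlonglongrightarrow> indicator A x *\<^sub>R \<psi> x"
        using lim by eventually_elim (rule tendsto_scaleR[OF tendsto_const])
      show "AE x in M. norm (indicator A x *\<^sub>R w j x) \<le> \<bar>h x\<bar>" for j
        using wb[of j] by eventually_elim (auto simp: indicator_def)
    qed (use h in auto)
    moreover have "(\<lambda>j. (\<integral>x. indicator A x *\<^sub>R w j x \<partial>M)) \<longlonglongrightarrow> l"
    proof (rule LIMSEQ_I)
      fix \<epsilon> :: real assume "\<epsilon> > 0"
      then obtain N where N: "\<And>k. k \<ge> N \<Longrightarrow> dist (\<integral>x. indicator A x *\<^sub>R \<phi> k x \<partial>M) l < \<epsilon>"
        using l unfolding lim_sequentially by blast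
      \<comment> \<open>The integral is linear and a ball is convex, so closeness to l passes from
        the functions of the tail to all their iterated midpoints.\<close>
      have tail: "(\<integral>x. indicator A x *\<^sub>R u x \<partial>M) \<in> ball l \<epsilon>" if "u \<in> ?H N" for u
        using that
      proof induction
        case (base k)
        then show ?case using N[of k] by (simp add: dist_commute)
      next
        case (mid u v)
        have "(\<integral>x. indicator A x *\<^sub>R ((1/2) *\<^sub>R (u x + v x)) \<partial>M)
          = (\<integral>x. (1/2) *\<^sub>R (indicator A x *\<^sub>R u x + indicator A x *\<^sub>R v x) \<partial>M)"
          by (intro Bochner_Integration.integral_cong) (auto simp: algebra_simps)
        also have "\<dots> = (1/2) *\<^sub>R ((\<integral>x. indicator A x *\<^sub>R u x \<partial>M) + (\<integral>x. indicator A x *\<^sub>R v x \<partial>M))"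
          using ib[OF mid.hyps(1)] ib[OF mid.hyps(2)] by simp
        also have "\<dots> \<in> ball l \<epsilon>"
          by (intro midpoint_in_convex convex_ball mid.IH)
        finally show ?case .
      qed
      have "norm ((\<integral>x. indicator A x *\<^sub>R w j x \<partial>M) - l) < \<epsilon>" if "j \<ge> N" for j
      proof -
        have "N \<le> \<nu> j" using that strict_mono_imp_increasing[OF sm, of j] by linarith
        then have "w j \<in> ?H N" using midpoint_tail_antimono w(1)[of j] by blast
        from tail[OF this] show ?thesis by (simp add: dist_norm norm_minus_commute)
      qed
      then show "\<exists>no. \<forall>j\<ge>no. norm ((\<integral>x. indicator A x *\<^sub>R w j x \<partial>M) - l) < \<epsilon>" by blast
    qed
    ultimately show ?thesis by (rule LIMSEQ_unique)
  qed
  ultimately show thesis by (rule that)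
qed

section \<open>Absolutely continuous functions\<close>

lemma AE_lebesgue_on_iff:
  assumes "S \<in> sets lebesgue"
  shows "(AE t in lebesgue_on S. P t) \<longleftrightarrow> (AE t in lebesgue. t \<in> S \<longrightarrow> P t)"
  using assms by (simp add: AE_restrict_space_iff)

lemma absolutely_integrable_on_iff:
  assumes "S \<in> sets lebesgue"
  shows "f absolutely_integrable_on S \<longleftrightarrow> integrable (lebesgue_on S) f"
  using assms unfolding set_integrable_def by (simp add: integrable_restrict_space)

lemma norm_integral_le_AE:
  fixes v :: "real \<Rightarrow> 'b::euclidean_space"
  assumes v: "v absolutely_integrable_on S" and h: "h absolutely_integrable_on S"
    and S: "S \<in> sets lebesgue"
    and le: "AE t in lebesgue. t \<in> S \<longrightarrow> norm (v t) \<le> h t"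
  shows "norm (integral S v) \<le> integral S h"
proof -
  have iv: "integrable (lebesgue_on S) v" and ih: "integrable (lebesgue_on S) h"
    using v h S by (auto simp: absolutely_integrable_on_iff)
  have "norm (LINT t|lebesgue_on S. v t) \<le> (LINT t|lebesgue_on S. norm (v t))"
    by (rule integral_norm_bound)
  also have "\<dots> \<le> (LINT t|lebesgue_on S. h t)"
    by (rule integral_mono_AE) (use iv ih le S in \<open>auto simp: AE_lebesgue_on_iff\<close>)
  finally show ?thesis
    using lebesgue_integral_eq_integral[OF iv S] lebesgue_integral_eq_integral[OF ih S] by simp
qed

lemma AE_negligibleI:
  assumes "negligible N" "\<And>t. t \<notin> N \<Longrightarrow> P t"
  shows "AE t in lebesgue. P t"
proof (rule AE_I')
  show "N \<in> null_sets lebesgue" using assms(1) by (simp add: negligible_iff_null_sets)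
qed (use assms(2) in auto)

lemma AE_negligibleE:
  assumes "AE t in lebesgue. P t"
  obtains N :: "'a::euclidean_space set" where "negligible N" "\<And>t. t \<notin> N \<Longrightarrow> P t"
proof -
  from AE_E[OF assms] obtain N where "{x \<in> space lebesgue. \<not> P x} \<subseteq> N" "emeasure lebesgue N = 0" "N \<in> sets lebesgue"
    by metis
  then show thesis
    by (intro that[of N]) (auto simp: negligible_iff_null_sets null_sets_def)
qed

section \<open>Lebesgue differentiation and the fundamental theorem of calculus for absolutely
  continuous functions\<close>

lemma integrable_right_derivative:
  fixes f :: "real \<Rightarrow> 'b::euclidean_space"
  assumes "\<And>c d. f integrable_on {c..d}"
  obtains N where "negligible N"
    "\<And>x e. x \<notin> N \<Longrightarrow> 0 < e \<Longrightarrow>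
       \<exists>d>0. \<forall>h. 0 < h \<and> h < d \<longrightarrow> norm (integral {x..x+h} f /\<^sub>R h - f x) < e"
  using integrable_ccontinuous_explicit[of f] assms unfolding cbox_interval by auto

text \<open>Right derivatives come from \<open>integrable_right_derivative\<close>. A left
  derivative at t is a right derivative at -t of the reflected integrand, so a second exceptional
  set has to be reflected back and added.\<close>

theorem AE_indefinite_integral_derivative:
  fixes f :: "real \<Rightarrow> 'b::euclidean_space"
  assumes f: "f absolutely_integrable_on {a..b}"
  shows "AE t in lebesgue. t \<in> {a<..<b} \<longrightarrow>
    ((\<lambda>s. integral {a..s} f) has_vector_derivative f t) (at t)"
proof -
  \<comment> \<open>Extension by zero gives integrability on every interval, as the lemma on right
    derivatives requires.\<close>
  define F where "F t = (if t \<in> {a..b} then f t else 0)" for t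
  have Fi: "F integrable_on {c..d}" for c d
  proof -
    have "F integrable_on UNIV"
      unfolding F_def integrable_restrict_UNIV using f by (rule set_lebesgue_integral_eq_integral(1))
    then show ?thesis by (rule integrable_on_subinterval) auto
  qed
  define G where "G = (\<lambda>t. F (- t))"
  have Gi: "G integrable_on {c..d}" for c d
    unfolding G_def
    using Fi[of "-d" "-c"] Henstock_Kurzweil_Integration.integrable_reflect_real[of F "-c" "-d"] by simp
  obtain N1 where N1: "negligible N1"
    "\<And>x e. x \<notin> N1 \<Longrightarrow> 0 < e \<Longrightarrow> \<exists>d>0. \<forall>h. 0 < h \<and> h < d \<longrightarrow> norm (integral {x..x+h} F /\<^sub>R h - F x) < e"
    using integrable_right_derivative[of F, OF Fi] by blast
  obtain N2 where N2: "negligible N2"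
    "\<And>x e. x \<notin> N2 \<Longrightarrow> 0 < e \<Longrightarrow> \<exists>d>0. \<forall>h. 0 < h \<and> h < d \<longrightarrow> norm (integral {x..x+h} G /\<^sub>R h - G x) < e"
    using integrable_right_derivative[of G, OF Gi] by blast
  have "negligible (uminus ` N2)"
    using N2(1) by (intro negligible_differentiable_image_negligible) (auto intro: derivative_intros)
  with N1(1) have "negligible (N1 \<union> uminus ` N2)" by simp
  then show ?thesis
  proof (rule AE_negligibleI, intro impI)
    fix t assume t: "t \<notin> N1 \<union> uminus ` N2" and tab: "t \<in> {a<..<b}"
    then have tN: "t \<notin> N1" "- t \<notin> N2" by force+
    have fi: "f integrable_on {c..d}" if "a \<le> c" "d \<le> b" for c d
      using integrable_on_subinterval[OF set_lebesgue_integral_eq_integral(1)[OF f], of c d] that by auto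
    have eqF: "integral {c..d} f = integral {c..d} F" if "a \<le> c" "d \<le> b" for c d
      using that by (intro integral_cong) (auto simp: F_def)
    show "((\<lambda>s. integral {a..s} f) has_vector_derivative f t) (at t)"
      unfolding has_vector_derivative_def has_derivative_at_alt
    proof (intro conjI allI impI)
      show "bounded_linear (\<lambda>x. x *\<^sub>R f t)" by (rule bounded_linear_scaleR_left)
      fix e :: real assume "e > 0"
      obtain d1 where d1: "d1 > 0" "\<And>h. 0 < h \<Longrightarrow> h < d1 \<Longrightarrow> norm (integral {t..t+h} F /\<^sub>R h - F t) < e"
        using N1(2)[OF tN(1) \<open>e > 0\<close>] by blast
      obtain d2 where d2: "d2 > 0" "\<And>h. 0 < h \<Longrightarrow> h < d2 \<Longrightarrow> norm (integral {-t..-t+h} G /\<^sub>R h - G (-t)) < e"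
        using N2(2)[OF tN(2) \<open>e > 0\<close>] by blast
      \<comment> \<open>The last two terms keep y inside the interval, where F and f agree.\<close>
      define d where "d = min (min d1 d2) (min (t - a) (b - t))"
      have key: "norm (J - h *\<^sub>R u) \<le> e * h" if "norm (J /\<^sub>R h - u) < e" "0 < h" for J u :: 'b and h
      proof -
        have "J - h *\<^sub>R u = h *\<^sub>R (J /\<^sub>R h - u)" using that(2) by (simp add: algebra_simps)
        then have "norm (J - h *\<^sub>R u) = h * norm (J /\<^sub>R h - u)" using that(2) by simp
        then show ?thesis using that by (simp add: mult.commute)
      qed
      have "norm (integral {a..y} f - integral {a..t} f - (y - t) *\<^sub>R f t) \<le> e * norm (y - t)"
        if y: "norm (y - t) < d" for y
      proof -
        consider "y = t" | "y > t" | "y < t" by linarith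
        then show ?thesis
        proof cases
          case 2
          have "integral {a..y} f - integral {a..t} f = integral {t..y} F"
            using Henstock_Kurzweil_Integration.integral_combine[of a t y f] 2 y tab fi[of a y] eqF[of t y]
            unfolding d_def by (auto simp: eq_diff_eq' algebra_simps)
          moreover have "norm (integral {t..y} F /\<^sub>R (y - t) - F t) < e"
            using d1(2)[of "y - t"] 2 y unfolding d_def by auto
          ultimately show ?thesis
            using key[where J = "integral {t..y} F" and u = "F t" and h = "y - t"] 2 tab by (auto simp: F_def)
        next
          case 3
          have "integral {a..t} f - integral {a..y} f = integral {y..t} F"
            using Henstock_Kurzweil_Integration.integral_combine[of a y t f] 3 y tab fi[of a t] eqF[of y t]
            unfolding d_def by (auto simp: eq_diff_eq' algebra_simps)
          also have "\<dots> = integral {-t..-y} G"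
            unfolding G_def by (rule Henstock_Kurzweil_Integration.integral_reflect_real[symmetric])
          finally have I: "integral {a..t} f - integral {a..y} f = integral {-t..-y} G" .
          have "norm (integral {-t..-y} G /\<^sub>R (t - y) - G (-t)) < e"
            using d2(2)[of "t - y"] 3 y unfolding d_def by auto
          moreover have "G (- t) = f t" using tab by (auto simp: G_def F_def)
          ultimately have "norm (integral {a..t} f - integral {a..y} f - (t - y) *\<^sub>R f t) \<le> e * (t - y)"
            using key[where J = "integral {-t..-y} G" and u = "G (-t)" and h = "t - y"] 3 I by simp
          moreover have "integral {a..t} f - integral {a..y} f - (t - y) *\<^sub>R f t
            = - (integral {a..y} f - integral {a..t} f - (y - t) *\<^sub>R f t)"
            by (simp add: algebra_simps)
          ultimately show ?thesis using 3 by (simp only: norm_minus_cancel) simp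
        qed simp
      qed
      moreover have "d > 0" using d1 d2 tab unfolding d_def by auto
      ultimately show "\<exists>d>0. \<forall>y. norm (y - t) < d \<longrightarrow>
          norm (integral {a..y} f - integral {a..t} f - (y - t) *\<^sub>R f t) \<le> e * norm (y - t)"
        by blast
    qed
  qed
qed

text \<open>Tags in the exceptional null set are controlled by an open cover of small measure and absolute
  continuity, all other tags by differentiability.\<close>

theorem abs_continuous_on_has_integral:
  fixes x :: "real \<Rightarrow> 'b::euclidean_space"
  assumes "a \<le> b" and ac: "abs_continuous_on {a..b} x"
    and der: "AE t in lebesgue. t \<in> {a..b} \<longrightarrow> (x has_vector_derivative v t) (at t within {a..b})"
  shows "(v has_integral (x b - x a)) {a..b}"
proof -
  obtain N where N: "negligible N"
    "\<And>t. t \<notin> N \<Longrightarrow> t \<in> {a..b} \<Longrightarrow> (x has_vector_derivative v t) (at t within {a..b})"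
    using AE_negligibleE[OF der] by metis
  \<comment> \<open>With the value 0 at exceptional tags, their terms in a Riemann sum reduce to
    increments of x, which absolute continuity can control.\<close>
  define v' where "v' t = (if t \<in> N then 0 else v t)" for t
  have "(v' has_integral (x b - x a)) {a..b}"
    unfolding has_integral_real
  proof (intro allI impI)
    fix e :: real assume "e > 0"
    from ac[unfolded abs_continuous_on_def, THEN spec, THEN spec, THEN mp, OF order_refl,
        THEN spec, of "e / 2"] \<open>e > 0\<close>
    obtain \<eta> where \<eta>: "\<eta> > 0"
      "\<And>(k::nat) l u. (\<forall>i<k. a \<le> l i \<and> l i \<le> u i \<and> u i \<le> b) \<and>
         disjoint_family_on (\<lambda>i. {l i<..<u i}) {..<k} \<and> (\<Sum>i<k. u i - l i) < \<eta> \<Longrightarrow>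
         (\<Sum>i<k. norm (x (u i) - x (l i))) < e / 2"
      by auto
    have Ns: "N \<in> null_sets lebesgue" using N(1) by (simp add: negligible_iff_null_sets)
    obtain U where U: "open U" "N \<subseteq> U" "U - N \<in> lmeasurable" "emeasure lebesgue (U - N) < ennreal \<eta>"
      using sets_lebesgue_outer_open[of N \<eta>] Ns \<eta>(1) by (metis null_setsD2)
    have mU: "U \<in> lmeasurable" "measure lebesgue U < \<eta>"
    proof -
      have "U = (U - N) \<union> N" using U(2) by auto
      then have "emeasure lebesgue U = emeasure lebesgue (U - N)"
        using emeasure_Un_null_set[OF fmeasurableD[OF U(3)] Ns] by simp
      then have em: "emeasure lebesgue U < ennreal \<eta>" using U(4) by simp
      then show "U \<in> lmeasurable"
        using U(1) by (intro fmeasurableI) (auto intro: less_trans simp: ennreal_less_top)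
      with em show "measure lebesgue U < \<eta>"
        using \<eta>(1) by (simp add: emeasure_eq_measure2 ennreal_less_iff)
    qed
    \<comment> \<open>The summand 1 keeps the denominator positive when a = b.\<close>
    define e' where "e' = e / (2 * (b - a + 1))"
    have e': "e' > 0" using \<open>e > 0\<close> \<open>a \<le> b\<close> unfolding e'_def by simp
    have "\<exists>d>0. \<forall>y. y \<in> {a..b} \<and> \<bar>y - t\<bar> < d \<longrightarrow> norm (x y - x t - (y - t) *\<^sub>R v t) \<le> e' * \<bar>y - t\<bar>"
      if "t \<notin> N" "t \<in> {a..b}" for t
    proof -
      have "\<exists>d>0. \<forall>y\<in>{a..b}. norm (y - t) < d \<longrightarrow> norm (x y - x t - (y - t) *\<^sub>R v t) \<le> e' * norm (y - t)"
        using N(2)[OF that] e' unfolding has_vector_derivative_def has_derivative_within_alt by blast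
      then show ?thesis by (simp add: Ball_def) blast
    qed
    then obtain d where d: "\<And>t. t \<notin> N \<Longrightarrow> t \<in> {a..b} \<Longrightarrow> d t > 0"
      "\<And>t y. t \<notin> N \<Longrightarrow> t \<in> {a..b} \<Longrightarrow> y \<in> {a..b} \<Longrightarrow> \<bar>y - t\<bar> < d t \<Longrightarrow>
         norm (x y - x t - (y - t) *\<^sub>R v t) \<le> e' * \<bar>y - t\<bar>"
      by metis
    \<comment> \<open>An exceptional tag forces its whole interval into U, so these intervals have
      total length below \<eta>. The third case only completes the gauge: tags of a division lie in
      the interval.\<close>
    define \<gamma> where "\<gamma> t = (if t \<in> N then U else if t \<in> {a..b} then ball t (d t) else ball t 1)" for t
    have g\<gamma>: "gauge \<gamma>"
      unfolding gauge_def \<gamma>_def using U d(1) by auto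
    have fine\<gamma>: "norm ((\<Sum>(t,K)\<in>p. measure lborel K *\<^sub>R v' t) - (x b - x a)) < e"
      if p: "p tagged_division_of {a..b}" and fine: "\<gamma> fine p" for p
    proof -
      note pD = tagged_division_ofD[OF p[folded cbox_interval]]
      have K: "\<exists>l u. K = {l..u} \<and> a \<le> l \<and> l \<le> t \<and> t \<le> u \<and> u \<le> b" if tK: "(t, K) \<in> p" for t K
      proof -
        obtain l u where lu: "K = cbox l u" using pD(4)[OF tK] by blast
        have "t \<in> K" "K \<subseteq> {a..b}" using pD(2,3)[OF tK] by auto
        then show ?thesis using lu by (auto intro!: exI[of _ l] exI[of _ u])
      qed
      have tel: "(\<Sum>(t,K)\<in>p. x (Sup K) - x (Inf K)) = x b - x a"
        by (rule additive_tagged_division_1[OF \<open>a \<le> b\<close> p])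
      define p1 where "p1 = {(t,K). (t,K) \<in> p \<and> t \<in> N}"
      define p2 where "p2 = {(t,K). (t,K) \<in> p \<and> t \<notin> N}"
      have pu: "p = p1 \<union> p2" "p1 \<inter> p2 = {}" and fin: "finite p1" "finite p2"
        using pD(1) unfolding p1_def p2_def by (auto intro: rev_finite_subset)
      have sub: "p1 \<subseteq> p" "p2 \<subseteq> p" using pu by auto
      have "(\<Sum>(t,K)\<in>p. measure lborel K *\<^sub>R v' t) - (x b - x a)
        = (\<Sum>(t,K)\<in>p. measure lborel K *\<^sub>R v' t - (x (Sup K) - x (Inf K)))"
        unfolding tel[symmetric] sum_subtractf[symmetric] by (intro sum.cong) auto
      also have "\<dots> = (\<Sum>(t,K)\<in>p1. measure lborel K *\<^sub>R v' t - (x (Sup K) - x (Inf K)))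
        + (\<Sum>(t,K)\<in>p2. measure lborel K *\<^sub>R v' t - (x (Sup K) - x (Inf K)))"
        unfolding pu(1) by (rule sum.union_disjoint[OF fin pu(2)])
      finally have split: "(\<Sum>(t,K)\<in>p. measure lborel K *\<^sub>R v' t) - (x b - x a) = \<dots>" .
      have s1: "norm (\<Sum>(t,K)\<in>p1. measure lborel K *\<^sub>R v' t - (x (Sup K) - x (Inf K))) < e / 2"
      proof -
        \<comment> \<open>Absolute continuity is stated for families indexed by an initial segment
          of the naturals, so the tagged intervals have to be enumerated.\<close>
        obtain \<beta> where \<beta>: "bij_betw \<beta> {..<card p1} p1"
          using ex_bij_betw_nat_finite[OF fin(1)] by (metis atLeast0LessThan)
        define l u where "l i = Inf (snd (\<beta> i))" and "u i = Sup (snd (\<beta> i))" for i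
        have \<beta>p1: "\<beta> i \<in> p1" if "i < card p1" for i
          using bij_betwE[OF \<beta>] that by blast
        have \<beta>p2: "(fst (\<beta> i), snd (\<beta> i)) \<in> p" if "i < card p1" for i
          unfolding prod.collapse using subsetD[OF sub(1) \<beta>p1[OF that]] .
        note \<beta>p = \<beta>p1 \<beta>p2
        have lu: "snd (\<beta> i) = {l i..u i}" "a \<le> l i" "l i \<le> u i" "u i \<le> b" if i: "i < card p1" for i
        proof -
          obtain L R where LR: "snd (\<beta> i) = {L..R}" "a \<le> L" "L \<le> fst (\<beta> i)" "fst (\<beta> i) \<le> R" "R \<le> b"
            using K[OF \<beta>p(2)[OF i]] by blast
          have "l i = L" "u i = R" using LR(3,4) unfolding l_def u_def LR(1) by simp_all
          then show "snd (\<beta> i) = {l i..u i}" "a \<le> l i" "l i \<le> u i" "u i \<le> b" using LR by simp_all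
        qed
        have inU: "{l i..u i} \<subseteq> U" if i: "i < card p1" for i
        proof -
          have "fst (\<beta> i) \<in> N" using \<beta>p(1)[OF i] unfolding p1_def by auto
          then have "\<gamma> (fst (\<beta> i)) = U" unfolding \<gamma>_def by simp
          with fineD[OF fine \<beta>p(2)[OF i]] lu(1)[OF i] show ?thesis by simp
        qed
        have dis: "disjoint_family_on (\<lambda>i. {l i<..<u i}) {..<card p1}"
          unfolding disjoint_family_on_def
        proof (intro ballI impI)
          fix i j assume ij: "i \<in> {..<card p1}" "j \<in> {..<card p1}" "i \<noteq> j"
          have "\<beta> i \<noteq> \<beta> j" using \<beta> ij unfolding bij_betw_def inj_on_def by blast
          then have "interior (snd (\<beta> i)) \<inter> interior (snd (\<beta> j)) = {}"
            using pD(5)[of "fst (\<beta> i)" "snd (\<beta> i)" "fst (\<beta> j)" "snd (\<beta> j)"] \<beta>p(2) ij by auto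
          then show "{l i<..<u i} \<inter> {l j<..<u j} = {}"
            using lu(1) ij by simp
        qed
        have "(\<Sum>i<card p1. u i - l i) = (\<Sum>i<card p1. measure lebesgue {l i<..<u i})"
          using lu(3) by (intro sum.cong) auto
        also have "\<dots> = measure lebesgue (\<Union>i<card p1. {l i<..<u i})"
          using dis by (intro measure_finite_Union[symmetric]) (auto simp: lu(3))
        also have "\<dots> \<le> measure lebesgue U"
          using inU mU(1) by (intro measure_mono_fmeasurable) (auto intro: subsetD[OF inU])
        finally have "(\<Sum>i<card p1. u i - l i) < \<eta>" using mU(2) by simp
        then have "(\<Sum>i<card p1. norm (x (u i) - x (l i))) < e / 2"
          using \<eta>(2)[of "card p1" l u] lu dis by auto
        moreover have "norm (\<Sum>(t,K)\<in>p1. measure lborel K *\<^sub>R v' t - (x (Sup K) - x (Inf K)))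
          \<le> (\<Sum>q\<in>p1. norm (x (Sup (snd q)) - x (Inf (snd q))))"
          by (rule sum_norm_le) (auto simp: p1_def v'_def norm_minus_commute)
        moreover have "(\<Sum>q\<in>p1. norm (x (Sup (snd q)) - x (Inf (snd q)))) = (\<Sum>i<card p1. norm (x (u i) - x (l i)))"
          unfolding l_def u_def by (rule sum.reindex_bij_betw[OF \<beta>, symmetric])
        ultimately show ?thesis by linarith
      qed
      have s2: "norm (\<Sum>(t,K)\<in>p2. measure lborel K *\<^sub>R v' t - (x (Sup K) - x (Inf K))) \<le> e / 2"
      proof -
        have "norm (\<Sum>(t,K)\<in>p2. measure lborel K *\<^sub>R v' t - (x (Sup K) - x (Inf K))) \<le> (\<Sum>(t,K)\<in>p2. e' * measure lborel K)"
        proof (rule sum_norm_le, clarify)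
          fix t K assume tK: "(t, K) \<in> p2"
          then have tp: "(t, K) \<in> p" and tN: "t \<notin> N" unfolding p2_def by auto
          obtain l u where lu: "K = {l..u}" "a \<le> l" "l \<le> t" "t \<le> u" "u \<le> b"
            using K[OF tp] by blast
          have tab: "t \<in> {a..b}" using lu by auto
          have "{l..u} \<subseteq> ball t (d t)"
            using fineD[OF fine tp] tN tab lu(1) unfolding \<gamma>_def by simp
          then have "l \<in> ball t (d t)" "u \<in> ball t (d t)" using lu(3,4) by (auto simp del: mem_ball)
          then have le: "norm (x l - x t - (l - t) *\<^sub>R v t) \<le> e' * \<bar>l - t\<bar>"
            "norm (x u - x t - (u - t) *\<^sub>R v t) \<le> e' * \<bar>u - t\<bar>"
            using d(2)[OF tN tab, of l] d(2)[OF tN tab, of u] lu by (simp_all add: dist_real_def abs_minus_commute)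
          \<comment> \<open>Straddling: the increment of x is split at the tag, both errors are
            measured from t, and the distances of t to the two ends add up to the length of
            K.\<close>
          have eq: "measure lborel K *\<^sub>R v' t - (x (Sup K) - x (Inf K))
            = (x l - x t - (l - t) *\<^sub>R v t) - (x u - x t - (u - t) *\<^sub>R v t)"
            using lu tN by (simp add: v'_def algebra_simps)
          have "norm (measure lborel K *\<^sub>R v' t - (x (Sup K) - x (Inf K)))
            \<le> e' * \<bar>l - t\<bar> + e' * \<bar>u - t\<bar>"
            unfolding eq using le norm_triangle_ineq4[of "x l - x t - (l - t) *\<^sub>R v t" "x u - x t - (u - t) *\<^sub>R v t"] by linarith
          also have "\<dots> = e' * measure lborel K" using lu by (simp add: algebra_simps)
          finally show "norm (measure lborel K *\<^sub>R v' t - (x (Sup K) - x (Inf K))) \<le> e' * measure lborel K" .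
        qed
        also have "\<dots> \<le> (\<Sum>(t,K)\<in>p. e' * measure lborel K)"
          using pD(1) sub(2) e' by (intro sum_mono2) auto
        also have "\<dots> = e' * (\<Sum>(t,K)\<in>p. measure lborel K)"
          by (simp add: sum_distrib_left case_prod_unfold)
        also have "\<dots> = e' * (b - a)"
          using additive_content_tagged_division[of p a b] p \<open>a \<le> b\<close> by simp
        also have "\<dots> \<le> e / 2"
          using \<open>e > 0\<close> \<open>a \<le> b\<close> unfolding e'_def by (simp add: field_simps)
        finally show ?thesis .
      qed
      show ?thesis
        unfolding split by (rule order.strict_trans1[OF norm_triangle_ineq]) (use s1 s2 in linarith)
    qed
    show "\<exists>\<gamma>. gauge \<gamma> \<and> (\<forall>\<D>. \<D> tagged_division_of {a..b} \<and> \<gamma> fine \<D> \<longrightarrow>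
        norm ((\<Sum>(x, K)\<in>\<D>. measure lborel K *\<^sub>R v' x) - (x b - x a)) < e)"
      by (intro exI[of _ \<gamma>] conjI allI impI g\<gamma>) (erule conjE, rule fine\<gamma>)
  qed
  then show ?thesis
    by (rule has_integral_spike[OF N(1), rotated]) (simp add: v'_def)
qed

text \<open>The norm of the integrand is cut at a level n. The excess over n has total integral
  below \<epsilon>/2, and disjointness of the intervals prevents counting any of it twice; the rest
  contributes at most n times the total length.\<close>

lemma abs_continuous_on_indefinite_integral:
  fixes x :: "real \<Rightarrow> 'b::euclidean_space"
  assumes v: "v absolutely_integrable_on {a..b}"
    and x: "\<And>s. s \<in> {a..b} \<Longrightarrow> x s = x0 + integral {a..s} v"
  shows "abs_continuous_on {a..b} x"
  unfolding abs_continuous_on_def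
proof (intro allI impI)
  fix c d \<epsilon> :: real
  assume cd: "{c..d} \<subseteq> {a..b}" and "\<epsilon> > 0"
  define h where "h t = indicator {a..b} t * norm (v t)" for t
  have h: "integrable lebesgue h"
    using integrable_norm[OF v[unfolded set_integrable_def]] unfolding h_def by simp
  note hm[measurable] = borel_measurable_integrable[OF h]
  have h0: "0 \<le> h t" for t unfolding h_def by simp
  have "(\<lambda>n. (\<integral>t. h t - min (h t) (real n) \<partial>lebesgue)) \<longlonglongrightarrow> (\<integral>t. 0 \<partial>(lebesgue :: real measure))"
  proof (rule integral_dominated_convergence[where w = h])
    show "AE t in lebesgue. (\<lambda>n. h t - min (h t) (real n)) \<longlonglongrightarrow> 0"
    proof (rule AE_I2)
      fix t
      obtain N where "h t \<le> real N" using real_arch_simple by blast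
      then have "\<forall>\<^sub>F n in sequentially. h t - min (h t) (real n) = 0"
        unfolding eventually_sequentially by (intro exI[of _ N]) auto
      then show "(\<lambda>n. h t - min (h t) (real n)) \<longlonglongrightarrow> 0" by (rule tendsto_eventually)
    qed
    show "AE t in lebesgue. norm (h t - min (h t) (real n)) \<le> h t" for n
      using h0 by (intro AE_I2) (auto simp: min_def)
  qed (use h in auto)
  then have "(\<lambda>n. (\<integral>t. h t - min (h t) (real n) \<partial>lebesgue)) \<longlonglongrightarrow> 0" by simp
  from order_tendstoD(2)[OF this, of "\<epsilon> / 2"] \<open>\<epsilon> > 0\<close>
  obtain n :: nat where n: "(\<integral>t. h t - min (h t) (real n) \<partial>lebesgue) < \<epsilon> / 2"
    unfolding eventually_sequentially by auto
  define g where "g t = h t - min (h t) (real n)" for t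
  have hn: "integrable lebesgue (\<lambda>t. min (h t) (real n))"
    by (rule Bochner_Integration.integrable_bound[OF h]) (use h0 in auto)
  have g: "integrable lebesgue g" unfolding g_def using h hn by auto
  have g0: "0 \<le> g t" for t unfolding g_def by simp
  have inc: "norm (x u - x l) \<le> (\<integral>t. indicator {l<..<u} t * g t \<partial>lebesgue) + real n * (u - l)"
    if lu: "a \<le> l" "l \<le> u" "u \<le> b" for l u
  proof -
    have vi: "v integrable_on {p..q}" if "a \<le> p" "q \<le> b" for p q
      using integrable_on_subinterval[OF set_lebesgue_integral_eq_integral(1)[OF v], of p q] that by auto
    have vs: "v absolutely_integrable_on {l<..<u}"
      by (rule set_integrable_subset[OF v]) (use lu in auto)
    have "x u - x l = integral {a..u} v - integral {a..l} v"
      using x[of u] x[of l] lu by auto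
    also have "\<dots> = integral {l..u} v"
      using Henstock_Kurzweil_Integration.integral_combine[of a l u v] vi[of a u] lu
      by (auto simp: algebra_simps)
    also have "\<dots> = integral {l<..<u} v"
      using integral_open_interval[of l u v] by (simp add: cbox_interval)
    finally have "norm (x u - x l) \<le> integral {l<..<u} (\<lambda>t. norm (v t))"
      using norm_integral_le_AE[OF vs, of "\<lambda>t. norm (v t)"] absolutely_integrable_norm[OF vs]
      by (auto simp: o_def)
    also have "\<dots> = (\<integral>t. indicator {l<..<u} t * h t \<partial>lebesgue)"
    proof -
      have "(\<lambda>t. indicator {l<..<u} t * h t) = (\<lambda>t. indicator {l<..<u} t *\<^sub>R norm (v t))"
        using lu by (auto simp: h_def indicator_def fun_eq_iff)
      then show ?thesis
        using set_lebesgue_integral_eq_integral(2)[OF absolutely_integrable_norm[OF vs]]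
        unfolding set_lebesgue_integral_def o_def by simp
    qed
    also have "\<dots> \<le> (\<integral>t. indicator {l<..<u} t * g t + real n * indicator {l<..<u} t \<partial>lebesgue)"
    proof (rule integral_mono)
      show "integrable lebesgue (\<lambda>t. indicator {l<..<u} t * h t)"
        using integrable_mult_indicator[OF _ h, of "{l<..<u}"] by simp
      show "integrable lebesgue (\<lambda>t. indicator {l<..<u} t * g t + real n * indicator {l<..<u} t)"
        using integrable_mult_indicator[OF _ g, of "{l<..<u}"] lu
        by (intro Bochner_Integration.integrable_add integrable_mult_right) auto
    qed (auto simp: g_def indicator_def)
    also have "\<dots> = (\<integral>t. indicator {l<..<u} t * g t \<partial>lebesgue) + real n * (u - l)"
      using integrable_mult_indicator[OF _ g, of "{l<..<u}"] lu by (subst Bochner_Integration.integral_add) auto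
    finally show ?thesis .
  qed
  show "\<exists>\<eta>>0. \<forall>(k::nat) l u. (\<forall>i<k. c \<le> l i \<and> l i \<le> u i \<and> u i \<le> d) \<and>
      disjoint_family_on (\<lambda>i. {l i<..<u i}) {..<k} \<and> (\<Sum>i<k. u i - l i) < \<eta> \<longrightarrow>
      (\<Sum>i<k. norm (x (u i) - x (l i))) < \<epsilon>"
  \<comment> \<open>Using n + 1 in place of n allows the cut level n = 0.\<close>
  proof (intro exI[of _ "\<epsilon> / (2 * (real n + 1))"] conjI allI impI)
    show "0 < \<epsilon> / (2 * (real n + 1))" using \<open>\<epsilon> > 0\<close> by simp
    fix k :: nat and l u :: "nat \<Rightarrow> real"
    assume "(\<forall>i<k. c \<le> l i \<and> l i \<le> u i \<and> u i \<le> d) \<and>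
      disjoint_family_on (\<lambda>i. {l i<..<u i}) {..<k} \<and> (\<Sum>i<k. u i - l i) < \<epsilon> / (2 * (real n + 1))"
    then have lu: "\<And>i. i < k \<Longrightarrow> c \<le> l i \<and> l i \<le> u i \<and> u i \<le> d"
      and dis: "disjoint_family_on (\<lambda>i. {l i<..<u i}) {..<k}"
      and len: "(\<Sum>i<k. u i - l i) < \<epsilon> / (2 * (real n + 1))" by auto
    have lu': "a \<le> l i" "l i \<le> u i" "u i \<le> b" if "i < k" for i
      using lu[OF that] cd atLeastatMost_subset_iff[of c d a b] by auto
    have gi: "integrable lebesgue (\<lambda>t. indicator {l i<..<u i} t * g t)" for i
      using integrable_mult_indicator[OF _ g, of "{l i<..<u i}"] by simp
    have "(\<Sum>i<k. norm (x (u i) - x (l i)))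
      \<le> (\<Sum>i<k. (\<integral>t. indicator {l i<..<u i} t * g t \<partial>lebesgue) + real n * (u i - l i))"
      by (intro sum_mono inc) (use lu' in auto)
    also have "\<dots> = (\<Sum>i<k. (\<integral>t. indicator {l i<..<u i} t * g t \<partial>lebesgue)) + real n * (\<Sum>i<k. u i - l i)"
      by (simp add: sum.distrib sum_distrib_left)
    also have "(\<Sum>i<k. (\<integral>t. indicator {l i<..<u i} t * g t \<partial>lebesgue))
      = (\<integral>t. (\<Sum>i<k. indicator {l i<..<u i} t * g t) \<partial>lebesgue)"
      by (rule Bochner_Integration.integral_sum[symmetric]) (rule gi)
    also have "\<dots> \<le> (\<integral>t. g t \<partial>lebesgue)"
    proof (rule integral_mono)
      show "integrable lebesgue (\<lambda>t. \<Sum>i<k. indicator {l i<..<u i} t * g t)"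
        by (rule Bochner_Integration.integrable_sum) (rule gi)
      fix t
      have "(\<Sum>i<k. indicator {l i<..<u i} t * g t) = indicator (\<Union>i<k. {l i<..<u i}) t * g t"
        using dis by (simp add: indicator_UN_disjoint sum_distrib_right)
      also have "\<dots> \<le> g t" using g0[of t] by (simp add: indicator_def)
      finally show "(\<Sum>i<k. indicator {l i<..<u i} t * g t) \<le> g t" .
    qed (rule g)
    also have "(\<integral>t. g t \<partial>lebesgue) < \<epsilon> / 2" using n unfolding g_def .
    also have "real n * (\<Sum>i<k. u i - l i) \<le> \<epsilon> / 2"
    proof -
      have "real n * (\<Sum>i<k. u i - l i) \<le> real n * (\<epsilon> / (2 * (real n + 1)))"
        using len by (intro mult_left_mono) auto
      also have "\<dots> = (real n / (real n + 1)) * (\<epsilon> / 2)" by simp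
      also have "\<dots> \<le> 1 * (\<epsilon> / 2)"
        using \<open>\<epsilon> > 0\<close> by (intro mult_right_mono) auto
      finally show ?thesis by simp
    qed
    finally show "(\<Sum>i<k. norm (x (u i) - x (l i))) < \<epsilon>" by simp
  qed
qed

lemma abs_continuous_on_subset:
  "abs_continuous_on I x \<Longrightarrow> J \<subseteq> I \<Longrightarrow> abs_continuous_on J x"
  unfolding abs_continuous_on_def by (meson subset_trans)

text \<open>The definition tests compact subintervals only, and each of them lies in an initial
  segment of I. This makes it possible to assemble a solution on a half-open interval from solutions
  on closed ones.\<close>

lemma abs_continuous_on_exhaust:
  assumes "I \<subseteq> {a..}" "a \<in> I" "\<And>d. d \<in> I \<Longrightarrow> abs_continuous_on {a..d} x"
  shows "abs_continuous_on I x"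
  unfolding abs_continuous_on_def
proof (intro allI impI)
  fix c d \<epsilon> :: real assume cd: "{c..d} \<subseteq> I" and "\<epsilon> > 0"
  have "\<exists>d'\<in>I. {c..d} \<subseteq> {a..d'}"
  proof (cases "c \<le> d")
    case True
    with cd assms(1) have "d \<in> I" "a \<le> c" by auto
    then show ?thesis by (intro bexI[of _ d]) auto
  qed (use assms(2) in \<open>auto intro!: bexI[of _ a]\<close>)
  then obtain d' where "d' \<in> I" "{c..d} \<subseteq> {a..d'}" by blast
  from assms(3)[OF this(1), unfolded abs_continuous_on_def, THEN spec, THEN spec, THEN mp, OF this(2)]
    \<open>\<epsilon> > 0\<close>
  show "\<exists>\<eta>>0. \<forall>(k::nat) l u. (\<forall>i<k. c \<le> l i \<and> l i \<le> u i \<and> u i \<le> d) \<and>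
      disjoint_family_on (\<lambda>i. {l i<..<u i}) {..<k} \<and> (\<Sum>i<k. u i - l i) < \<eta> \<longrightarrow>
      (\<Sum>i<k. norm (x (u i) - x (l i))) < \<epsilon>"
    by simp
qed

lemma abs_continuous_on_imp_continuous_on:
  fixes x :: "real \<Rightarrow> 'b::real_normed_vector"
  assumes "abs_continuous_on {a..b} x"
  shows "continuous_on {a..b} x"
  unfolding continuous_on_iff
proof (intro ballI allI impI)
  fix t e :: real assume t: "t \<in> {a..b}" and "e > 0"
  from assms[unfolded abs_continuous_on_def, THEN spec, THEN spec, THEN mp, OF order_refl,
      THEN spec, of e] \<open>e > 0\<close>
  obtain \<eta> where \<eta>: "\<eta> > 0"
    "\<And>(k::nat) l u. (\<forall>i<k. a \<le> l i \<and> l i \<le> u i \<and> u i \<le> b) \<and>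
       disjoint_family_on (\<lambda>i. {l i<..<u i}) {..<k} \<and> (\<Sum>i<k. u i - l i) < \<eta> \<Longrightarrow>
       (\<Sum>i<k. norm (x (u i) - x (l i))) < e"
    by auto
  have "dist (x s) (x t) < e" if s: "s \<in> {a..b}" "dist s t < \<eta>" for s
  proof (cases "s \<le> t")
    case True
    then show ?thesis
      using \<eta>(2)[of 1 "\<lambda>_. s" "\<lambda>_. t"] s t by (simp add: dist_norm disjoint_family_on_def norm_minus_commute)
  next
    case False
    then show ?thesis
      using \<eta>(2)[of 1 "\<lambda>_. t" "\<lambda>_. s"] s t by (simp add: dist_norm disjoint_family_on_def)
  qed
  with \<eta>(1) show "\<exists>d>0. \<forall>s\<in>{a..b}. dist s t < d \<longrightarrow> dist (x s) (x t) < e" by blast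
qed

section \<open>Filippov regularization and enlarged right-hand sides\<close>

text \<open>The condition is imposed for each \<open>M\<close> separately: \<open>w\<close> may depend on the null set.\<close>

definition ess_near :: "(real \<times> (real^'n) \<Rightarrow> real^'n) \<Rightarrow> real \<Rightarrow> real^'n \<Rightarrow> real \<Rightarrow> (real^'n) set"
  where "ess_near g t x \<eta> = {v. \<forall>M\<in>null_sets lebesgue. \<forall>\<delta>>0. \<exists>w. norm w \<le> \<eta> \<and>
    v - w \<in> closure (convex hull ((\<lambda>y. g (t, y)) ` (ball x (\<eta> + \<delta>) - M)))}"

text \<open>For radius 0 the correction w vanishes. Exact solutions thereby become approximate ones
  with \<eta> = 0, and the compactness results apply to both.\<close>

lemma filippov_reg_eq_ess_near: "filippov_reg g t x = ess_near g t x 0"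
  unfolding filippov_reg_def ess_near_def by auto

lemma convex_filippov_reg: "convex (filippov_reg g t x)"
  unfolding filippov_reg_def by (intro convex_INT convex_closure convex_convex_hull)

text \<open>The membership is tested with M the null set where the bound on g fails and with
  \<delta> the slack r - |x| - \<eta>, so that all points used lie in the ball where g is bounded.
  The extra \<eta> pays for the correction w.\<close>

lemma ess_near_bound:
  assumes ae: "AE y in lebesgue. y \<in> ball 0 r \<longrightarrow> norm (g (t, y)) \<le> m"
    and v: "v \<in> ess_near g t x \<eta>" and r: "norm x + \<eta> < r"
  shows "norm v \<le> m + \<eta>"
proof -
  obtain N where N: "negligible N" "\<And>y. y \<notin> N \<Longrightarrow> y \<in> ball 0 r \<Longrightarrow> norm (g (t, y)) \<le> m"
    using AE_negligibleE[OF ae] by metis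
  have "N \<in> null_sets lebesgue" "r - norm x - \<eta> > 0"
    using N(1) r by (auto simp: negligible_iff_null_sets)
  then obtain w where w: "norm w \<le> \<eta>"
    "v - w \<in> closure (convex hull ((\<lambda>y. g (t, y)) ` (ball x (\<eta> + (r - norm x - \<eta>)) - N)))"
    using v unfolding ess_near_def by blast
  have "closure (convex hull ((\<lambda>y. g (t, y)) ` (ball x (\<eta> + (r - norm x - \<eta>)) - N))) \<subseteq> cball 0 m"
  proof (intro closure_minimal hull_minimal)
    show "(\<lambda>y. g (t, y)) ` (ball x (\<eta> + (r - norm x - \<eta>)) - N) \<subseteq> cball 0 m"
    proof clarify
      fix y assume y: "y \<in> ball x (\<eta> + (r - norm x - \<eta>))" "y \<notin> N"
      then have "norm y < r"
        using norm_triangle_ineq2[of y x] by (simp add: dist_norm norm_minus_commute)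
      then show "g (t, y) \<in> cball 0 m" using N(2)[OF y(2)] by simp
    qed
  qed auto
  with w(2) have "norm (v - w) \<le> m" by auto
  with w(1) norm_triangle_sub[of v w] show ?thesis by linarith
qed

text \<open>Each value of g' near x is a value of g at a nearby point z outside M plus a vector of
  norm at most \<eta>. The set of all such sums is closed and convex, so it contains the closed
  convex hull. Since z is chosen after M, the correction w obtained depends on M.\<close>

lemma filippov_reg_subset_ess_near:
  fixes g g' :: "real \<times> (real^'n) \<Rightarrow> real^'n"
  assumes ae: "AE y in lebesgue. y \<in> ball 0 r \<longrightarrow>
      (\<forall>M\<in>null_sets lebesgue. \<exists>z. z \<notin> M \<and> norm (y - z) \<le> \<eta> \<and> norm (g' (t, y) - g (t, z)) \<le> \<eta>)"
    and r: "norm x < r"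
  shows "filippov_reg g' t x \<subseteq> ess_near g t x \<eta>"
proof
  fix v assume v: "v \<in> filippov_reg g' t x"
  obtain N where N: "negligible N" "\<And>y M. y \<notin> N \<Longrightarrow> y \<in> ball 0 r \<Longrightarrow> M \<in> null_sets lebesgue \<Longrightarrow>
      \<exists>z. z \<notin> M \<and> norm (y - z) \<le> \<eta> \<and> norm (g' (t, y) - g (t, z)) \<le> \<eta>"
    using AE_negligibleE[OF ae] by metis
  show "v \<in> ess_near g t x \<eta>"
    unfolding ess_near_def
  proof (intro CollectI ballI allI impI)
    fix M and \<delta> :: real assume M: "M \<in> null_sets (lebesgue :: (real^'n) measure)" and "\<delta> > 0"
    define S where "S = closure (convex hull ((\<lambda>y. g (t, y)) ` (ball x (\<eta> + \<delta>) - M)))"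
    \<comment> \<open>The radius is at most \<delta>, and small enough for the ball around x to stay
      where the hypothesis speaks.\<close>
    define \<rho> where "\<rho> = min \<delta> (r - norm x)"
    have "\<rho> > 0" "N \<in> null_sets lebesgue"
      using \<open>\<delta> > 0\<close> r N(1) unfolding \<rho>_def by (auto simp: negligible_iff_null_sets)
    then have "v \<in> closure (convex hull ((\<lambda>y. g' (t, y)) ` (ball x \<rho> - N)))"
      using v unfolding filippov_reg_def by auto
    also have "\<dots> \<subseteq> {u + w |u w. u \<in> S \<and> w \<in> cball 0 \<eta>}"
    proof (intro closure_minimal hull_minimal)
      show "(\<lambda>y. g' (t, y)) ` (ball x \<rho> - N) \<subseteq> {u + w |u w. u \<in> S \<and> w \<in> cball 0 \<eta>}"
      proof clarify
        fix y assume y: "y \<in> ball x \<rho>" "y \<notin> N"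
        then have "y \<in> ball 0 r"
          using norm_triangle_ineq2[of y x] unfolding \<rho>_def by (simp add: dist_norm norm_minus_commute)
        then obtain z where z: "z \<notin> M" "norm (y - z) \<le> \<eta>" "norm (g' (t, y) - g (t, z)) \<le> \<eta>"
          using N(2)[OF y(2) _ M] by blast
        have "dist x z \<le> dist x y + dist y z" by (rule dist_triangle)
        then have "z \<in> ball x (\<eta> + \<delta>)"
          using y(1) z(2) unfolding \<rho>_def by (auto simp: dist_norm)
        then have "g (t, z) \<in> S"
          unfolding S_def using z(1) by (intro subsetD[OF closure_subset] hull_inc) auto
        then show "\<exists>u w. g' (t, y) = u + w \<and> u \<in> S \<and> w \<in> cball 0 \<eta>"
          using z(3) by (intro exI[of _ "g (t, z)"] exI[of _ "g' (t, y) - g (t, z)"]) auto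
      qed
      have "convex S" unfolding S_def by (intro convex_closure convex_convex_hull)
      then have "convex (\<Union>u\<in>S. \<Union>w\<in>cball 0 \<eta>. {u + w})" by (intro convex_sums convex_cball)
      moreover have eq: "(\<Union>u\<in>S. \<Union>w\<in>cball 0 \<eta>. {u + w}) = {u + w |u w. u \<in> S \<and> w \<in> cball 0 \<eta>}" by blast
      ultimately show "convex {u + w |u w. u \<in> S \<and> w \<in> cball 0 \<eta>}" by simp
      \<comment> \<open>A sum of two closed sets need not be closed; compactness of the ball of
        corrections saves it here.\<close>
      have "closed (\<Union>u\<in>S. \<Union>w\<in>cball 0 \<eta>. {u + w})"
        unfolding S_def by (intro closed_compact_sums closed_closure compact_cball)
      then show "closed {u + w |u w. u \<in> S \<and> w \<in> cball 0 \<eta>}" unfolding eq .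
    qed
    finally obtain u w where "v = u + w" "u \<in> S" "norm w \<le> \<eta>" by auto
    then show "\<exists>w. norm w \<le> \<eta> \<and> v - w \<in> S" by (intro exI[of _ w]) auto
  qed
qed

text \<open>Upper semicontinuity of the regularization under vanishing enlargements. For fixed M and
  \<rho> the corrections tend to 0, and the balls used for the approximating points are eventually
  contained in the ball of radius \<rho>: a third each for the moving centre, the enlargement and
  the free \<delta>.\<close>

lemma ess_near_limit:
  fixes g :: "real \<times> (real^'n) \<Rightarrow> real^'n"
  assumes z: "zs \<longlonglongrightarrow> z" and v: "vs \<longlonglongrightarrow> v" and \<eta>: "\<eta>s \<longlonglongrightarrow> 0"
    and mem: "\<And>j. vs j \<in> ess_near g t (zs j) (\<eta>s j)"
  shows "v \<in> filippov_reg g t z"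
  unfolding filippov_reg_def
proof (intro INT_I)
  fix \<rho> :: real and M :: "(real^'n) set" assume "\<rho> \<in> {0<..}" and M: "M \<in> null_sets lebesgue"
  then have "\<rho> / 3 > 0" by simp
  let ?S = "closure (convex hull ((\<lambda>y. g (t, y)) ` (ball z \<rho> - M)))"
  have "\<exists>w. norm w \<le> \<eta>s j \<and> vs j - w \<in> closure (convex hull ((\<lambda>y. g (t, y)) ` (ball (zs j) (\<eta>s j + \<rho> / 3) - M)))" for j
    using mem[of j] M \<open>\<rho> / 3 > 0\<close> unfolding ess_near_def by blast
  then obtain w where w: "\<And>j. norm (w j) \<le> \<eta>s j"
    "\<And>j. vs j - w j \<in> closure (convex hull ((\<lambda>y. g (t, y)) ` (ball (zs j) (\<eta>s j + \<rho> / 3) - M)))"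
    by metis
  have "w \<longlonglongrightarrow> 0"
    by (rule Lim_null_comparison[OF _ \<eta>]) (use w(1) in auto)
  with v have lim: "(\<lambda>j. vs j - w j) \<longlonglongrightarrow> v - 0" by (intro tendsto_diff)
  have ev: "\<forall>\<^sub>F j in sequentially. vs j - w j \<in> ?S"
    using order_tendstoD(2)[OF \<eta> \<open>\<rho> / 3 > 0\<close>] tendstoD[OF z \<open>\<rho> / 3 > 0\<close>]
  proof eventually_elim
    case (elim j)
    have "ball (zs j) (\<eta>s j + \<rho> / 3) \<subseteq> ball z \<rho>"
    proof
      fix y assume y: "y \<in> ball (zs j) (\<eta>s j + \<rho> / 3)"
      have "dist z y \<le> dist (zs j) z + dist (zs j) y" by (rule dist_triangle3)
      then show "y \<in> ball z \<rho>" using y elim by simp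
    qed
    then have "closure (convex hull ((\<lambda>y. g (t, y)) ` (ball (zs j) (\<eta>s j + \<rho> / 3) - M))) \<subseteq> ?S"
      by (intro closure_mono hull_mono image_mono) auto
    then show ?case using w(2)[of j] by blast
  qed
  show "v \<in> ?S"
    using Lim_in_closed_set[OF closed_closure ev sequentially_bot lim] by simp
qed

section \<open>Aumann integrals and the integral form of solutions\<close>

lemma norm_matrix_vector_mult_le:
  fixes A :: "real^'n^'m"
  shows "norm (A *v w) \<le> norm A * norm w"
proof -
  have "norm ((A *v w) $ i) \<le> norm (A $ i) * norm w" for i
    by (simp add: matrix_vector_mul_component Cauchy_Schwarz_ineq2)
  then have "L2_set (\<lambda>i. norm ((A *v w) $ i)) UNIV \<le> L2_set (\<lambda>i. norm (A $ i) * norm w) UNIV"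
    by (intro L2_set_mono) auto
  also have "\<dots> = norm A * norm w"
    by (simp add: norm_vec_def L2_set_left_distrib)
  finally show ?thesis by (simp add: norm_vec_def)
qed

lemma aumann_integral_mono:
  assumes "\<beta> \<in> aumann_integral M F" "AE \<tau> in M. F \<tau> \<subseteq> G \<tau>"
  shows "\<beta> \<in> aumann_integral M G"
proof -
  obtain \<phi> where \<phi>: "\<beta> = integral\<^sup>L M \<phi>" "integrable M \<phi>" "AE \<tau> in M. \<phi> \<tau> \<in> F \<tau>"
    using assms(1) unfolding aumann_integral_def by auto
  have 3: "AE \<tau> in M. \<phi> \<tau> \<in> G \<tau>" using \<phi>(3) assms(2) by eventually_elim auto
  show ?thesis
    unfolding aumann_integral_def by (intro CollectI exI conjI) (rule \<phi>(1), rule \<phi>(2), rule 3)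
qed

lemma convex_aumann_integral:
  fixes F :: "'a \<Rightarrow> 'b::euclidean_space set"
  assumes F: "\<And>\<tau>. convex (F \<tau>)"
  shows "convex (aumann_integral M F)"
proof (rule convexI)
  fix \<beta> \<beta>' and u w :: real
  assume \<beta>: "\<beta> \<in> aumann_integral M F" "\<beta>' \<in> aumann_integral M F" and uw: "0 \<le> u" "0 \<le> w" "u + w = 1"
  obtain \<phi> where \<phi>: "\<beta> = integral\<^sup>L M \<phi>" "integrable M \<phi>" "AE \<tau> in M. \<phi> \<tau> \<in> F \<tau>"
    using \<beta>(1) unfolding aumann_integral_def by auto
  obtain \<phi>' where \<phi>': "\<beta>' = integral\<^sup>L M \<phi>'" "integrable M \<phi>'" "AE \<tau> in M. \<phi>' \<tau> \<in> F \<tau>"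
    using \<beta>(2) unfolding aumann_integral_def by auto
  have 1: "AE \<tau> in M. u *\<^sub>R \<phi> \<tau> + w *\<^sub>R \<phi>' \<tau> \<in> F \<tau>"
    using \<phi>(3) \<phi>'(3) by eventually_elim (rule convexD[OF F _ _ uw])
  have 2: "u *\<^sub>R \<beta> + w *\<^sub>R \<beta>' = (\<integral>\<tau>. u *\<^sub>R \<phi> \<tau> + w *\<^sub>R \<phi>' \<tau> \<partial>M)"
    using \<phi>(1,2) \<phi>'(1,2) by simp
  have 3: "integrable M (\<lambda>\<tau>. u *\<^sub>R \<phi> \<tau> + w *\<^sub>R \<phi>' \<tau>)"
    using \<phi>(2) \<phi>'(2) by (intro Bochner_Integration.integrable_add integrable_scaleR_right)
  show "u *\<^sub>R \<beta> + w *\<^sub>R \<beta>' \<in> aumann_integral M F"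
    unfolding aumann_integral_def by (intro CollectI exI conjI) (rule 2, rule 3, rule 1)
qed

lemma integral_lebesgue_on_initial:
  fixes v :: "real \<Rightarrow> 'b::euclidean_space"
  assumes v: "v absolutely_integrable_on {a..b}" and t: "t \<in> {a..b}"
  shows "(\<integral>x. indicator {a..t} x *\<^sub>R v x \<partial>lebesgue_on {a..b}) = integral {a..t} v"
proof -
  have "(\<integral>x. indicator {a..t} x *\<^sub>R v x \<partial>lebesgue_on {a..b})
    = (\<integral>x. indicator {a..b} x *\<^sub>R indicator {a..t} x *\<^sub>R v x \<partial>lebesgue)"
    by (simp add: integral_restrict_space)
  also have "\<dots> = (\<integral>x. indicator {a..t} x *\<^sub>R v x \<partial>lebesgue)"
    using t by (intro Bochner_Integration.integral_cong) (auto simp: indicator_def)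
  also have "\<dots> = integral {a..t} v"
    using set_lebesgue_integral_eq_integral(2)[OF set_integrable_subset[OF v, of "{a..t}"]] t
    unfolding set_lebesgue_integral_def by simp
  finally show ?thesis .
qed

lemma indefinite_integral_diff:
  fixes v :: "real \<Rightarrow> 'b::euclidean_space"
  assumes v: "v absolutely_integrable_on {a..b}" and "a \<le> l" "l \<le> u" "u \<le> b"
  shows "integral {a..u} v - integral {a..l} v = integral {l..u} v"
proof -
  have "v integrable_on {a..u}"
    using integrable_on_subinterval[OF set_lebesgue_integral_eq_integral(1)[OF v], of a u] assms by auto
  from Henstock_Kurzweil_Integration.integral_combine[OF assms(2,3) this]
  show ?thesis by (simp add: algebra_simps)
qed

lemma AE_singleton: "AE t in lebesgue. t \<noteq> (a::'a::euclidean_space)"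
  by (rule AE_negligibleI[of "{a}"]) auto

text \<open>Limits are obtained as integrals of a selection v; differentiation almost everywhere
  restores the differential form. The end points are discarded as a null set, so only interior
  derivatives are needed.\<close>

lemma filippov_solutionI:
  assumes "t0 \<le> e" and v: "v absolutely_integrable_on {t0..e}"
    and x: "\<And>t. t \<in> {t0..e} \<Longrightarrow> x t = x0 + integral {t0..t} v"
    and rhs: "AE t in lebesgue. t \<in> {t0..e} \<longrightarrow> v t \<in> filippov_reg f t (x t) +
      aumann_integral (lebesgue_on {t0..t}) (\<lambda>\<tau>. (\<lambda>w. \<Phi> (t, \<tau>) *v w) ` filippov_reg g \<tau> (x \<tau>))"
  shows "filippov_solution \<Phi> f g t0 x0 {t0..e} x"
  unfolding filippov_solution_def
proof (intro conjI)
  show "abs_continuous_on {t0..e} x"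
    by (rule abs_continuous_on_indefinite_integral[OF v x])
  show "x t0 = x0" using x[of t0] \<open>t0 \<le> e\<close> by simp
  show "AE t in lebesgue_on {t0..e}. \<exists>v. (x has_vector_derivative v) (at t within {t0..e}) \<and>
      v \<in> filippov_reg f t (x t) +
        aumann_integral (lebesgue_on {t0..t}) (\<lambda>\<tau>. (\<lambda>w. \<Phi> (t, \<tau>) *v w) ` filippov_reg g \<tau> (x \<tau>))"
    unfolding AE_lebesgue_on_iff[OF lmeasurable_cbox[of t0 e, THEN fmeasurableD, unfolded cbox_interval]]
    using rhs AE_indefinite_integral_derivative[OF v] AE_singleton[of t0] AE_singleton[of e]
  proof eventually_elim
    case (elim t)
    show ?case
    proof
      assume t: "t \<in> {t0..e}"
      have "t \<in> {t0<..<e}" using t elim(3,4) by auto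
      then have "((\<lambda>s. integral {t0..s} v) has_vector_derivative v t) (at t within {t0..e})"
        using elim(2) by (blast intro: has_vector_derivative_at_within)
      from has_vector_derivative_add[OF has_vector_derivative_const[of x0] this]
      have "((\<lambda>s. x0 + integral {t0..s} v) has_vector_derivative v t) (at t within {t0..e})"
        by simp
      from has_vector_derivative_transform[OF t x this]
      have "(x has_vector_derivative v t) (at t within {t0..e})" .
      with elim(1) t show "\<exists>v. (x has_vector_derivative v) (at t within {t0..e}) \<and>
          v \<in> filippov_reg f t (x t) +
            aumann_integral (lebesgue_on {t0..t}) (\<lambda>\<tau>. (\<lambda>w. \<Phi> (t, \<tau>) *v w) ` filippov_reg g \<tau> (x \<tau>))"
        by (intro exI[of _ "v t"]) simp
    qed
  qed
qed (use \<open>t0 \<le> e\<close> in \<open>auto simp: is_interval_cc\<close>)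

section \<open>Uniform domination and limits of the enlarged right-hand sides\<close>

definition approx_rhs ::
    "(real \<times> real \<Rightarrow> real^'n^'n) \<Rightarrow> (real \<times> (real^'n) \<Rightarrow> real^'n) \<Rightarrow> (real \<times> (real^'n) \<Rightarrow> real^'n)
     \<Rightarrow> (real \<Rightarrow> real) \<Rightarrow> real \<Rightarrow> (real \<Rightarrow> real^'n) \<Rightarrow> real \<Rightarrow> (real^'n) set"
  where "approx_rhs \<Phi> f g \<eta> s x t = ess_near f t (x t) (\<eta> t) +
    aumann_integral (lebesgue_on {s..t}) (\<lambda>\<tau>. (\<lambda>w. \<Phi> (t, \<tau>) *v w) ` ess_near g \<tau> (x \<tau>) (\<eta> \<tau>))"

text \<open>This is the quantitative content of the hypotheses on a fixed ball of radius r, for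
  enlargements up to c. The bounds on velocities hold for all points and all enlargements off one
  null set of times. The kernel bound is in iterated form, because \<open>\<Phi>\<close> is
  integrated in \<tau> with t fixed.\<close>

locale filippov_bounds =
  fixes \<Phi> :: "real \<times> real \<Rightarrow> real^'n^'n" and f g :: "real \<times> (real^'n) \<Rightarrow> real^'n"
    and t0 b r c C :: real and hf hg :: "real \<Rightarrow> real"
  assumes C0: "0 \<le> C"
    and hf: "hf absolutely_integrable_on {t0..b}" and hg: "hg absolutely_integrable_on {t0..b}"
    and bf: "AE t in lebesgue. t \<in> {t0..b} \<longrightarrow>
      (\<forall>z \<eta> v. norm z < r \<longrightarrow> 0 \<le> \<eta> \<longrightarrow> \<eta> \<le> c \<longrightarrow> v \<in> ess_near f t z \<eta> \<longrightarrow> norm v \<le> hf t)"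
    and bg: "AE t in lebesgue. t \<in> {t0..b} \<longrightarrow>
      (\<forall>z \<eta> v. norm z < r \<longrightarrow> 0 \<le> \<eta> \<longrightarrow> \<eta> \<le> c \<longrightarrow> v \<in> ess_near g t z \<eta> \<longrightarrow> norm v \<le> hg t)"
    and b\<Phi>: "AE t in lebesgue. t \<in> {t0..b} \<longrightarrow>
      (AE \<tau> in lebesgue. \<tau> \<in> {t0..t} \<longrightarrow> norm (\<Phi> (t, \<tau>)) \<le> C)"
begin

text \<open>The common majorant of all velocities: local term plus a constant for the integral term.
  The absolute values make it nonnegative everywhere, so 0 is an admissible default
  velocity.\<close>

definition h :: "real \<Rightarrow> real"
  where "h t = \<bar>hf t\<bar> + C * integral {t0..b} (\<lambda>\<tau>. \<bar>hg \<tau>\<bar>)"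

lemma abs_hg: "(\<lambda>\<tau>. \<bar>hg \<tau>\<bar>) absolutely_integrable_on {t0..b}"
  using absolutely_integrable_norm[OF hg] by (simp add: o_def)

lemma h_int: "h absolutely_integrable_on {t0..b}"
proof -
  have "(\<lambda>\<tau>. \<bar>hf \<tau>\<bar>) absolutely_integrable_on {t0..b}"
    using absolutely_integrable_norm[OF hf] by (simp add: o_def)
  then show ?thesis
    unfolding h_def by (intro set_integral_add(1)) (auto intro!: absolutely_integrable_continuous_real)
qed

lemma h_int_sub: "t0 \<le> a \<Longrightarrow> e \<le> b \<Longrightarrow> h absolutely_integrable_on {a..e}"
  by (rule set_integrable_subset[OF h_int]) auto

lemma h_nonneg: "0 \<le> h t"
proof -
  have "0 \<le> integral {t0..b} (\<lambda>\<tau>. \<bar>hg \<tau>\<bar>)"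
    by (rule Henstock_Kurzweil_Integration.integral_nonneg[OF set_lebesgue_integral_eq_integral(1)[OF abs_hg]]) simp
  with C0 show ?thesis unfolding h_def by simp
qed

lemma kernel_integral_selection:
  assumes t: "t \<in> {t0..b}" and \<Phi>t: "AE \<tau> in lebesgue. \<tau> \<in> {t0..t} \<longrightarrow> norm (\<Phi> (t, \<tau>)) \<le> C"
    and s: "t0 \<le> s" and x: "\<And>\<tau>. \<tau> \<in> {s..t} \<Longrightarrow> norm (x \<tau>) < r"
    and \<eta>: "\<And>\<tau>. 0 \<le> \<eta> \<tau>" "\<And>\<tau>. \<eta> \<tau> \<le> c"
    and \<beta>: "\<beta> \<in> aumann_integral (lebesgue_on {s..t}) (\<lambda>\<tau>. (\<lambda>w. \<Phi> (t, \<tau>) *v w) ` ess_near g \<tau> (x \<tau>) (\<eta> \<tau>))"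
  obtains \<phi> where "\<phi> absolutely_integrable_on {s..t}" "integral {s..t} \<phi> = \<beta>"
    "AE \<tau> in lebesgue. \<tau> \<in> {s..t} \<longrightarrow>
       \<phi> \<tau> \<in> (\<lambda>w. \<Phi> (t, \<tau>) *v w) ` ess_near g \<tau> (x \<tau>) (\<eta> \<tau>) \<and> norm (\<phi> \<tau>) \<le> C * \<bar>hg \<tau>\<bar>"
proof -
  have m: "{s..t} \<in> sets lebesgue" by simp
  obtain \<phi> where \<phi>: "\<beta> = integral\<^sup>L (lebesgue_on {s..t}) \<phi>" "integrable (lebesgue_on {s..t}) \<phi>"
    "AE \<tau> in lebesgue_on {s..t}. \<phi> \<tau> \<in> (\<lambda>w. \<Phi> (t, \<tau>) *v w) ` ess_near g \<tau> (x \<tau>) (\<eta> \<tau>)"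
    using \<beta> unfolding aumann_integral_def by auto
  have "AE \<tau> in lebesgue. \<tau> \<in> {s..t} \<longrightarrow>
     \<phi> \<tau> \<in> (\<lambda>w. \<Phi> (t, \<tau>) *v w) ` ess_near g \<tau> (x \<tau>) (\<eta> \<tau>) \<and> norm (\<phi> \<tau>) \<le> C * \<bar>hg \<tau>\<bar>"
    using \<phi>(3)[unfolded AE_lebesgue_on_iff[OF m]] \<Phi>t bg
  proof eventually_elim
    case (elim \<tau>)
    show ?case
    proof
      assume \<tau>: "\<tau> \<in> {s..t}"
      then obtain w where w: "w \<in> ess_near g \<tau> (x \<tau>) (\<eta> \<tau>)" "\<phi> \<tau> = \<Phi> (t, \<tau>) *v w"
        using elim(1) by auto
      have \<tau>': "\<tau> \<in> {t0..t}" "\<tau> \<in> {t0..b}" using \<tau> s t by auto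
      have "norm w \<le> hg \<tau>" using elim(3) \<tau>'(2) x[OF \<tau>] \<eta> w(1) by blast
      moreover have "norm (\<Phi> (t, \<tau>)) \<le> C" using elim(2) \<tau>'(1) by blast
      ultimately have "norm (\<Phi> (t, \<tau>)) * norm w \<le> C * \<bar>hg \<tau>\<bar>"
        using C0 by (intro mult_mono) auto
      with norm_matrix_vector_mult_le[of "\<Phi> (t, \<tau>)" w] w
      show "\<phi> \<tau> \<in> (\<lambda>w. \<Phi> (t, \<tau>) *v w) ` ess_near g \<tau> (x \<tau>) (\<eta> \<tau>) \<and> norm (\<phi> \<tau>) \<le> C * \<bar>hg \<tau>\<bar>"
        by auto
    qed
  qed
  moreover have "\<phi> absolutely_integrable_on {s..t}"
    using \<phi>(2) by (simp add: absolutely_integrable_on_iff)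
  moreover have "integral {s..t} \<phi> = \<beta>"
    using lebesgue_integral_eq_integral[OF \<phi>(2) m] \<phi>(1) by simp
  ultimately show thesis using that by blast
qed

lemma kernel_integral_bound:
  assumes t: "t \<in> {t0..b}" and \<Phi>t: "AE \<tau> in lebesgue. \<tau> \<in> {t0..t} \<longrightarrow> norm (\<Phi> (t, \<tau>)) \<le> C"
    and s: "t0 \<le> s" and x: "\<And>\<tau>. \<tau> \<in> {s..t} \<Longrightarrow> norm (x \<tau>) < r"
    and \<eta>: "\<And>\<tau>. 0 \<le> \<eta> \<tau>" "\<And>\<tau>. \<eta> \<tau> \<le> c"
    and \<beta>: "\<beta> \<in> aumann_integral (lebesgue_on {s..t}) (\<lambda>\<tau>. (\<lambda>w. \<Phi> (t, \<tau>) *v w) ` ess_near g \<tau> (x \<tau>) (\<eta> \<tau>))"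
  shows "norm \<beta> \<le> C * integral {t0..b} (\<lambda>\<tau>. \<bar>hg \<tau>\<bar>)"
proof -
  obtain \<phi> where \<phi>: "\<phi> absolutely_integrable_on {s..t}" "integral {s..t} \<phi> = \<beta>"
    "AE \<tau> in lebesgue. \<tau> \<in> {s..t} \<longrightarrow>
       \<phi> \<tau> \<in> (\<lambda>w. \<Phi> (t, \<tau>) *v w) ` ess_near g \<tau> (x \<tau>) (\<eta> \<tau>) \<and> norm (\<phi> \<tau>) \<le> C * \<bar>hg \<tau>\<bar>"
    by (rule kernel_integral_selection[OF assms]) auto
  have sub: "(\<lambda>\<tau>. \<bar>hg \<tau>\<bar>) absolutely_integrable_on {s..t}"
    by (rule set_integrable_subset[OF abs_hg]) (use s t in auto)
  have "norm \<beta> \<le> integral {s..t} (\<lambda>\<tau>. C * \<bar>hg \<tau>\<bar>)"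
    unfolding \<phi>(2)[symmetric]
  proof (rule norm_integral_le_AE[OF \<phi>(1)])
    show "(\<lambda>\<tau>. C * \<bar>hg \<tau>\<bar>) absolutely_integrable_on {s..t}"
      using set_integrable_mult_right[of C, OF sub] by simp
    show "AE t' in lebesgue. t' \<in> {s..t} \<longrightarrow> norm (\<phi> t') \<le> C * \<bar>hg t'\<bar>"
      using \<phi>(3) by eventually_elim auto
  qed simp
  also have "\<dots> = C * integral {s..t} (\<lambda>\<tau>. \<bar>hg \<tau>\<bar>)" by simp
  also have "\<dots> \<le> C * integral {t0..b} (\<lambda>\<tau>. \<bar>hg \<tau>\<bar>)"
    using C0 s t
    by (intro mult_left_mono integral_subset_le set_lebesgue_integral_eq_integral(1)[OF sub]
        set_lebesgue_integral_eq_integral(1)[OF abs_hg]) auto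
  finally show ?thesis .
qed

text \<open>The quantifiers over s, x and \<eta> stand inside the almost-everywhere statement, so
  one exceptional set of times serves a whole sequence of approximate solutions.\<close>

lemma approx_rhs_bound:
  "AE t in lebesgue. t \<in> {t0..b} \<longrightarrow> (\<forall>s x \<eta> v. s \<in> {t0..t} \<longrightarrow> (\<forall>\<tau>\<in>{s..t}. norm (x \<tau>) < r) \<longrightarrow>
     (\<forall>\<tau>. 0 \<le> \<eta> \<tau> \<and> \<eta> \<tau> \<le> c) \<longrightarrow> v \<in> approx_rhs \<Phi> f g \<eta> s x t \<longrightarrow> norm v \<le> h t)"
  using bf b\<Phi>
proof eventually_elim
  case (elim t)
  show ?case
  proof (intro impI allI)
    fix s x \<eta> v
    assume t: "t \<in> {t0..b}" and s: "s \<in> {t0..t}" and x: "\<forall>\<tau>\<in>{s..t}. norm (x \<tau>) < r"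
      and \<eta>: "\<forall>\<tau>. 0 \<le> \<eta> \<tau> \<and> \<eta> \<tau> \<le> c" and v: "v \<in> approx_rhs \<Phi> f g \<eta> s x t"
    obtain \<alpha> \<beta> where ab: "v = \<alpha> + \<beta>" "\<alpha> \<in> ess_near f t (x t) (\<eta> t)"
      "\<beta> \<in> aumann_integral (lebesgue_on {s..t}) (\<lambda>\<tau>. (\<lambda>w. \<Phi> (t, \<tau>) *v w) ` ess_near g \<tau> (x \<tau>) (\<eta> \<tau>))"
      using v unfolding approx_rhs_def by (auto elim: set_plus_elim)
    have "norm (x t) < r" using x s by auto
    then have "norm \<alpha> \<le> hf t" using elim(1) t \<eta> ab(2) by blast
    moreover have "norm \<beta> \<le> C * integral {t0..b} (\<lambda>\<tau>. \<bar>hg \<tau>\<bar>)"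
      by (rule kernel_integral_bound[OF t _ _ _ _ _ ab(3)]) (use elim(2) t s x \<eta> in auto)
    ultimately show "norm v \<le> h t"
      unfolding h_def ab(1) using norm_triangle_ineq[of \<alpha> \<beta>] by linarith
  qed
qed

text \<open>The selections are dominated by a multiple of hg, so \<open>dominated_mazur\<close> in
  the variable \<tau> yields a function whose integral is the limit. Its values lie in the convex
  image of the limiting regularization, since all cluster points of the selections do.\<close>

lemma kernel_integral_limit:
  assumes t: "t \<in> {t0..b}" and \<Phi>t: "AE \<tau> in lebesgue. \<tau> \<in> {t0..t} \<longrightarrow> norm (\<Phi> (t, \<tau>)) \<le> C"
    and s: "\<And>k. t0 \<le> s k" "s \<longlonglongrightarrow> t0"
    and x: "\<And>k \<tau>. \<tau> \<in> {t0..t} \<Longrightarrow> norm (x k \<tau>) < r" "\<And>\<tau>. \<tau> \<in> {t0..t} \<Longrightarrow> (\<lambda>k. x k \<tau>) \<longlonglongrightarrow> y \<tau>"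
    and \<eta>: "\<And>k \<tau>. 0 \<le> \<eta> k \<tau>" "\<And>k \<tau>. \<eta> k \<tau> \<le> c"
      "AE \<tau> in lebesgue. \<tau> \<in> {t0..b} \<longrightarrow> (\<lambda>k. \<eta> k \<tau>) \<longlonglongrightarrow> 0"
    and \<beta>: "\<And>k. \<beta> k \<in> aumann_integral (lebesgue_on {s k..t})
        (\<lambda>\<tau>. (\<lambda>w. \<Phi> (t, \<tau>) *v w) ` ess_near g \<tau> (x k \<tau>) (\<eta> k \<tau>))" "\<beta> \<longlonglongrightarrow> \<beta>0"
  shows "\<beta>0 \<in> aumann_integral (lebesgue_on {t0..t})
      (\<lambda>\<tau>. (\<lambda>w. \<Phi> (t, \<tau>) *v w) ` filippov_reg g \<tau> (y \<tau>))"
proof -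
  let ?M = "lebesgue_on {t0..t}"
  have m: "{t0..t} \<in> sets lebesgue" by simp
  have "\<exists>\<phi>. \<phi> absolutely_integrable_on {s k..t} \<and> integral {s k..t} \<phi> = \<beta> k \<and>
    (AE \<tau> in lebesgue. \<tau> \<in> {s k..t} \<longrightarrow>
       \<phi> \<tau> \<in> (\<lambda>w. \<Phi> (t, \<tau>) *v w) ` ess_near g \<tau> (x k \<tau>) (\<eta> k \<tau>) \<and> norm (\<phi> \<tau>) \<le> C * \<bar>hg \<tau>\<bar>)" for k
  proof -
    have "norm (x k \<tau>) < r" if "\<tau> \<in> {s k..t}" for \<tau>
      using x(1) that s(1)[of k] by auto
    from kernel_integral_selection[OF t \<Phi>t s(1) this \<eta>(1,2) \<beta>(1)] show ?thesis by blast
  qed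
  then have "\<exists>\<phi>. \<forall>k. \<phi> k absolutely_integrable_on {s k..t} \<and> integral {s k..t} (\<phi> k) = \<beta> k \<and>
    (AE \<tau> in lebesgue. \<tau> \<in> {s k..t} \<longrightarrow>
       \<phi> k \<tau> \<in> (\<lambda>w. \<Phi> (t, \<tau>) *v w) ` ess_near g \<tau> (x k \<tau>) (\<eta> k \<tau>) \<and> norm (\<phi> k \<tau>) \<le> C * \<bar>hg \<tau>\<bar>)"
    by (intro choice allI)
  then obtain \<phi> where \<phi>: "\<And>k. \<phi> k absolutely_integrable_on {s k..t}" "\<And>k. integral {s k..t} (\<phi> k) = \<beta> k"
    "\<And>k. AE \<tau> in lebesgue. \<tau> \<in> {s k..t} \<longrightarrow>
       \<phi> k \<tau> \<in> (\<lambda>w. \<Phi> (t, \<tau>) *v w) ` ess_near g \<tau> (x k \<tau>) (\<eta> k \<tau>) \<and> norm (\<phi> k \<tau>) \<le> C * \<bar>hg \<tau>\<bar>"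
    by blast
  \<comment> \<open>The selections live on intervals with different left ends; extension by zero
    puts them on a common one without changing the integrals.\<close>
  define \<phi>' where "\<phi>' k \<tau> = indicator {s k..t} \<tau> *\<^sub>R \<phi> k \<tau>" for k \<tau>
  have \<phi>'l: "integrable lebesgue (\<phi>' k)" for k
    using \<phi>(1)[of k] unfolding \<phi>'_def set_integrable_def .
  have \<phi>'i: "integrable ?M (\<phi>' k)" for k
    using integrable_mult_indicator[OF m \<phi>'l[of k]] m by (simp add: integrable_restrict_space)
  have \<phi>'int: "(\<integral>\<tau>. indicator {t0..t} \<tau> *\<^sub>R \<phi>' k \<tau> \<partial>?M) = \<beta> k" for k
  proof -
    have "(\<integral>\<tau>. indicator {t0..t} \<tau> *\<^sub>R \<phi>' k \<tau> \<partial>?M)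
      = (\<integral>\<tau>. indicator {t0..t} \<tau> *\<^sub>R indicator {t0..t} \<tau> *\<^sub>R \<phi>' k \<tau> \<partial>lebesgue)"
      by (simp add: integral_restrict_space)
    also have "\<dots> = (\<integral>\<tau>. indicator {s k..t} \<tau> *\<^sub>R \<phi> k \<tau> \<partial>lebesgue)"
      using s(1)[of k] by (intro Bochner_Integration.integral_cong) (auto simp: \<phi>'_def indicator_def)
    also have "\<dots> = \<beta> k"
      using set_lebesgue_integral_eq_integral(2)[OF \<phi>(1)[of k]] \<phi>(2)[of k]
      unfolding set_lebesgue_integral_def by simp
    finally show ?thesis .
  qed
  have dom: "AE \<tau> in ?M. norm (\<phi>' k \<tau>) \<le> C * \<bar>hg \<tau>\<bar>" for k
    unfolding AE_lebesgue_on_iff[OF m] using \<phi>(3)[of k]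
    by eventually_elim (use C0 in \<open>auto simp: \<phi>'_def indicator_def\<close>)
  have "(\<lambda>\<tau>. C * \<bar>hg \<tau>\<bar>) absolutely_integrable_on {t0..b}"
    using set_integrable_mult_right[of C, OF abs_hg] by simp
  then have "(\<lambda>\<tau>. C * \<bar>hg \<tau>\<bar>) absolutely_integrable_on {t0..t}"
    by (rule set_integrable_subset) (use t in auto)
  then have hi: "integrable ?M (\<lambda>\<tau>. C * \<bar>hg \<tau>\<bar>)"
    by (simp add: absolutely_integrable_on_iff)
  obtain \<psi> where \<psi>: "integrable ?M \<psi>" "AE \<tau> in ?M. norm (\<psi> \<tau>) \<le> C * \<bar>hg \<tau>\<bar>"
    "\<And>N. AE \<tau> in ?M. \<psi> \<tau> \<in> closure (convex hull ((\<lambda>k. \<phi>' k \<tau>) ` {N..}))"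
    "\<And>A l. A \<in> sets ?M \<Longrightarrow> (\<lambda>k. (\<integral>\<tau>. indicator A \<tau> *\<^sub>R \<phi>' k \<tau> \<partial>?M)) \<longlonglongrightarrow> l \<Longrightarrow>
       (\<integral>\<tau>. indicator A \<tau> *\<^sub>R \<psi> \<tau> \<partial>?M) = l"
    by (rule dominated_mazur[of \<phi>' ?M "\<lambda>\<tau>. C * \<bar>hg \<tau>\<bar>", OF borel_measurable_integrable[OF \<phi>'i] dom hi]) (rule that)
  have "(\<integral>\<tau>. indicator {t0..t} \<tau> *\<^sub>R \<psi> \<tau> \<partial>?M) = \<beta>0"
    by (rule \<psi>(4)) (use \<beta>(2) \<phi>'int in \<open>auto simp: sets_restrict_space_iff\<close>)
  moreover have "(\<integral>\<tau>. indicator {t0..t} \<tau> *\<^sub>R \<psi> \<tau> \<partial>?M) = integral\<^sup>L ?M \<psi>"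
    by (intro Bochner_Integration.integral_cong) auto
  ultimately have \<psi>int: "\<beta>0 = integral\<^sup>L ?M \<psi>" by simp
  have \<psi>N: "AE \<tau> in lebesgue. \<tau> \<in> {t0..t} \<longrightarrow> (\<forall>N. \<psi> \<tau> \<in> closure (convex hull ((\<lambda>k. \<phi>' k \<tau>) ` {N..})))"
    using \<psi>(3) unfolding AE_lebesgue_on_iff[OF m, symmetric] by (simp add: AE_all_countable)
  have \<phi>N: "AE \<tau> in lebesgue. \<forall>k. \<tau> \<in> {s k..t} \<longrightarrow>
       \<phi> k \<tau> \<in> (\<lambda>w. \<Phi> (t, \<tau>) *v w) ` ess_near g \<tau> (x k \<tau>) (\<eta> k \<tau>) \<and> norm (\<phi> k \<tau>) \<le> C * \<bar>hg \<tau>\<bar>"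
    using \<phi>(3) by (simp add: AE_all_countable)
  have "AE \<tau> in ?M. \<psi> \<tau> \<in> (\<lambda>w. \<Phi> (t, \<tau>) *v w) ` filippov_reg g \<tau> (y \<tau>)"
    unfolding AE_lebesgue_on_iff[OF m] using \<psi>N \<phi>N \<eta>(3) bg AE_singleton[of t0]
  proof eventually_elim
    case (elim \<tau>)
    show ?case
    proof
      assume \<tau>: "\<tau> \<in> {t0..t}"
      then have \<tau>b: "\<tau> \<in> {t0..b}" using t by auto
      let ?C = "(\<lambda>w. \<Phi> (t, \<tau>) *v w) ` filippov_reg g \<tau> (y \<tau>)"
      have bd: "norm (\<phi>' k \<tau>) \<le> C * \<bar>hg \<tau>\<bar>" for k
        using elim(2) C0 by (auto simp: \<phi>'_def indicator_def)
      show "\<psi> \<tau> \<in> ?C"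
      proof (rule tail_hull_subset)
        show "convex ?C"
          by (intro convex_linear_image convex_filippov_reg) (rule matrix_vector_mul_linear)
        show "bounded (range (\<lambda>k. \<phi>' k \<tau>))"
          using bd by (auto simp: bounded_iff)

        show "\<psi> \<tau> \<in> closure (convex hull ((\<lambda>k. \<phi>' k \<tau>) ` {N..}))" for N
          using elim(1) \<tau> by blast
        fix \<sigma> :: "nat \<Rightarrow> nat" and l assume \<sigma>: "strict_mono \<sigma>" and l: "((\<lambda>k. \<phi>' k \<tau>) \<circ> \<sigma>) \<longlonglongrightarrow> l"
        \<comment> \<open>For such \<tau> the default value 0 occurs for finitely many k only, since
          the starting times tend to t0. The index shift by K drops those k.\<close>
        have "t0 < \<tau>" using elim(5) \<tau> by auto
        then obtain K where K: "\<And>k. k \<ge> K \<Longrightarrow> s k < \<tau>"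
          using order_tendstoD(2)[OF s(2)] unfolding eventually_sequentially by metis
        define \<rho> where "\<rho> j = \<sigma> (j + K)" for j
        have \<rho>: "strict_mono \<rho>" "K \<le> \<rho> j" for j
          using \<sigma> strict_mono_imp_increasing[OF \<sigma>, of "j + K"]
          unfolding \<rho>_def strict_mono_def by auto
        have l': "(\<lambda>j. \<phi>' (\<rho> j) \<tau>) \<longlonglongrightarrow> l"
          using LIMSEQ_ignore_initial_segment[OF l, of K] by (simp add: \<rho>_def o_def)
        have in_s: "\<tau> \<in> {s (\<rho> j)..t}" for j using K[OF \<rho>(2)[of j]] \<tau> by auto
        \<comment> \<open>The preimages under \<open>\<Phi> (t, \<tau>)\<close> are chosen at this
          one \<tau> only; their measurability in \<tau> is not at issue. Being possibly singular,
          the matrix cannot bound them, so their bound comes from \<open>bg\<close>.\<close>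
        have "\<exists>w. w \<in> ess_near g \<tau> (x (\<rho> j) \<tau>) (\<eta> (\<rho> j) \<tau>) \<and> \<phi>' (\<rho> j) \<tau> = \<Phi> (t, \<tau>) *v w" for j
        proof -
          have "\<phi>' (\<rho> j) \<tau> = \<phi> (\<rho> j) \<tau>" using in_s[of j] by (simp add: \<phi>'_def)
          with elim(2) in_s[of j] show ?thesis by auto
        qed
        then obtain w where w: "\<And>j. w j \<in> ess_near g \<tau> (x (\<rho> j) \<tau>) (\<eta> (\<rho> j) \<tau>)"
          "\<And>j. \<phi>' (\<rho> j) \<tau> = \<Phi> (t, \<tau>) *v w j" by metis
        have "norm (w j) \<le> hg \<tau>" for j
          using elim(4) \<tau>b x(1)[OF \<tau>, of "\<rho> j"] \<eta>(1,2)[of "\<rho> j" \<tau>] w(1)[of j] by blast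
        then have "bounded (range w)" by (auto simp: bounded_iff)
        then obtain w0 \<kappa> where \<kappa>: "strict_mono (\<kappa> :: nat \<Rightarrow> nat)" "(w \<circ> \<kappa>) \<longlonglongrightarrow> w0"
          using bounded_imp_convergent_subsequence by blast
        have sub: "strict_mono (\<rho> \<circ> \<kappa>)" using \<rho>(1) \<kappa>(1) by (rule strict_mono_o)
        have "w0 \<in> filippov_reg g \<tau> (y \<tau>)"
        proof (rule ess_near_limit)
          show "(\<lambda>j. x (\<rho> (\<kappa> j)) \<tau>) \<longlonglongrightarrow> y \<tau>"
            using LIMSEQ_subseq_LIMSEQ[OF x(2)[OF \<tau>] sub] by (simp add: o_def)
          show "(\<lambda>j. \<eta> (\<rho> (\<kappa> j)) \<tau>) \<longlonglongrightarrow> 0"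
            using LIMSEQ_subseq_LIMSEQ[OF elim(3)[rule_format, OF \<tau>b] sub] by (simp add: o_def)
          show "(\<lambda>j. w (\<kappa> j)) \<longlonglongrightarrow> w0" using \<kappa>(2) by (simp add: o_def)
          show "w (\<kappa> j) \<in> ess_near g \<tau> (x (\<rho> (\<kappa> j)) \<tau>) (\<eta> (\<rho> (\<kappa> j)) \<tau>)" for j by (rule w(1))
        qed
        moreover have "l = \<Phi> (t, \<tau>) *v w0"
        proof (rule LIMSEQ_unique)
          show "(\<lambda>j. \<phi>' (\<rho> (\<kappa> j)) \<tau>) \<longlonglongrightarrow> l"
            using LIMSEQ_subseq_LIMSEQ[OF l' \<kappa>(1)] by (simp add: o_def)
          show "(\<lambda>j. \<phi>' (\<rho> (\<kappa> j)) \<tau>) \<longlonglongrightarrow> \<Phi> (t, \<tau>) *v w0"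
            unfolding w(2) using bounded_linear.tendsto[OF matrix_vector_mul_bounded_linear \<kappa>(2)]
            by (simp add: o_def)
        qed
        ultimately show "l \<in> ?C" by blast
      qed
    qed
  qed
  then show ?thesis
    unfolding aumann_integral_def by (intro CollectI exI conjI) (rule \<psi>int, rule \<psi>(1))
qed

end

section \<open>Limits of approximate solutions\<close>

lemma convergent_subsequence_pair:
  fixes \<alpha> :: "nat \<Rightarrow> 'a::heine_borel" and \<beta> :: "nat \<Rightarrow> 'b::heine_borel"
  assumes "bounded (range \<alpha>)" "bounded (range \<beta>)"
  obtains \<kappa> a b where "strict_mono (\<kappa> :: nat \<Rightarrow> nat)" "(\<lambda>j. \<alpha> (\<kappa> j)) \<longlonglongrightarrow> a" "(\<lambda>j. \<beta> (\<kappa> j)) \<longlonglongrightarrow> b"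
proof -
  obtain a \<kappa>1 where 1: "strict_mono (\<kappa>1 :: nat \<Rightarrow> nat)" "(\<alpha> \<circ> \<kappa>1) \<longlonglongrightarrow> a"
    using bounded_imp_convergent_subsequence[OF assms(1)] by blast
  have "bounded (range (\<beta> \<circ> \<kappa>1))" by (rule bounded_subset[OF assms(2)]) auto
  then obtain b \<kappa>2 where 2: "strict_mono (\<kappa>2 :: nat \<Rightarrow> nat)" "((\<beta> \<circ> \<kappa>1) \<circ> \<kappa>2) \<longlonglongrightarrow> b"
    using bounded_imp_convergent_subsequence by blast
  show thesis
  proof (rule that[of "\<kappa>1 \<circ> \<kappa>2"])
    show "strict_mono (\<kappa>1 \<circ> \<kappa>2)" using 1(1) 2(1) by (rule strict_mono_o)
    show "(\<lambda>j. \<alpha> ((\<kappa>1 \<circ> \<kappa>2) j)) \<longlonglongrightarrow> a"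
      using LIMSEQ_subseq_LIMSEQ[OF 1(2) 2(1)] by (simp add: o_def)
    show "(\<lambda>j. \<beta> ((\<kappa>1 \<circ> \<kappa>2) j)) \<longlonglongrightarrow> b" using 2(2) by (simp add: o_def)
  qed
qed

lemma approx_rhs_cong:
  assumes "s \<le> t" "\<And>\<tau>. \<tau> \<in> {s..t} \<Longrightarrow> x \<tau> = x' \<tau>"
    and "v \<in> approx_rhs \<Phi> f g \<eta> s x t"
  shows "v \<in> approx_rhs \<Phi> f g \<eta> s x' t"
proof -
  obtain \<alpha> \<beta> where ab: "v = \<alpha> + \<beta>" "\<alpha> \<in> ess_near f t (x t) (\<eta> t)"
    "\<beta> \<in> aumann_integral (lebesgue_on {s..t}) (\<lambda>\<tau>. (\<lambda>w. \<Phi> (t, \<tau>) *v w) ` ess_near g \<tau> (x \<tau>) (\<eta> \<tau>))"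
    using assms(3) unfolding approx_rhs_def by (auto elim: set_plus_elim)
  have "\<beta> \<in> aumann_integral (lebesgue_on {s..t}) (\<lambda>\<tau>. (\<lambda>w. \<Phi> (t, \<tau>) *v w) ` ess_near g \<tau> (x' \<tau>) (\<eta> \<tau>))"
    by (rule aumann_integral_mono[OF ab(3)]) (rule AE_I2, use assms(2) in auto)
  moreover have "\<alpha> \<in> ess_near f t (x' t) (\<eta> t)" using ab(2) assms(1,2) by simp
  ultimately show ?thesis unfolding approx_rhs_def ab(1) by (intro set_plus_intro)
qed

context filippov_bounds
begin

text \<open>The majorant h gives a common modulus of continuity, hence a uniform limit y by
  Arzela-Ascoli, and \<open>dominated_mazur\<close> gives a candidate \<psi> for its velocity.
  Convergence of the functions identifies the integrals of \<psi>, while cluster points of the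
  velocities at a fixed time place its values.\<close>

theorem approx_solutions_compact:
  assumes e: "t0 < e" "e \<le> b"
    and s: "\<And>k. s k \<in> {t0..e}" "s \<longlonglongrightarrow> t0"
    and \<eta>: "\<And>k \<tau>. 0 \<le> \<eta> k \<tau>" "\<And>k \<tau>. \<eta> k \<tau> \<le> c"
      "AE \<tau> in lebesgue. \<tau> \<in> {t0..b} \<longrightarrow> (\<lambda>k. \<eta> k \<tau>) \<longlonglongrightarrow> 0"
    and xr: "\<And>k \<tau>. \<tau> \<in> {t0..e} \<Longrightarrow> norm (x k \<tau>) < r"
    and v: "\<And>k. v k absolutely_integrable_on {t0..e}"
    and xv: "\<And>k t. t \<in> {t0..e} \<Longrightarrow> x k t = x k t0 + integral {t0..t} (v k)"
    and rhs: "\<And>k. AE t in lebesgue. t \<in> {s k..e} \<longrightarrow> v k t \<in> approx_rhs \<Phi> f g (\<eta> k) (s k) (x k) t"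
    and v0: "\<And>k t. t < s k \<Longrightarrow> v k t = 0"
    and x0: "(\<lambda>k. x k t0) \<longlonglongrightarrow> x0"
  obtains \<sigma> y where "strict_mono (\<sigma> :: nat \<Rightarrow> nat)" "filippov_solution \<Phi> f g t0 x0 {t0..e} y"
    "\<And>\<epsilon>. 0 < \<epsilon> \<Longrightarrow> \<exists>N. \<forall>n\<ge>N. \<forall>t\<in>{t0..e}. norm (x (\<sigma> n) t - y t) < \<epsilon>"
proof -
  have rhs': "AE t in lebesgue. \<forall>k. t \<in> {s k..e} \<longrightarrow> v k t \<in> approx_rhs \<Phi> f g (\<eta> k) (s k) (x k) t"
    using rhs by (simp add: AE_all_countable)
  have vb: "AE t in lebesgue. t \<in> {t0..e} \<longrightarrow> (\<forall>k. norm (v k t) \<le> h t)"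
    using rhs' approx_rhs_bound
  proof eventually_elim
    case (elim t)
    show ?case
    proof (intro impI allI)
      fix k assume t: "t \<in> {t0..e}"
      show "norm (v k t) \<le> h t"
      proof (cases "t < s k")
        case True
        then show ?thesis using v0 h_nonneg by simp
      next
        case False
        then have "v k t \<in> approx_rhs \<Phi> f g (\<eta> k) (s k) (x k) t" using elim(1) t by auto
        moreover have "t \<in> {t0..b}" "s k \<in> {t0..t}" using False t e s(1)[of k] by auto
        moreover have "\<forall>\<tau>\<in>{s k..t}. norm (x k \<tau>) < r" using xr s(1)[of k] t by auto
        moreover have "\<forall>\<tau>. 0 \<le> \<eta> k \<tau> \<and> \<eta> k \<tau> \<le> c" using \<eta> by auto
        ultimately show ?thesis using elim(2) by blast
      qed
    qed
  qed
  have hi: "h absolutely_integrable_on {t0..e}" by (rule h_int_sub) (use e in auto)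
  \<comment> \<open>Increments of H dominate those of every x k, which is the equicontinuity
    required below.\<close>
  define H where "H t = integral {t0..t} h" for t
  have Hc: "continuous_on {t0..e} H"
    unfolding H_def by (rule indefinite_integral_continuous_1[OF set_lebesgue_integral_eq_integral(1)[OF hi]])
  have lip: "norm (x k u - x k l) \<le> H u - H l" if lu: "t0 \<le> l" "l \<le> u" "u \<le> e" for k l u
  proof -
    have "x k u - x k l = integral {l..u} (v k)"
      using xv[of u k] xv[of l k] indefinite_integral_diff[OF v[of k] lu] lu by simp
    moreover have "norm (integral {l..u} (v k)) \<le> integral {l..u} h"
    proof (rule norm_integral_le_AE)
      show "v k absolutely_integrable_on {l..u}" "h absolutely_integrable_on {l..u}"
        using set_integrable_subset[OF v[of k], of "{l..u}"] set_integrable_subset[OF hi, of "{l..u}"] lu by auto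
      show "AE t in lebesgue. t \<in> {l..u} \<longrightarrow> norm (v k t) \<le> h t"
        using vb by eventually_elim (use lu in auto)
    qed simp
    ultimately show ?thesis
      unfolding H_def using indefinite_integral_diff[OF hi lu] by simp
  qed
  have lip': "norm (x k u - x k l) \<le> \<bar>H u - H l\<bar>" if "l \<in> {t0..e}" "u \<in> {t0..e}" for k l u
    using lip[of l u k] lip[of u l k] that by (cases "l \<le> u") (auto simp: norm_minus_commute)
  obtain y \<kappa> where \<kappa>: "strict_mono (\<kappa> :: nat \<Rightarrow> nat)"
    "\<And>\<epsilon>. 0 < \<epsilon> \<Longrightarrow> \<exists>N. \<forall>n t. n \<ge> N \<and> t \<in> {t0..e} \<longrightarrow> norm (x (\<kappa> n) t - y t) < \<epsilon>"
  proof (rule Arzela_Ascoli[of "{t0..e}" x r])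
    show "norm (x n t) \<le> r" if "t \<in> {t0..e}" for n t using xr[OF that, of n] by simp
    show "\<exists>d. 0 < d \<and> (\<forall>n u. u \<in> {t0..e} \<and> norm (t - u) < d \<longrightarrow> norm (x n t - x n u) < \<epsilon>)"
      if t: "t \<in> {t0..e}" and "0 < \<epsilon>" for t \<epsilon> :: real
    proof -
      obtain d where d: "d > 0" "\<And>u. u \<in> {t0..e} \<Longrightarrow> dist u t < d \<Longrightarrow> dist (H u) (H t) < \<epsilon>"
        using Hc t \<open>0 < \<epsilon>\<close> unfolding continuous_on_iff by metis
      have "norm (x n t - x n u) < \<epsilon>" if "u \<in> {t0..e}" "norm (t - u) < d" for n u
        using lip'[OF that(1) t, of n] d(2)[OF that(1)] that(2) by (simp add: dist_real_def abs_minus_commute)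
      with d(1) show ?thesis by blast
    qed
  qed (auto intro: that)
  have xlim: "(\<lambda>n. x (\<kappa> n) t) \<longlonglongrightarrow> y t" if "t \<in> {t0..e}" for t
    unfolding LIMSEQ_iff using \<kappa>(2) that by blast
  let ?M = "lebesgue_on {t0..e}"
  have m: "{t0..e} \<in> sets lebesgue" by simp
  have vi: "integrable ?M (v k)" for k using v[of k] by (simp add: absolutely_integrable_on_iff)
  have hiM: "integrable ?M h" using hi by (simp add: absolutely_integrable_on_iff)
  have dom: "AE t in ?M. norm (v (\<kappa> k) t) \<le> h t" for k
    unfolding AE_lebesgue_on_iff[OF m] using vb by eventually_elim auto
  obtain \<psi> where \<psi>: "integrable ?M \<psi>" "AE t in ?M. norm (\<psi> t) \<le> h t"
    "\<And>N. AE t in ?M. \<psi> t \<in> closure (convex hull ((\<lambda>k. v (\<kappa> k) t) ` {N..}))"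
    "\<And>A l. A \<in> sets ?M \<Longrightarrow> (\<lambda>k. (\<integral>t. indicator A t *\<^sub>R v (\<kappa> k) t \<partial>?M)) \<longlonglongrightarrow> l \<Longrightarrow>
       (\<integral>t. indicator A t *\<^sub>R \<psi> t \<partial>?M) = l"
    by (rule dominated_mazur[of "\<lambda>k. v (\<kappa> k)" ?M h, OF borel_measurable_integrable[OF vi] dom hiM]) (rule that)
  have \<psi>a: "\<psi> absolutely_integrable_on {t0..e}" using \<psi>(1) by (simp add: absolutely_integrable_on_iff)
  have y: "y t = x0 + integral {t0..t} \<psi>" if t: "t \<in> {t0..e}" for t
  proof -
    \<comment> \<open>Initial intervals are tested: there the integrals of the velocities are
      increments of the functions, whose limits are known.\<close>
    have "(\<integral>t'. indicator {t0..t} t' *\<^sub>R \<psi> t' \<partial>?M) = y t - x0"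
    proof (rule \<psi>(4))
      have "{t0..t} \<subseteq> {t0..e}" using t by auto
      then show "{t0..t} \<in> sets ?M" by (simp add: sets_restrict_space_iff)
      have "(\<lambda>k. x (\<kappa> k) t - x (\<kappa> k) t0) \<longlonglongrightarrow> y t - x0"
        using LIMSEQ_subseq_LIMSEQ[OF x0 \<kappa>(1)] by (intro tendsto_diff xlim[OF t]) (simp add: o_def)
      moreover have "x (\<kappa> k) t - x (\<kappa> k) t0 = (\<integral>t'. indicator {t0..t} t' *\<^sub>R v (\<kappa> k) t' \<partial>?M)" for k
        unfolding integral_lebesgue_on_initial[OF v t] using xv[OF t, of "\<kappa> k"] by simp
      ultimately show "(\<lambda>k. (\<integral>t'. indicator {t0..t} t' *\<^sub>R v (\<kappa> k) t' \<partial>?M)) \<longlonglongrightarrow> y t - x0" by simp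
    qed
    then show ?thesis using integral_lebesgue_on_initial[OF \<psi>a t] by (simp add: algebra_simps)
  qed
  have \<psi>N: "AE t in lebesgue. t \<in> {t0..e} \<longrightarrow> (\<forall>N. \<psi> t \<in> closure (convex hull ((\<lambda>k. v (\<kappa> k) t) ` {N..})))"
    using \<psi>(3) unfolding AE_lebesgue_on_iff[OF m, symmetric] by (simp add: AE_all_countable)
  have "filippov_solution \<Phi> f g t0 x0 {t0..e} y"
  proof (rule filippov_solutionI[OF _ \<psi>a y])
    show "AE t in lebesgue. t \<in> {t0..e} \<longrightarrow> \<psi> t \<in> filippov_reg f t (y t) +
      aumann_integral (lebesgue_on {t0..t}) (\<lambda>\<tau>. (\<lambda>w. \<Phi> (t, \<tau>) *v w) ` filippov_reg g \<tau> (y \<tau>))"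
      using \<psi>N rhs' vb \<eta>(3) bf b\<Phi> AE_singleton[of t0]
    proof eventually_elim
      case (elim t)
      show ?case
      proof
        assume t: "t \<in> {t0..e}"
        then have tb: "t \<in> {t0..b}" using e by auto
        let ?A = "aumann_integral (lebesgue_on {t0..t}) (\<lambda>\<tau>. (\<lambda>w. \<Phi> (t, \<tau>) *v w) ` filippov_reg g \<tau> (y \<tau>))"
        have \<Phi>t: "AE \<tau> in lebesgue. \<tau> \<in> {t0..t} \<longrightarrow> norm (\<Phi> (t, \<tau>)) \<le> C"
          using elim(6) tb by blast
        show "\<psi> t \<in> filippov_reg f t (y t) + ?A"
        proof (rule tail_hull_subset)
          show "convex (filippov_reg f t (y t) + ?A)"
            by (intro convex_set_plus convex_filippov_reg convex_aumann_integral convex_linear_image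
                matrix_vector_mul_linear)
          have "norm (v k t) \<le> h t" for k using elim(3) t by blast
          then show "bounded (range (\<lambda>k. v (\<kappa> k) t))" by (auto simp: bounded_iff)
          show "\<psi> t \<in> closure (convex hull ((\<lambda>k. v (\<kappa> k) t) ` {N..}))" for N
            using elim(1) t by blast
          fix \<sigma> :: "nat \<Rightarrow> nat" and l
          assume \<sigma>: "strict_mono \<sigma>" and l: "((\<lambda>k. v (\<kappa> k) t) \<circ> \<sigma>) \<longlonglongrightarrow> l"
          \<comment> \<open>Past t0 the default velocity 0 before the start occurs for finitely many
            k only, so every cluster point comes from genuine members of the right-hand
            sides.\<close>
          have "t0 < t" using elim(7) t by auto
          then obtain K where K: "\<And>k. k \<ge> K \<Longrightarrow> s k < t"
            using order_tendstoD(2)[OF s(2)] unfolding eventually_sequentially by metis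
          define \<rho> where "\<rho> j = \<kappa> (\<sigma> (j + K))" for j
          have \<rho>: "strict_mono \<rho>" using \<kappa>(1) \<sigma> unfolding \<rho>_def strict_mono_def by auto
          have K\<rho>: "K \<le> \<rho> j" for j
            using strict_mono_imp_increasing[OF \<sigma>, of "j + K"]
              strict_mono_imp_increasing[OF \<kappa>(1), of "\<sigma> (j + K)"] unfolding \<rho>_def by linarith
          have l': "(\<lambda>j. v (\<rho> j) t) \<longlonglongrightarrow> l"
            using LIMSEQ_ignore_initial_segment[OF l, of K] by (simp add: \<rho>_def o_def)
          have in_s: "t \<in> {s (\<rho> j)..e}" for j using K[OF K\<rho>[of j]] t by auto
          have "\<exists>p. v (\<rho> j) t = fst p + snd p \<and> fst p \<in> ess_near f t (x (\<rho> j) t) (\<eta> (\<rho> j) t) \<and>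
            snd p \<in> aumann_integral (lebesgue_on {s (\<rho> j)..t})
              (\<lambda>\<tau>. (\<lambda>w. \<Phi> (t, \<tau>) *v w) ` ess_near g \<tau> (x (\<rho> j) \<tau>) (\<eta> (\<rho> j) \<tau>))" for j
          proof -
            have "v (\<rho> j) t \<in> approx_rhs \<Phi> f g (\<eta> (\<rho> j)) (s (\<rho> j)) (x (\<rho> j)) t"
              using elim(2) in_s[of j] by blast
            then show ?thesis unfolding approx_rhs_def
              by (elim set_plus_elim) (rule exI[of _ "(_, _)"], simp)
          qed
          then have "\<exists>p. \<forall>j. v (\<rho> j) t = fst (p j) + snd (p j) \<and>
            fst (p j) \<in> ess_near f t (x (\<rho> j) t) (\<eta> (\<rho> j) t) \<and>
            snd (p j) \<in> aumann_integral (lebesgue_on {s (\<rho> j)..t})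
              (\<lambda>\<tau>. (\<lambda>w. \<Phi> (t, \<tau>) *v w) ` ess_near g \<tau> (x (\<rho> j) \<tau>) (\<eta> (\<rho> j) \<tau>))"
            by (intro choice allI)
          then obtain p where p: "\<And>j. v (\<rho> j) t = fst (p j) + snd (p j)"
            "\<And>j. fst (p j) \<in> ess_near f t (x (\<rho> j) t) (\<eta> (\<rho> j) t)"
            "\<And>j. snd (p j) \<in> aumann_integral (lebesgue_on {s (\<rho> j)..t})
              (\<lambda>\<tau>. (\<lambda>w. \<Phi> (t, \<tau>) *v w) ` ess_near g \<tau> (x (\<rho> j) \<tau>) (\<eta> (\<rho> j) \<tau>))"
            by blast
          define \<alpha> \<beta> where "\<alpha> j = fst (p j)" and "\<beta> j = snd (p j)" for j
          note ab = p[folded \<alpha>_def \<beta>_def]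
          have xr': "norm (x k \<tau>) < r" if "\<tau> \<in> {t0..t}" for k \<tau> using xr[of \<tau> k] that t by auto
          have s': "t0 \<le> s k" for k using s(1)[of k] by auto
          have "norm (\<alpha> j) \<le> hf t" for j
            using elim(5) tb xr[OF t, of "\<rho> j"] \<eta>(1,2)[of "\<rho> j" t] ab(2)[of j] by blast
          then have ba: "bounded (range \<alpha>)" by (auto simp: bounded_iff)
          have "norm (\<beta> j) \<le> C * integral {t0..b} (\<lambda>\<tau>. \<bar>hg \<tau>\<bar>)" for j
            by (rule kernel_integral_bound[OF tb \<Phi>t s' _ \<eta>(1,2) ab(3)])
              (use xr' s' in \<open>auto intro: order_trans\<close>)
          then have bb: "bounded (range \<beta>)" by (auto simp: bounded_iff)
          \<comment> \<open>Convergence of a sum does not give convergence of its terms, and the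
            limits of the two terms are treated by different lemmas; boundedness of both supplies a
            common subsequence.\<close>
          obtain \<tau> a0 b0 where \<tau>: "strict_mono (\<tau> :: nat \<Rightarrow> nat)" "(\<lambda>j. \<alpha> (\<tau> j)) \<longlonglongrightarrow> a0" "(\<lambda>j. \<beta> (\<tau> j)) \<longlonglongrightarrow> b0"
            by (rule convergent_subsequence_pair[OF ba bb])
          have sub: "strict_mono (\<lambda>j. \<rho> (\<tau> j))" using \<rho> \<tau>(1) unfolding strict_mono_def by auto
          have sub': "strict_mono (\<lambda>j. \<sigma> (\<tau> j + K))" using \<sigma> \<tau>(1) unfolding strict_mono_def by auto
          have xl: "(\<lambda>j. x (\<rho> (\<tau> j)) u) \<longlonglongrightarrow> y u" if "u \<in> {t0..e}" for u
            using LIMSEQ_subseq_LIMSEQ[OF xlim[OF that] sub'] by (simp add: o_def \<rho>_def)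
          have "a0 \<in> filippov_reg f t (y t)"
          proof (rule ess_near_limit[OF xl[OF t] \<tau>(2) _ ab(2)])
            show "(\<lambda>j. \<eta> (\<rho> (\<tau> j)) t) \<longlonglongrightarrow> 0"
              using LIMSEQ_subseq_LIMSEQ[OF elim(4)[rule_format, OF tb] sub] by (simp add: o_def)
          qed
          moreover have "b0 \<in> ?A"
          proof (rule kernel_integral_limit[OF tb \<Phi>t])
            show "t0 \<le> s (\<rho> (\<tau> j))" for j by (rule s')
            show "(\<lambda>j. s (\<rho> (\<tau> j))) \<longlonglongrightarrow> t0"
              using LIMSEQ_subseq_LIMSEQ[OF s(2) sub] by (simp add: o_def)
            show "norm (x (\<rho> (\<tau> j)) u) < r" if "u \<in> {t0..t}" for j u by (rule xr'[OF that])
            show "(\<lambda>j. x (\<rho> (\<tau> j)) u) \<longlonglongrightarrow> y u" if "u \<in> {t0..t}" for u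
              by (rule xl) (use that t in auto)
            show "AE u in lebesgue. u \<in> {t0..b} \<longrightarrow> (\<lambda>j. \<eta> (\<rho> (\<tau> j)) u) \<longlonglongrightarrow> 0"
              using \<eta>(3) by eventually_elim (use LIMSEQ_subseq_LIMSEQ[OF _ sub] in \<open>auto simp: o_def\<close>)
            show "(\<lambda>j. \<beta> (\<tau> j)) \<longlonglongrightarrow> b0" by (rule \<tau>(3))
          qed (rule \<eta>(1) \<eta>(2) ab(3))+
          moreover have "l = a0 + b0"
          proof (rule LIMSEQ_unique)
            show "(\<lambda>j. v (\<rho> (\<tau> j)) t) \<longlonglongrightarrow> l"
              using LIMSEQ_subseq_LIMSEQ[OF l' \<tau>(1)] by (simp add: o_def)
            show "(\<lambda>j. v (\<rho> (\<tau> j)) t) \<longlonglongrightarrow> a0 + b0"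
              unfolding ab(1) by (rule tendsto_add[OF \<tau>(2,3)])
          qed
          ultimately show "l \<in> filippov_reg f t (y t) + ?A" by (auto intro: set_plus_intro)
        qed
      qed
    qed
  qed (use e in auto)
  then show thesis
    by (rule that[OF \<kappa>(1)]) (use \<kappa>(2) in blast)
qed

section \<open>Approximate solutions in differential form: a priori bound and compactness\<close>

text \<open>The inclusion is only required as long as the whole past of \<open>x\<close> lies in the ball of radius
  \<open>r\<close>, since the right-hand side at time \<open>t\<close> depends on all of \<open>x\<close> on \<open>{s..t}\<close>.\<close>

definition approx_deriv :: "(real \<Rightarrow> real) \<Rightarrow> real \<Rightarrow> (real \<Rightarrow> real^'n) \<Rightarrow> bool"
  where "approx_deriv \<eta> s x \<longleftrightarrow> abs_continuous_on {s..b} x \<and>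
    (AE t in lebesgue. t \<in> {s..b} \<longrightarrow> (\<forall>\<tau>\<in>{s..t}. norm (x \<tau>) < r) \<longrightarrow>
      (\<exists>v. (x has_vector_derivative v) (at t within {s..b}) \<and> v \<in> approx_rhs \<Phi> f g \<eta> s x t))"

text \<open>The velocity is picked pointwise, without measurability. The fundamental theorem for
  absolutely continuous functions gives its gauge integral, and domination by h upgrades this to
  absolute integrability.\<close>

lemma approx_deriv_integral_form:
  assumes x: "approx_deriv \<eta> s x" and s: "t0 \<le> s" "s \<le> e" "e \<le> b"
    and xr: "\<And>\<tau>. \<tau> \<in> {s..e} \<Longrightarrow> norm (x \<tau>) < r"
    and \<eta>: "\<And>\<tau>. 0 \<le> \<eta> \<tau>" "\<And>\<tau>. \<eta> \<tau> \<le> c"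
  obtains v where "v absolutely_integrable_on {s..e}" "\<And>t. t \<in> {s..e} \<Longrightarrow> x t = x s + integral {s..t} v"
    "AE t in lebesgue. t \<in> {s..e} \<longrightarrow> v t \<in> approx_rhs \<Phi> f g \<eta> s x t" "\<And>t. norm (v t) \<le> h t"
proof -
  define P where "P t v \<longleftrightarrow> (x has_vector_derivative v) (at t within {s..b}) \<and>
    v \<in> approx_rhs \<Phi> f g \<eta> s x t \<and> norm v \<le> h t" for t v
  \<comment> \<open>The default 0 makes the bound by h valid at every time, not merely almost
    everywhere.\<close>
  define v where "v t = (if \<exists>v. P t v then SOME v. P t v else 0)" for t
  have Pv: "P t (v t)" if "P t w" for t w
    using someI[of "P t" w] that unfolding v_def by auto
  have vb: "norm (v t) \<le> h t" for t
    using Pv[of t] h_nonneg[of t] unfolding P_def by (cases "\<exists>v. P t v") (auto simp: P_def v_def)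
  have ae: "AE t in lebesgue. t \<in> {s..e} \<longrightarrow> P t (v t)"
    using x[unfolded approx_deriv_def, THEN conjunct2] approx_rhs_bound
  proof eventually_elim
    case (elim t)
    show ?case
    proof
      assume t: "t \<in> {s..e}"
      then have xt: "\<forall>\<tau>\<in>{s..t}. norm (x \<tau>) < r" using xr by auto
      have "t \<in> {s..b}" "t \<in> {t0..b}" "s \<in> {t0..t}" using t s by auto
      then obtain w where w: "(x has_vector_derivative w) (at t within {s..b})" "w \<in> approx_rhs \<Phi> f g \<eta> s x t"
        using elim(1) xt by blast
      have "norm w \<le> h t" using elim(2) \<open>t \<in> {t0..b}\<close> \<open>s \<in> {t0..t}\<close> xt \<eta> w(2) by blast
      then show "P t (v t)" using w by (intro Pv[of t w]) (auto simp: P_def)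
    qed
  qed
  have int: "(v has_integral (x t - x s)) {s..t}" if t: "t \<in> {s..e}" for t
  proof (rule abs_continuous_on_has_integral)
    show "s \<le> t" using t by simp
    show "abs_continuous_on {s..t} x"
      by (rule abs_continuous_on_subset[OF x[unfolded approx_deriv_def, THEN conjunct1]]) (use t s in auto)
    show "AE u in lebesgue. u \<in> {s..t} \<longrightarrow> (x has_vector_derivative v u) (at u within {s..t})"
      using ae
    proof eventually_elim
      case (elim u)
      show ?case
      proof
        assume "u \<in> {s..t}"
        then have "P u (v u)" using elim t by auto
        then show "(x has_vector_derivative v u) (at u within {s..t})"
          unfolding P_def by (elim conjE has_vector_derivative_within_subset) (use t s in auto)
      qed
    qed
  qed
  show thesis
  proof
    show "v absolutely_integrable_on {s..e}"
    proof (rule absolutely_integrable_integrable_bound)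
      show "v integrable_on {s..e}" using int[of e] s by auto
      show "h integrable_on {s..e}"
        by (rule set_lebesgue_integral_eq_integral(1)[OF h_int_sub]) (use s in auto)
    qed (rule vb)
    show "x t = x s + integral {s..t} v" if "t \<in> {s..e}" for t
      using integral_unique[OF int[OF that]] by simp
    show "AE t in lebesgue. t \<in> {s..e} \<longrightarrow> v t \<in> approx_rhs \<Phi> f g \<eta> s x t"
      using ae by eventually_elim (auto simp: P_def)
  qed (rule vb)
qed

text \<open>At the first time when the norm reaches \<rho> + 1 the whole past is still in the ball
  of radius r, so the inclusion and the bound h are available up to then. But the integral of h is
  too small for the norm to have grown by 1 since u.\<close>

lemma approx_deriv_a_priori:
  assumes x: "approx_deriv \<eta> s x" and s: "t0 \<le> s" "s \<le> u" "u \<le> u'" "u' \<le> b"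
    and xu: "\<And>\<tau>. \<tau> \<in> {s..u} \<Longrightarrow> norm (x \<tau>) < \<rho>"
    and hu: "integral {u..u'} h < 1" and \<rho>: "\<rho> + 1 < r"
    and \<eta>: "\<And>\<tau>. 0 \<le> \<eta> \<tau>" "\<And>\<tau>. \<eta> \<tau> \<le> c"
    and \<tau>: "\<tau> \<in> {s..u'}"
  shows "norm (x \<tau>) < \<rho> + 1"
proof (rule ccontr)
  assume "\<not> norm (x \<tau>) < \<rho> + 1"
  have "continuous_on {s..b} x"
    using x unfolding approx_deriv_def by (auto intro: abs_continuous_on_imp_continuous_on)
  then have cont: "continuous_on {a..d} (\<lambda>t. norm (x t))" if "s \<le> a" "d \<le> b" for a d
    using that by (intro continuous_on_norm) (auto elim: continuous_on_subset)
  have xs: "norm (x s) < \<rho>" using xu s by auto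
  define A where "A = {t \<in> {s..u'}. norm (x t) = \<rho> + 1}"
  have hit: "\<exists>t\<in>A. t \<le> d" if "d \<in> {s..u'}" "\<not> norm (x d) < \<rho> + 1" for d
  proof -
    have "\<exists>t\<ge>s. t \<le> d \<and> norm (x t) = \<rho> + 1"
      using xs that s by (intro IVT' cont) auto
    then show ?thesis using that unfolding A_def by auto
  qed
  have "compact A"
  proof -
    have "closed ({s..u'} \<inter> (\<lambda>t. norm (x t)) -` {\<rho> + 1})"
      by (rule continuous_closed_preimage) (use cont s in auto)
    then have "compact ({s..u'} \<inter> ({s..u'} \<inter> (\<lambda>t. norm (x t)) -` {\<rho> + 1}))"
      by (intro compact_Int_closed compact_Icc)
    moreover have "A = {s..u'} \<inter> ({s..u'} \<inter> (\<lambda>t. norm (x t)) -` {\<rho> + 1})"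
      unfolding A_def by auto
    ultimately show ?thesis by simp
  qed
  moreover have "A \<noteq> {}" using hit[OF \<tau>] \<open>\<not> norm (x \<tau>) < \<rho> + 1\<close> by auto
  ultimately have "\<exists>t\<in>A. \<forall>d\<in>A. t \<le> d" by (rule compact_attains_inf)
  then obtain t where t: "t \<in> A" "\<And>d. d \<in> A \<Longrightarrow> t \<le> d" by blast
  have ts: "t \<in> {s..u'}" "norm (x t) = \<rho> + 1" using t(1) unfolding A_def by auto
  have "u < t" using xu[of t] ts s by (cases "t \<le> u") auto
  \<comment> \<open>A norm of at least \<rho> + 1 before t would, by the intermediate value theorem,
    produce an earlier hitting time. At t itself the strict inequality \<rho> + 1 < r is
    used.\<close>
  have xr: "norm (x d) < r" if d: "d \<in> {s..t}" for d
  proof (cases "norm (x d) < \<rho> + 1")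
    case False
    then obtain d' where "d' \<in> A" "d' \<le> d" using hit[of d] d ts by auto
    then have "d = t" using t(2)[of d'] d by auto
    then show ?thesis using ts(2) \<rho> by simp
  qed (use \<rho> in simp)
  have st: "s \<le> t" "t \<le> b" using ts s by auto
  obtain v where v: "v absolutely_integrable_on {s..t}" "\<And>d. d \<in> {s..t} \<Longrightarrow> x d = x s + integral {s..d} v"
    "AE d in lebesgue. d \<in> {s..t} \<longrightarrow> v d \<in> approx_rhs \<Phi> f g \<eta> s x d" "\<And>d. norm (v d) \<le> h d"
    by (rule approx_deriv_integral_form[OF x s(1) st xr \<eta>]) (assumption | rule that)+
  have eq: "x t - x u = integral {u..t} v"
    using v(2)[of t] v(2)[of u] indefinite_integral_diff[OF v(1), of u t] \<open>u < t\<close> s by simp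
  have "norm (x t - x u) \<le> integral {u..t} h"
    unfolding eq
  proof (rule norm_integral_le_AE)
    show "v absolutely_integrable_on {u..t}"
      by (rule set_integrable_subset[OF v(1)]) (use s in auto)
    show "h absolutely_integrable_on {u..t}" using ts s by (intro h_int_sub) auto
  qed (use v(4) in auto)
  moreover have "integral {u..t} h \<le> integral {u..u'} h"
  proof (rule integral_subset_le)
    show "h integrable_on {u..t}" "h integrable_on {u..u'}"
      using ts s by (auto intro!: set_lebesgue_integral_eq_integral(1) h_int_sub)
  qed (use ts h_nonneg in auto)
  moreover have "norm (x u) < \<rho>" using xu[of u] s by auto
  ultimately show False using hu ts(2) norm_triangle_sub[of "x t" "x u"] by linarith
qed

text \<open>Different starting times are brought to a common interval by freezing each function at
  its initial value before its start, with velocity 0 there.\<close>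

theorem approx_deriv_compact:
  assumes e: "t0 < e" "e \<le> b"
    and s: "\<And>k. s k \<in> {t0..e}" "s \<longlonglongrightarrow> t0"
    and \<eta>: "\<And>k \<tau>. 0 \<le> \<eta> k \<tau>" "\<And>k \<tau>. \<eta> k \<tau> \<le> c"
      "AE \<tau> in lebesgue. \<tau> \<in> {t0..b} \<longrightarrow> (\<lambda>k. \<eta> k \<tau>) \<longlonglongrightarrow> 0"
    and x: "\<And>k. approx_deriv (\<eta> k) (s k) (x k)"
    and xr: "\<And>k \<tau>. \<tau> \<in> {s k..e} \<Longrightarrow> norm (x k \<tau>) < r"
    and x0: "(\<lambda>k. x k (s k)) \<longlonglongrightarrow> x0"
  obtains \<sigma> y where "strict_mono (\<sigma> :: nat \<Rightarrow> nat)" "filippov_solution \<Phi> f g t0 x0 {t0..e} y"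
    "\<And>\<epsilon>. 0 < \<epsilon> \<Longrightarrow> \<exists>N. \<forall>n\<ge>N. \<forall>t\<in>{t0..e}. norm (x (\<sigma> n) (max t (s (\<sigma> n))) - y t) < \<epsilon>"
proof -
  have s': "t0 \<le> s k" "s k \<le> e" for k using s(1)[of k] by auto
  have "\<exists>v. v absolutely_integrable_on {s k..e} \<and> (\<forall>t\<in>{s k..e}. x k t = x k (s k) + integral {s k..t} v) \<and>
    (AE t in lebesgue. t \<in> {s k..e} \<longrightarrow> v t \<in> approx_rhs \<Phi> f g (\<eta> k) (s k) (x k) t)" for k
    by (rule approx_deriv_integral_form[OF x[of k] s'(1) s'(2)[of k] e(2) xr \<eta>(1,2)]) blast+
  then have "\<exists>v. \<forall>k. v k absolutely_integrable_on {s k..e} \<and> (\<forall>t\<in>{s k..e}. x k t = x k (s k) + integral {s k..t} (v k)) \<and>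
    (AE t in lebesgue. t \<in> {s k..e} \<longrightarrow> v k t \<in> approx_rhs \<Phi> f g (\<eta> k) (s k) (x k) t)"
    by (intro choice allI)
  then obtain v where v: "\<And>k. v k absolutely_integrable_on {s k..e}"
    "\<And>k t. t \<in> {s k..e} \<Longrightarrow> x k t = x k (s k) + integral {s k..t} (v k)"
    "\<And>k. AE t in lebesgue. t \<in> {s k..e} \<longrightarrow> v k t \<in> approx_rhs \<Phi> f g (\<eta> k) (s k) (x k) t"
    by blast
  define x' where "x' k t = x k (max t (s k))" for k t
  define v' where "v' k t = (if t \<in> {s k..e} then v k t else 0)" for k t
  have v'i: "v' k absolutely_integrable_on {t0..e}" for k
  proof -
    have "v' k = (\<lambda>t. indicator {s k..e} t *\<^sub>R v k t)"
      by (auto simp: v'_def fun_eq_iff)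
    with v(1)[of k] have "integrable lebesgue (v' k)" by (simp add: set_integrable_def)
    then show ?thesis unfolding set_integrable_def by (intro integrable_mult_indicator) auto
  qed
  have x'v': "x' k t = x' k t0 + integral {t0..t} (v' k)" if t: "t \<in> {t0..e}" for k t
  proof (cases "t < s k")
    case True
    then have "integral {t0..t} (v' k) = integral {t0..t} (\<lambda>_. 0)"
      by (intro integral_cong) (auto simp: v'_def)
    with True t s'(1)[of k] show ?thesis by (simp add: x'_def max_absorb2)
  next
    case False
    have "integral {t0..s k} (v' k) = integral {t0..s k} (\<lambda>_. 0)"
      by (rule integral_spike[of "{s k}"]) (auto simp: v'_def)
    moreover have "integral {s k..t} (v' k) = integral {s k..t} (v k)"
      using t by (intro integral_cong) (auto simp: v'_def)
    moreover have "integral {t0..t} (v' k) - integral {t0..s k} (v' k) = integral {s k..t} (v' k)"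
      by (rule indefinite_integral_diff[OF v'i]) (use False t s' in auto)
    ultimately have "integral {t0..t} (v' k) = integral {s k..t} (v k)" by simp
    with v(2)[of t k] False t s'(1)[of k] show ?thesis by (simp add: x'_def max_absorb1 max_absorb2)
  qed
  have rhs': "AE t in lebesgue. t \<in> {s k..e} \<longrightarrow> v' k t \<in> approx_rhs \<Phi> f g (\<eta> k) (s k) (x' k) t" for k
    using v(3)[of k]
  proof eventually_elim
    case (elim t)
    show ?case
    proof
      assume t: "t \<in> {s k..e}"
      then have "v' k t \<in> approx_rhs \<Phi> f g (\<eta> k) (s k) (x k) t" using elim by (simp add: v'_def)
      then show "v' k t \<in> approx_rhs \<Phi> f g (\<eta> k) (s k) (x' k) t"
        by (rule approx_rhs_cong[rotated 2]) (use t in \<open>auto simp: x'_def max_absorb1\<close>)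
    qed
  qed
  have "(\<lambda>k. x' k t0) = (\<lambda>k. x k (s k))" using s'(1) by (simp add: x'_def max_absorb2)
  with x0 have x0': "(\<lambda>k. x' k t0) \<longlonglongrightarrow> x0" by simp
  have xr': "norm (x' k \<tau>) < r" if "\<tau> \<in> {t0..e}" for k \<tau>
    unfolding x'_def by (rule xr) (use that s' in auto)
  have v0': "v' k t = 0" if "t < s k" for k t using that by (simp add: v'_def)
  show thesis
    by (rule approx_solutions_compact[OF e s \<eta> xr' v'i x'v' rhs' v0' x0'])
      (assumption | rule that[folded x'_def])+
qed

end

section \<open>Uniform bounds from the Filippov Condition and the kernel\<close>

lemma filippov_condition_bound:
  assumes f: "filippov_condition f" and "0 < \<rho>"
  obtains m where "m absolutely_integrable_on {a..b}"
    "AE t in lebesgue. t \<in> {a..b} \<longrightarrow> (AE y in lebesgue. y \<in> ball 0 \<rho> \<longrightarrow> norm (f (t, y)) \<le> m t)"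
proof -
  define \<alpha> where "\<alpha> = \<bar>a\<bar> + \<bar>b\<bar> + 1"
  have "\<alpha> > 0" and sub: "{a..b} \<subseteq> {-\<alpha><..<\<alpha>}" unfolding \<alpha>_def by auto
  then obtain m where m: "integrable (lebesgue_on {-\<alpha><..<\<alpha>}) m"
    "AE t in lebesgue_on {-\<alpha><..<\<alpha>}. AE x in lebesgue_on (ball 0 \<rho>). norm (f (t, x)) \<le> m t"
    using f \<open>0 < \<rho>\<close> unfolding filippov_condition_def by blast
  have meas: "{-\<alpha><..<\<alpha>} \<in> sets lebesgue" "ball (0::real^'n) \<rho> \<in> sets lebesgue" by auto
  show thesis
  proof
    have "m absolutely_integrable_on {-\<alpha><..<\<alpha>}"
      using m(1) by (simp add: absolutely_integrable_on_iff)
    then show "m absolutely_integrable_on {a..b}"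
      by (rule set_integrable_subset) (use sub in auto)
    show "AE t in lebesgue. t \<in> {a..b} \<longrightarrow> (AE y in lebesgue. y \<in> ball 0 \<rho> \<longrightarrow> norm (f (t, y)) \<le> m t)"
      using m(2) unfolding AE_lebesgue_on_iff[OF meas(1)] AE_lebesgue_on_iff[OF meas(2)]
      by eventually_elim (use sub in auto)
  qed
qed

text \<open>The essential bound is taken on the compact triangle cut from \<open>Delta\<close> by a
  square and then sliced by Fubini's theorem.\<close>

lemma locally_ess_bounded_on_Delta_iterated:
  assumes \<Phi>: "locally_ess_bounded_on Delta \<Phi>"
  obtains C where "0 \<le> C" "AE t in lebesgue. t \<in> {a..b} \<longrightarrow>
    (AE \<tau> in lebesgue. \<tau> \<in> {a..t} \<longrightarrow> norm (\<Phi> (t, \<tau>)) \<le> C)"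
proof -
  define K where "K = Delta \<inter> ({a..b} \<times> {a..b})"
  have "closed Delta"
    unfolding Delta_def case_prod_beta by (intro closed_Collect_le continuous_intros)
  then have "compact K" unfolding K_def by (intro closed_Int_compact compact_Times compact_Icc)
  then have fin: "esssup (lebesgue_on K) (\<lambda>p. ereal (norm (\<Phi> p))) < \<infinity>"
    using \<Phi> unfolding locally_ess_bounded_on_def K_def by blast
  define C where "C = max 0 (real_of_ereal (esssup (lebesgue_on K) (\<lambda>p. ereal (norm (\<Phi> p)))))"
  have "K \<in> sets lebesgue" using \<open>compact K\<close> by (simp add: compact_imp_closed lebesgue_closedin borel_closed)
  then have "AE p in lebesgue. p \<in> K \<longrightarrow> ereal (norm (\<Phi> p)) \<le> esssup (lebesgue_on K) (\<lambda>p. ereal (norm (\<Phi> p)))"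
    using esssup_AE[of "\<lambda>p. ereal (norm (\<Phi> p))" "lebesgue_on K"] by (simp add: AE_restrict_space_iff)
  then have "AE p in lebesgue. p \<in> K \<longrightarrow> norm (\<Phi> p) \<le> C"
  proof eventually_elim
    case (elim p)
    show ?case
    proof
      assume "p \<in> K"
      with elim have "ereal (norm (\<Phi> p)) \<le> esssup (lebesgue_on K) (\<lambda>p. ereal (norm (\<Phi> p)))" by blast
      then show "norm (\<Phi> p) \<le> C"
        using fin unfolding C_def
        by (cases "esssup (lebesgue_on K) (\<lambda>p. ereal (norm (\<Phi> p)))") auto
    qed
  qed
  then obtain N0 where N0: "N0 \<in> null_sets lebesgue" "{p. \<not> (p \<in> K \<longrightarrow> norm (\<Phi> p) \<le> C)} \<subseteq> N0"
    unfolding eventually_ae_filter by auto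
  \<comment> \<open>Slicing is done in the product of Borel-Lebesgue measures, so the exceptional
    set is first enclosed in a Borel null set.\<close>
  obtain N where N: "N \<in> null_sets lborel" "{p. \<not> (p \<in> K \<longrightarrow> norm (\<Phi> p) \<le> C)} \<subseteq> N"
    using N0(1)[unfolded null_sets_completion_iff2] N0(2) by blast
  have "AE p in lborel \<Otimes>\<^sub>M lborel. p \<in> K \<longrightarrow> norm (\<Phi> p) \<le> C"
    unfolding lborel_prod by (rule AE_I'[OF N(1)]) (use N(2) in auto)
  then have "AE t in lborel. AE \<tau> in lborel. (t, \<tau>) \<in> K \<longrightarrow> norm (\<Phi> (t, \<tau>)) \<le> C"
    by (rule lborel_pair.AE_pair)
  then have "AE t in lborel. t \<in> {a..b} \<longrightarrow> (AE \<tau> in lebesgue. \<tau> \<in> {a..t} \<longrightarrow> norm (\<Phi> (t, \<tau>)) \<le> C)"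
  proof eventually_elim
    case (elim t)
    show ?case
    proof
      assume t: "t \<in> {a..b}"
      have "AE \<tau> in lebesgue. (t, \<tau>) \<in> K \<longrightarrow> norm (\<Phi> (t, \<tau>)) \<le> C"
        using elim by (rule AE_completion)
      then show "AE \<tau> in lebesgue. \<tau> \<in> {a..t} \<longrightarrow> norm (\<Phi> (t, \<tau>)) \<le> C"
        by eventually_elim (use t in \<open>auto simp: K_def Delta_def\<close>)
    qed
  qed
  then have "AE t in lebesgue. t \<in> {a..b} \<longrightarrow> (AE \<tau> in lebesgue. \<tau> \<in> {a..t} \<longrightarrow> norm (\<Phi> (t, \<tau>)) \<le> C)"
    by (rule AE_completion)
  moreover have "0 \<le> C" unfolding C_def by simp
  ultimately show thesis using that by blast
qed

lemma filippov_bounds_exist: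
  fixes \<Phi> :: "real \<times> real \<Rightarrow> real^'n^'n" and f g :: "real \<times> (real^'n) \<Rightarrow> real^'n"
  assumes \<Phi>: "locally_ess_bounded_on Delta \<Phi>" and f: "filippov_condition f" and g: "filippov_condition g"
    and rc: "0 < r" "0 \<le> c"
  obtains C hf hg where "filippov_bounds \<Phi> f g t0 b r c C hf hg"
proof -
  obtain C where C: "0 \<le> C" "AE t in lebesgue. t \<in> {t0..b} \<longrightarrow>
    (AE \<tau> in lebesgue. \<tau> \<in> {t0..t} \<longrightarrow> norm (\<Phi> (t, \<tau>)) \<le> C)"
    by (rule locally_ess_bounded_on_Delta_iterated[OF \<Phi>])
  have ex: "\<exists>k. k absolutely_integrable_on {t0..b} \<and> (AE t in lebesgue. t \<in> {t0..b} \<longrightarrow>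
      (\<forall>z \<eta> v. norm z < r \<longrightarrow> 0 \<le> \<eta> \<longrightarrow> \<eta> \<le> c \<longrightarrow> v \<in> ess_near u t z \<eta> \<longrightarrow> norm v \<le> k t))"
    if u: "filippov_condition u" for u :: "real \<times> (real^'n) \<Rightarrow> real^'n"
  proof -
    \<comment> \<open>Values near z of norm below r, with enlargement up to c, come from points of
      norm below r + c; the correction w then adds at most c to the bound.\<close>
    obtain m where m: "m absolutely_integrable_on {t0..b}"
      "AE t in lebesgue. t \<in> {t0..b} \<longrightarrow> (AE y in lebesgue. y \<in> ball 0 (r + c) \<longrightarrow> norm (u (t, y)) \<le> m t)"
      by (rule filippov_condition_bound[OF u, of "r + c" t0 b]) (use rc in auto)
    have "(\<lambda>t. m t + c) absolutely_integrable_on {t0..b}"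
      using m(1) by (intro set_integral_add(1)) (auto intro!: absolutely_integrable_continuous_real)
    moreover have "AE t in lebesgue. t \<in> {t0..b} \<longrightarrow>
      (\<forall>z \<eta> v. norm z < r \<longrightarrow> 0 \<le> \<eta> \<longrightarrow> \<eta> \<le> c \<longrightarrow> v \<in> ess_near u t z \<eta> \<longrightarrow> norm v \<le> m t + c)"
      using m(2)
    proof eventually_elim
      case (elim t)
      show ?case
      proof (intro impI allI)
        fix z \<eta> v
        assume "t \<in> {t0..b}" "norm z < r" "0 \<le> \<eta>" "\<eta> \<le> c" "v \<in> ess_near u t z \<eta>"
        then have "norm v \<le> m t + \<eta>"
          using elim by (intro ess_near_bound[where r = "r + c"]) auto
        then show "norm v \<le> m t + c" using \<open>\<eta> \<le> c\<close> by simp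
      qed
    qed
    ultimately show ?thesis by blast
  qed
  obtain hf hg where "hf absolutely_integrable_on {t0..b}" "hg absolutely_integrable_on {t0..b}"
    "AE t in lebesgue. t \<in> {t0..b} \<longrightarrow>
      (\<forall>z \<eta> v. norm z < r \<longrightarrow> 0 \<le> \<eta> \<longrightarrow> \<eta> \<le> c \<longrightarrow> v \<in> ess_near f t z \<eta> \<longrightarrow> norm v \<le> hf t)"
    "AE t in lebesgue. t \<in> {t0..b} \<longrightarrow>
      (\<forall>z \<eta> v. norm z < r \<longrightarrow> 0 \<le> \<eta> \<longrightarrow> \<eta> \<le> c \<longrightarrow> v \<in> ess_near g t z \<eta> \<longrightarrow> norm v \<le> hg t)"
    using ex[OF f] ex[OF g] by blast
  with C have "filippov_bounds \<Phi> f g t0 b r c C hf hg" by (intro filippov_bounds.intro)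
  then show thesis by (rule that)
qed

section \<open>Changing solutions off their interval and gluing them\<close>

lemma filippov_solution_cong:
  assumes "filippov_solution \<Phi> f g t0 x0 {t0..e} y" "\<And>t. t \<in> {t0..e} \<Longrightarrow> z t = y t"
  shows "filippov_solution \<Phi> f g t0 x0 {t0..e} z"
proof -
  note y = assms(1)[unfolded filippov_solution_def]
  have m: "{t0..e} \<in> sets lebesgue" by simp
  have "abs_continuous_on {t0..e} z"
    unfolding abs_continuous_on_def
  proof (intro allI impI)
    fix c d \<epsilon> :: real assume cd: "{c..d} \<subseteq> {t0..e}" and "\<epsilon> > 0"
    have "abs_continuous_on {t0..e} y" using y by blast
    from this[unfolded abs_continuous_on_def, THEN spec, THEN spec, THEN mp, OF cd, THEN spec, THEN mp, OF \<open>\<epsilon> > 0\<close>]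
    obtain \<eta> where \<eta>: "\<eta> > 0" "\<And>(k::nat) l u. (\<forall>i<k. c \<le> l i \<and> l i \<le> u i \<and> u i \<le> d) \<and>
      disjoint_family_on (\<lambda>i. {l i<..<u i}) {..<k} \<and> (\<Sum>i<k. u i - l i) < \<eta> \<Longrightarrow>
      (\<Sum>i<k. norm (y (u i) - y (l i))) < \<epsilon>" by blast
    have "(\<Sum>i<k. norm (z (u i) - z (l i))) < \<epsilon>"
      if lu: "(\<forall>i<k. c \<le> l i \<and> l i \<le> u i \<and> u i \<le> d) \<and>
      disjoint_family_on (\<lambda>i. {l i<..<u i}) {..<k} \<and> (\<Sum>i<k. u i - l i) < \<eta>" for k :: nat and l u
    proof -
      have "norm (z (u i) - z (l i)) = norm (y (u i) - y (l i))" if "i < k" for i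
      proof -
        have "u i \<in> {c..d}" "l i \<in> {c..d}" using lu that by (auto intro: order_trans)
        then show ?thesis using cd assms(2) by auto
      qed
      then have "(\<Sum>i<k. norm (z (u i) - z (l i))) = (\<Sum>i<k. norm (y (u i) - y (l i)))"
        by (intro sum.cong) auto
      also have "\<dots> < \<epsilon>" by (rule \<eta>(2)[OF lu])
      finally show ?thesis .
    qed
    with \<eta>(1) show "\<exists>\<eta>>0. \<forall>(k::nat) l u. (\<forall>i<k. c \<le> l i \<and> l i \<le> u i \<and> u i \<le> d) \<and>
      disjoint_family_on (\<lambda>i. {l i<..<u i}) {..<k} \<and> (\<Sum>i<k. u i - l i) < \<eta> \<longrightarrow>
      (\<Sum>i<k. norm (z (u i) - z (l i))) < \<epsilon>" by blast
  qed
  moreover have "AE t in lebesgue_on {t0..e}. \<exists>v. (z has_vector_derivative v) (at t within {t0..e}) \<and>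
      v \<in> filippov_reg f t (z t) +
        aumann_integral (lebesgue_on {t0..t}) (\<lambda>\<tau>. (\<lambda>w. \<Phi> (t, \<tau>) *v w) ` filippov_reg g \<tau> (z \<tau>))"
  proof -
    have "AE t in lebesgue_on {t0..e}. \<exists>v. (y has_vector_derivative v) (at t within {t0..e}) \<and>
      v \<in> filippov_reg f t (y t) +
        aumann_integral (lebesgue_on {t0..t}) (\<lambda>\<tau>. (\<lambda>w. \<Phi> (t, \<tau>) *v w) ` filippov_reg g \<tau> (y \<tau>))"
      using y by blast
    then show ?thesis
      unfolding AE_lebesgue_on_iff[OF m]
    proof eventually_elim
      case (elim t)
      show ?case
      proof
        assume t: "t \<in> {t0..e}"
        then obtain v where v: "(y has_vector_derivative v) (at t within {t0..e})"
          \<comment> \<open>With \<eta> = 0 the exact right-hand side is an instance of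
            \<open>approx_rhs\<close>, so its dependence on the past alone is already known.\<close>
          "v \<in> approx_rhs \<Phi> f g (\<lambda>_. 0) t0 y t"
          using elim unfolding approx_rhs_def filippov_reg_eq_ess_near by blast
        have "v \<in> approx_rhs \<Phi> f g (\<lambda>_. 0) t0 z t"
          by (rule approx_rhs_cong[OF _ _ v(2)]) (use t assms(2) in auto)
        moreover have "(z has_vector_derivative v) (at t within {t0..e})"
          by (rule has_vector_derivative_transform[OF t _ v(1)]) (rule assms(2))
        ultimately show "\<exists>v. (z has_vector_derivative v) (at t within {t0..e}) \<and>
          v \<in> filippov_reg f t (z t) +
            aumann_integral (lebesgue_on {t0..t}) (\<lambda>\<tau>. (\<lambda>w. \<Phi> (t, \<tau>) *v w) ` filippov_reg g \<tau> (z \<tau>))"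
          unfolding approx_rhs_def filippov_reg_eq_ess_near by blast
      qed
    qed
  qed
  ultimately show ?thesis
    unfolding filippov_solution_def using y assms(2)[of t0] by auto
qed

text \<open>Countably many exceptional sets are merged. At an interior time the derivative within
  any of the intervals is the ordinary one, so the pieces agree; the only boundary point, t0, is
  dropped as null.\<close>

lemma filippov_solution_exhaust:
  assumes "t0 < \<sigma>" and e: "\<And>t. t < \<sigma> \<Longrightarrow> \<exists>i::nat. t < e i" "\<And>i. e i < \<sigma>"
    and z: "\<And>i. filippov_solution \<Phi> f g t0 x0 {t0..e i} z"
  shows "filippov_solution \<Phi> f g t0 x0 {t0..<\<sigma>} z"
  unfolding filippov_solution_def
proof (intro conjI)
  have m: "{t0..<\<sigma>} \<in> sets lebesgue" "{t0..e i} \<in> sets lebesgue" for i by simp_all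
  show "abs_continuous_on {t0..<\<sigma>} z"
  proof (rule abs_continuous_on_exhaust)
    fix d assume "d \<in> {t0..<\<sigma>}"
    then obtain i where "d < e i" using e(1)[of d] by auto
    then show "abs_continuous_on {t0..d} z"
      using z[of i] unfolding filippov_solution_def by (auto elim!: abs_continuous_on_subset)
  qed (use assms in auto)
  have "AE t in lebesgue. \<forall>i. t \<in> {t0..e i} \<longrightarrow> (\<exists>v. (z has_vector_derivative v) (at t within {t0..e i}) \<and>
      v \<in> filippov_reg f t (z t) +
        aumann_integral (lebesgue_on {t0..t}) (\<lambda>\<tau>. (\<lambda>w. \<Phi> (t, \<tau>) *v w) ` filippov_reg g \<tau> (z \<tau>)))"
    using z unfolding filippov_solution_def AE_lebesgue_on_iff[OF m(2)] by (simp add: AE_all_countable)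
  then show "AE t in lebesgue_on {t0..<\<sigma>}. \<exists>v. (z has_vector_derivative v) (at t within {t0..<\<sigma>}) \<and>
      v \<in> filippov_reg f t (z t) +
        aumann_integral (lebesgue_on {t0..t}) (\<lambda>\<tau>. (\<lambda>w. \<Phi> (t, \<tau>) *v w) ` filippov_reg g \<tau> (z \<tau>))"
    unfolding AE_lebesgue_on_iff[OF m(1)] using AE_singleton[of t0]
  proof eventually_elim
    case (elim t)
    show ?case
    proof
      assume t: "t \<in> {t0..<\<sigma>}"
      then obtain i where i: "t < e i" using e(1)[of t] by auto
      have "t0 < t" using t elim(2) by auto
      have "at t within {t0..e i} = at t" "at t within {t0..<\<sigma>} = at t"
        using i \<open>t0 < t\<close> t e(2)[of i]
        by (auto intro!: at_within_open_subset[of t "{t0<..<e i}"])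
      with elim(1)[THEN spec, of i] i \<open>t0 < t\<close>
      show "\<exists>v. (z has_vector_derivative v) (at t within {t0..<\<sigma>}) \<and>
        v \<in> filippov_reg f t (z t) +
          aumann_integral (lebesgue_on {t0..t}) (\<lambda>\<tau>. (\<lambda>w. \<Phi> (t, \<tau>) *v w) ` filippov_reg g \<tau> (z \<tau>))"
        by simp
    qed
  qed
  show "z t0 = x0" using z[of 0] unfolding filippov_solution_def by blast
qed (use \<open>t0 < \<sigma>\<close> in \<open>auto simp: is_interval_co\<close>)

section \<open>From perturbed solutions to limits on the whole interval\<close>

context filippov_bounds
begin

text \<open>The perturbed regularizations are controlled only inside the ball of radius r. The
  condition on the past in \<open>approx_deriv\<close> absorbs this, at t for the local term and at
  all earlier times for the integral.\<close>

lemma filippov_solution_imp_approx_deriv: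
  assumes x: "filippov_solution \<Phi> f' g' s x0 {s..b} x" and s: "t0 \<le> s"
    and incf: "AE t in lebesgue. t \<in> {t0..b} \<longrightarrow> (\<forall>z. norm z < r \<longrightarrow> filippov_reg f' t z \<subseteq> ess_near f t z (\<eta> t))"
    and incg: "AE t in lebesgue. t \<in> {t0..b} \<longrightarrow> (\<forall>z. norm z < r \<longrightarrow> filippov_reg g' t z \<subseteq> ess_near g t z (\<eta> t))"
  shows "approx_deriv \<eta> s x"
  unfolding approx_deriv_def
proof
  have m: "{s..e} \<in> sets lebesgue" for e by simp
  note x' = x[unfolded filippov_solution_def AE_lebesgue_on_iff[OF m]]
  show "abs_continuous_on {s..b} x" using x' by blast
  have "AE t in lebesgue. t \<in> {s..b} \<longrightarrow> (\<exists>v. (x has_vector_derivative v) (at t within {s..b}) \<and>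
      v \<in> filippov_reg f' t (x t) +
        aumann_integral (lebesgue_on {s..t}) (\<lambda>\<tau>. (\<lambda>w. \<Phi> (t, \<tau>) *v w) ` filippov_reg g' \<tau> (x \<tau>)))"
    using x' by blast
  then show "AE t in lebesgue. t \<in> {s..b} \<longrightarrow> (\<forall>\<tau>\<in>{s..t}. norm (x \<tau>) < r) \<longrightarrow>
      (\<exists>v. (x has_vector_derivative v) (at t within {s..b}) \<and> v \<in> approx_rhs \<Phi> f g \<eta> s x t)"
    using incf
  proof eventually_elim
    case (elim t)
    show ?case
    proof (intro impI)
      assume t: "t \<in> {s..b}" and xt: "\<forall>\<tau>\<in>{s..t}. norm (x \<tau>) < r"
      then obtain v where v: "(x has_vector_derivative v) (at t within {s..b})"
        "v \<in> filippov_reg f' t (x t) +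
          aumann_integral (lebesgue_on {s..t}) (\<lambda>\<tau>. (\<lambda>w. \<Phi> (t, \<tau>) *v w) ` filippov_reg g' \<tau> (x \<tau>))"
        using elim(1) by blast
      from v(2) obtain \<alpha> \<beta> where ab: "v = \<alpha> + \<beta>" "\<alpha> \<in> filippov_reg f' t (x t)"
        "\<beta> \<in> aumann_integral (lebesgue_on {s..t}) (\<lambda>\<tau>. (\<lambda>w. \<Phi> (t, \<tau>) *v w) ` filippov_reg g' \<tau> (x \<tau>))"
        by (rule set_plus_elim)
      have tb: "t \<in> {t0..b}" "norm (x t) < r" using t xt s by auto
      then have "\<alpha> \<in> ess_near f t (x t) (\<eta> t)" using elim(2) ab(2) by blast
      moreover have "\<beta> \<in> aumann_integral (lebesgue_on {s..t})
          (\<lambda>\<tau>. (\<lambda>w. \<Phi> (t, \<tau>) *v w) ` ess_near g \<tau> (x \<tau>) (\<eta> \<tau>))"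
      proof (rule aumann_integral_mono[OF ab(3)])
        show "AE \<tau> in lebesgue_on {s..t}. (\<lambda>w. \<Phi> (t, \<tau>) *v w) ` filippov_reg g' \<tau> (x \<tau>)
            \<subseteq> (\<lambda>w. \<Phi> (t, \<tau>) *v w) ` ess_near g \<tau> (x \<tau>) (\<eta> \<tau>)"
          unfolding AE_lebesgue_on_iff[OF m] using incg
        proof eventually_elim
          case (elim \<tau>)
          show ?case
          proof
            assume "\<tau> \<in> {s..t}"
            then have "\<tau> \<in> {t0..b}" "norm (x \<tau>) < r" using s t xt by auto
            then show "(\<lambda>w. \<Phi> (t, \<tau>) *v w) ` filippov_reg g' \<tau> (x \<tau>)
              \<subseteq> (\<lambda>w. \<Phi> (t, \<tau>) *v w) ` ess_near g \<tau> (x \<tau>) (\<eta> \<tau>)"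
              using elim by (intro image_mono) blast
          qed
        qed
      qed
      ultimately show "\<exists>v. (x has_vector_derivative v) (at t within {s..b}) \<and> v \<in> approx_rhs \<Phi> f g \<eta> s x t"
        using v(1) unfolding approx_rhs_def ab(1) by (intro exI[of _ "\<alpha> + \<beta>"] conjI set_plus_intro)
    qed
  qed
qed

lemma filippov_solution_approx_deriv:
  assumes "filippov_solution \<Phi> f g t0 x0 {t0..b} x"
  shows "approx_deriv (\<lambda>_. 0) t0 x"
  by (rule filippov_solution_imp_approx_deriv[OF assms order_refl])
    (simp_all add: filippov_reg_eq_ess_near)

text \<open>A uniform step length over which no approximate solution in the ball moves by 1 or
  more.\<close>

lemma h_integral_small:
  obtains d where "0 < d" "\<And>p q. t0 \<le> p \<Longrightarrow> p \<le> q \<Longrightarrow> q \<le> b \<Longrightarrow> q - p < d \<Longrightarrow> integral {p..q} h < 1"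
proof -
  define H where "H t = integral {t0..t} h" for t
  have "continuous_on {t0..b} H"
    unfolding H_def
    by (rule indefinite_integral_continuous_1[OF set_lebesgue_integral_eq_integral(1)[OF h_int]])
  then have "uniformly_continuous_on {t0..b} H" by (rule compact_uniformly_continuous) simp
  then obtain d where d: "d > 0"
    "\<And>p q. p \<in> {t0..b} \<Longrightarrow> q \<in> {t0..b} \<Longrightarrow> dist q p < d \<Longrightarrow> dist (H q) (H p) < 1"
    unfolding uniformly_continuous_on_def by (meson zero_less_one)
  show thesis
  proof
    fix p q assume pq: "t0 \<le> p" "p \<le> q" "q \<le> b" "q - p < d"
    have "integral {p..q} h = H q - H p"
      unfolding H_def using indefinite_integral_diff[OF h_int pq(1-3)] by simp
    with d(2)[of p q] pq show "integral {p..q} h < 1" by (simp add: dist_real_def)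
  qed (rule d(1))
qed

text \<open>Induction over short time steps, passing to a subsequence in each. The a priori estimate
  alone would lose 1 per step. Instead, the loss is undone by compactness: the limit on the interval
  reached so far extends to b, hence is bounded by R, so a further subsequence is again below R +
  1.\<close>

theorem approx_deriv_converge:
  assumes tb: "t0 < b" and ext: "all_filippov_solutions_exist_until \<Phi> f g t0 x0 b"
    and R: "norm x0 \<le> R" "\<And>y t. filippov_solution \<Phi> f g t0 x0 {t0..b} y \<Longrightarrow> t \<in> {t0..b} \<Longrightarrow> norm (y t) \<le> R"
      "R + 2 < r"
    and s: "\<And>k. s k \<in> {t0..b}" "s \<longlonglongrightarrow> t0"
    and \<eta>: "\<And>k \<tau>. 0 \<le> \<eta> k \<tau>" "\<And>k \<tau>. \<eta> k \<tau> \<le> c"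
      "AE \<tau> in lebesgue. \<tau> \<in> {t0..b} \<longrightarrow> (\<lambda>k. \<eta> k \<tau>) \<longlonglongrightarrow> 0"
    and x: "\<And>k. approx_deriv (\<eta> k) (s k) (x k)"
    and x0: "(\<lambda>k. x k (s k)) \<longlonglongrightarrow> x0"
  obtains \<sigma> y where "strict_mono (\<sigma> :: nat \<Rightarrow> nat)" "filippov_solution \<Phi> f g t0 x0 {t0..b} y"
    "\<And>\<epsilon>. 0 < \<epsilon> \<Longrightarrow> \<exists>N. \<forall>n\<ge>N. \<forall>t\<in>{t0..b}. norm (x (\<sigma> n) (max t (s (\<sigma> n))) - y t) < \<epsilon>"
proof -
  have compact: "\<exists>\<sigma> y. strict_mono (\<sigma> :: nat \<Rightarrow> nat) \<and> filippov_solution \<Phi> f g t0 x0 {t0..e} y \<and>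
    (\<forall>\<epsilon>>0. \<exists>N. \<forall>n\<ge>N. \<forall>t\<in>{t0..e}. norm (x (\<kappa> (\<sigma> n)) (max t (s (\<kappa> (\<sigma> n)))) - y t) < \<epsilon>)"
    if e: "t0 < e" "e \<le> b" and \<kappa>: "strict_mono (\<kappa> :: nat \<Rightarrow> nat)" and se: "\<And>k. s (\<kappa> k) \<le> e"
      and xr: "\<And>k \<tau>. \<tau> \<in> {s (\<kappa> k)..e} \<Longrightarrow> norm (x (\<kappa> k) \<tau>) < r" for e \<kappa>
  proof -
    have 1: "s (\<kappa> k) \<in> {t0..e}" for k using se[of k] s(1)[of "\<kappa> k"] by auto
    have 2: "(\<lambda>k. s (\<kappa> k)) \<longlonglongrightarrow> t0"
      using LIMSEQ_subseq_LIMSEQ[OF s(2) \<kappa>] by (simp add: o_def)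
    have 3: "AE \<tau> in lebesgue. \<tau> \<in> {t0..b} \<longrightarrow> (\<lambda>k. \<eta> (\<kappa> k) \<tau>) \<longlonglongrightarrow> 0"
      using \<eta>(3) by eventually_elim (use LIMSEQ_subseq_LIMSEQ[OF _ \<kappa>] in \<open>auto simp: o_def\<close>)
    have 4: "(\<lambda>k. x (\<kappa> k) (s (\<kappa> k))) \<longlonglongrightarrow> x0"
      using LIMSEQ_subseq_LIMSEQ[OF x0 \<kappa>] by (simp add: o_def)
    show ?thesis
      by (rule approx_deriv_compact[where s = "\<lambda>k. s (\<kappa> k)" and \<eta> = "\<lambda>k. \<eta> (\<kappa> k)" and x = "\<lambda>k. x (\<kappa> k)",
            OF e 1 2 \<eta>(1) \<eta>(2) 3 x xr 4]) blast+
  qed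
  obtain d where d: "0 < d" "\<And>p q. t0 \<le> p \<Longrightarrow> p \<le> q \<Longrightarrow> q \<le> b \<Longrightarrow> q - p < d \<Longrightarrow> integral {p..q} h < 1"
    by (rule h_integral_small) (rule that)
  obtain n :: nat where n: "(b - t0) / d < real n" using reals_Archimedean2 by blast
  then have "0 < real n" using tb d(1) by (smt (verit) divide_pos_pos)
  define w where "w = (b - t0) / real n"
  have w: "0 < w" "w < d" "real n * w = b - t0"
    using tb d(1) n \<open>0 < real n\<close> unfolding w_def by (auto simp: field_simps)
  define p where "p i = t0 + real i * w" for i
  have p: "p 0 = t0" "p (Suc i) = p i + w" "t0 \<le> p i" for i
    unfolding p_def using w by (auto simp: algebra_simps)
  have pb: "p i \<le> b" if "i \<le> n" for i
  proof -
    have "real i * w \<le> real n * w" using that w by (intro mult_right_mono) auto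
    then show ?thesis unfolding p_def using w(3) by simp
  qed
  have pn: "p n = b" unfolding p_def using w(3) by simp
  \<comment> \<open>From K on every starting time lies in the first step, so each later grid point
    comes after all starts.\<close>
  have "\<forall>\<^sub>F k in sequentially. s k < t0 + w \<and> norm (x k (s k)) < R + 1"
  proof (rule eventually_conj)
    show "\<forall>\<^sub>F k in sequentially. s k < t0 + w" using order_tendstoD(2)[OF s(2)] w(1) by simp
    show "\<forall>\<^sub>F k in sequentially. norm (x k (s k)) < R + 1"
      using order_tendstoD(2)[OF tendsto_norm[OF x0]] R(1) by simp
  qed
  then obtain K where K: "\<And>k. k \<ge> K \<Longrightarrow> s k < t0 + w" "\<And>k. k \<ge> K \<Longrightarrow> norm (x k (s k)) < R + 1"
    unfolding eventually_sequentially by blast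
  have step: "\<exists>\<kappa> :: nat \<Rightarrow> nat. strict_mono \<kappa> \<and> (\<forall>k. K \<le> \<kappa> k \<and> (\<forall>\<tau>\<in>{s (\<kappa> k)..p i}. norm (x (\<kappa> k) \<tau>) < R + 1))"
    if "i \<le> n" for i
    using that
  proof (induction i)
    case 0
    have "norm (x (k + K) \<tau>) < R + 1" if "\<tau> \<in> {s (k + K)..p 0}" for k \<tau>
    proof -
      \<comment> \<open>As no start precedes t0, the interval is empty or a single point.\<close>
      have "\<tau> = s (k + K)" using that s(1)[of "k + K"] p(1) by auto
      then show ?thesis using K(2)[of "k + K"] by simp
    qed
    then show ?case by (intro exI[of _ "\<lambda>k. k + K"]) (auto simp: strict_mono_def)
  next
    case (Suc i)
    from Suc.IH[OF Suc_leD[OF Suc.prems]]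
    obtain \<kappa> :: "nat \<Rightarrow> nat" where \<kappa>: "strict_mono \<kappa>" "\<And>k. K \<le> \<kappa> k"
      "\<And>k \<tau>. \<tau> \<in> {s (\<kappa> k)..p i} \<Longrightarrow> norm (x (\<kappa> k) \<tau>) < R + 1" by blast
    define e where "e = p (Suc i)"
    have e: "t0 < e" "e \<le> b" "e = p i + w"
      using Suc.prems pb[of "Suc i"] p(2,3)[of i] w(1) unfolding e_def by auto
    have se: "s (\<kappa> k) \<le> e" for k using K(1)[OF \<kappa>(2)[of k]] p(3)[of i] e(3) by simp
    have xr: "norm (x (\<kappa> k) \<tau>) < R + 1 + 1" if \<tau>: "\<tau> \<in> {s (\<kappa> k)..e}" for k \<tau>
    proof (rule approx_deriv_a_priori[OF x _ _ _ e(2) _ _ _ \<eta>(1) \<eta>(2) \<tau>])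
      \<comment> \<open>In the first step the grid point t0 may precede the start, and the estimate
        then begins at the start instead.\<close>
      let ?u = "max (p i) (s (\<kappa> k))"
      show "t0 \<le> s (\<kappa> k)" using s(1)[of "\<kappa> k"] by auto
      show "s (\<kappa> k) \<le> ?u" "?u \<le> e" using se[of k] e(3) w(1) by auto
      show "norm (x (\<kappa> k) u) < R + 1" if "u \<in> {s (\<kappa> k)..?u}" for u
      proof (cases "u \<le> p i")
        case True
        then show ?thesis using \<kappa>(3)[of u k] that by simp
      next
        case False
        then have "u = s (\<kappa> k)" using that by auto
        then show ?thesis using K(2)[OF \<kappa>(2)[of k]] by simp
      qed
      show "integral {?u..e} h < 1"
        using p(3)[of i] \<open>?u \<le> e\<close> e w by (intro d(2)) auto
      show "R + 1 + 1 < r" using R(3) by simp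
    qed
    have xr': "norm (x (\<kappa> k) \<tau>) < r" if "\<tau> \<in> {s (\<kappa> k)..e}" for k \<tau>
      using xr[OF that] R(3) by simp
    obtain \<sigma> y where y: "strict_mono (\<sigma> :: nat \<Rightarrow> nat)" "filippov_solution \<Phi> f g t0 x0 {t0..e} y"
      "\<forall>\<epsilon>>0. \<exists>N. \<forall>n\<ge>N. \<forall>t\<in>{t0..e}. norm (x (\<kappa> (\<sigma> n)) (max t (s (\<kappa> (\<sigma> n)))) - y t) < \<epsilon>"
      using compact[OF e(1,2) \<kappa>(1) se xr'] by blast
    \<comment> \<open>The continuation hypothesis excludes the degenerate interval, hence the need
      for e to exceed t0.\<close>
    have "{t0..e} \<noteq> {t0}" "{t0..e} \<subseteq> {t0..b}" using e by auto
    then obtain y' where y': "filippov_solution \<Phi> f g t0 x0 {t0..b} y'" "\<And>t. t \<in> {t0..e} \<Longrightarrow> y' t = y t"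
      using ext y(2) unfolding all_filippov_solutions_exist_until_def by blast
    from y(3)[THEN spec, THEN mp, OF zero_less_one]
    obtain N where N: "\<And>n t. n \<ge> N \<Longrightarrow> t \<in> {t0..e} \<Longrightarrow> norm (x (\<kappa> (\<sigma> n)) (max t (s (\<kappa> (\<sigma> n)))) - y t) < 1"
      by blast
    have "norm (x (\<kappa> (\<sigma> (k + N))) \<tau>) < R + 1" if \<tau>: "\<tau> \<in> {s (\<kappa> (\<sigma> (k + N)))..e}" for k \<tau>
    proof -
      have \<tau>': "\<tau> \<in> {t0..e}" using \<tau> s(1)[of "\<kappa> (\<sigma> (k + N))"] by auto
      then have "norm (y \<tau>) \<le> R" using R(2)[OF y'(1), of \<tau>] y'(2)[of \<tau>] e(2) by auto
      moreover have "norm (x (\<kappa> (\<sigma> (k + N))) \<tau> - y \<tau>) < 1"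
        using N[OF _ \<tau>', of "k + N"] \<tau> by (simp add: max_absorb1)
      ultimately show ?thesis
        using norm_triangle_sub[of "x (\<kappa> (\<sigma> (k + N))) \<tau>" "y \<tau>"] by linarith
    qed
    moreover have "strict_mono (\<lambda>k. \<kappa> (\<sigma> (k + N)))"
      using \<kappa>(1) y(1) unfolding strict_mono_def by simp
    ultimately show ?case
      using \<kappa>(2) unfolding e_def by (intro exI[of _ "\<lambda>k. \<kappa> (\<sigma> (k + N))"]) auto
  qed
  obtain \<kappa> :: "nat \<Rightarrow> nat" where \<kappa>: "strict_mono \<kappa>" "\<And>k \<tau>. \<tau> \<in> {s (\<kappa> k)..b} \<Longrightarrow> norm (x (\<kappa> k) \<tau>) < R + 1"
    using step[OF order_refl] unfolding pn by blast
  have sb: "s (\<kappa> k) \<le> b" for k using s(1)[of "\<kappa> k"] by auto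
  have xr: "norm (x (\<kappa> k) \<tau>) < r" if "\<tau> \<in> {s (\<kappa> k)..b}" for k \<tau>
    using \<kappa>(2)[OF that] R(3) by simp
  obtain \<sigma> y where y: "strict_mono (\<sigma> :: nat \<Rightarrow> nat)" "filippov_solution \<Phi> f g t0 x0 {t0..b} y"
    "\<forall>\<epsilon>>0. \<exists>N. \<forall>n\<ge>N. \<forall>t\<in>{t0..b}. norm (x (\<kappa> (\<sigma> n)) (max t (s (\<kappa> (\<sigma> n)))) - y t) < \<epsilon>"
    using compact[OF tb order_refl \<kappa>(1) sb xr] by blast
  show thesis
  proof (rule that[of "\<lambda>n. \<kappa> (\<sigma> n)" y])
    show "strict_mono (\<lambda>n. \<kappa> (\<sigma> n))" using \<kappa>(1) y(1) unfolding strict_mono_def by simp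
  qed (use y(2,3) in blast)+
qed

end

section \<open>Stability of Filippov solutions\<close>

text \<open>That every solution reaches b does not by itself bound the family. The continuation
  hypothesis is applied to a limit known only on a half-open interval; its continuation through
  \<sigma> is continuous, thus bounded, and nearby solutions inherit this slightly beyond
  \<sigma>.\<close>

theorem filippov_solutions_bounded:
  fixes \<Phi> :: "real \<times> real \<Rightarrow> real^'n^'n" and f g :: "real \<times> (real^'n) \<Rightarrow> real^'n"
  assumes \<Phi>: "locally_ess_bounded_on Delta \<Phi>" and f: "filippov_condition f" and g: "filippov_condition g"
    and tb: "t0 < b" and ext: "all_filippov_solutions_exist_until \<Phi> f g t0 x0 b"
  obtains R where "\<And>y t. filippov_solution \<Phi> f g t0 x0 {t0..b} y \<Longrightarrow> t \<in> {t0..b} \<Longrightarrow> norm (y t) \<le> R"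
proof -
  let ?sol = "filippov_solution \<Phi> f g t0 x0 {t0..b}"
  define bounded_until where "bounded_until s \<longleftrightarrow> s \<in> {t0..b} \<and> (\<exists>R. \<forall>y. ?sol y \<longrightarrow> (\<forall>t\<in>{t0..s}. norm (y t) \<le> R))" for s
  have init: "y t0 = x0" if "?sol y" for y
    using that unfolding filippov_solution_def by blast
  have mono: "bounded_until s'" if s: "bounded_until s" "t0 \<le> s'" "s' \<le> s" for s s'
  proof -
    obtain R where R: "\<forall>y. ?sol y \<longrightarrow> (\<forall>t\<in>{t0..s}. norm (y t) \<le> R)"
      using s(1) unfolding bounded_until_def by blast
    have "{t0..s'} \<subseteq> {t0..s}" "s' \<in> {t0..b}"
      using s unfolding bounded_until_def by auto
    with R show ?thesis unfolding bounded_until_def by blast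
  qed
  have at_t0: "bounded_until t0"
    using tb init unfolding bounded_until_def by (auto intro!: exI[of _ "norm x0"])
  define \<sigma> where "\<sigma> = Sup (Collect bounded_until)"
  have bdd: "bdd_above (Collect bounded_until)"
    by (rule bdd_aboveI[of _ b]) (auto simp: bounded_until_def)
  have le\<sigma>: "s \<le> \<sigma>" if "bounded_until s" for s
    unfolding \<sigma>_def using that bdd by (intro cSup_upper) auto
  have \<sigma>b: "t0 \<le> \<sigma>" "\<sigma> \<le> b"
  proof -
    have "Collect bounded_until \<noteq> {}" using at_t0 by blast
    then show "\<sigma> \<le> b"
      unfolding \<sigma>_def by (rule cSup_least) (simp add: bounded_until_def)
  qed (rule le\<sigma>[OF at_t0])
  have below: "bounded_until s" if s: "t0 \<le> s" "s < \<sigma>" for s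
  proof -
    have "\<exists>s'\<in>Collect bounded_until. s < s'"
      using less_cSupD[of "Collect bounded_until" s] s(2) at_t0 unfolding \<sigma>_def by blast
    then obtain s' where "bounded_until s'" "s < s'" by blast
    then show ?thesis using mono[of s' s] s(1) by simp
  qed
  have bounds: "\<exists>C hf hg. filippov_bounds \<Phi> f g t0 b r 0 C hf hg" if "0 < r" for r
    using filippov_bounds_exist[OF \<Phi> f g that order_refl] by blast
  have "\<sigma> \<noteq> t0"
  proof
    assume "\<sigma> = t0"
    \<comment> \<open>All solutions share the value x0, so the a priori estimate applies with \<rho>
      = |x0| + 1, and \<rho> + 1 must be below the radius.\<close>
    obtain C hf hg where "filippov_bounds \<Phi> f g t0 b (norm x0 + 3) 0 C hf hg"
      using bounds[of "norm x0 + 3"] by (auto simp: add_nonneg_pos)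
    then interpret filippov_bounds \<Phi> f g t0 b "norm x0 + 3" 0 C hf hg .
    obtain d where d: "0 < d" "\<And>p q. t0 \<le> p \<Longrightarrow> p \<le> q \<Longrightarrow> q \<le> b \<Longrightarrow> q - p < d \<Longrightarrow> integral {p..q} h < 1"
      by (rule h_integral_small) (rule that)
    define u where "u = min b (t0 + d / 2)"
    have u: "t0 < u" "u \<le> b" "u - t0 < d" using tb d(1) unfolding u_def by auto
    have "norm (y t) < norm x0 + 1 + 1" if y: "?sol y" and t: "t \<in> {t0..u}" for y t
      by (rule approx_deriv_a_priori[OF filippov_solution_approx_deriv[OF y] order_refl order_refl _ u(2) _ _ _ _ _ t])
        (use u init[OF y] d(2) in auto)
    then have "\<forall>y. ?sol y \<longrightarrow> (\<forall>t\<in>{t0..u}. norm (y t) \<le> norm x0 + 1 + 1)"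
      by (blast intro: less_imp_le)
    moreover have "u \<in> {t0..b}" using u by simp
    ultimately have "bounded_until u" unfolding bounded_until_def by blast
    with le\<sigma>[of u] u \<open>\<sigma> = t0\<close> show False by simp
  qed
  with \<sigma>b have \<sigma>: "t0 < \<sigma>" "\<sigma> \<le> b" by auto
  have "bounded_until b"
  proof (rule ccontr)
    assume nb: "\<not> bounded_until b"
    \<comment> \<open>Times just beyond \<sigma>, capped at b: no uniform bound exists up to them,
      so some solution exceeds k by then.\<close>
    define u where "u k = min b (\<sigma> + 1 / real (Suc k))" for k
    have "\<not> bounded_until (u k)" for k
    proof
      assume "bounded_until (u k)"
      with le\<sigma> have "u k \<le> \<sigma>" by blast
      then have "u k = b" unfolding u_def by (auto simp: min_def split: if_splits)
      with \<open>bounded_until (u k)\<close> nb show False by simp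
    qed
    moreover have "u k \<in> {t0..b}" for k
    proof -
      have "0 < 1 / real (Suc k)" by simp
      with tb \<sigma> have "t0 \<le> u k" unfolding u_def by linarith
      then show ?thesis unfolding u_def by simp
    qed
    ultimately have "\<exists>y. ?sol y \<and> (\<exists>t\<in>{t0..u k}. real k < norm (y t))" for k
      unfolding bounded_until_def by (meson not_le)
    then have "\<exists>y. \<forall>k. ?sol (y k) \<and> (\<exists>t\<in>{t0..u k}. real k < norm (y k t))"
      by (intro choice allI)
    then obtain y where y: "\<And>k. ?sol (y k)" "\<And>k. \<exists>t\<in>{t0..u k}. real k < norm (y k t)"
      by blast
    \<comment> \<open>Times approaching \<sigma> from below; the shift by 2 keeps even the first one
      strictly after t0.\<close>
    define e where "e i = \<sigma> - (\<sigma> - t0) / real (i + 2)" for i :: nat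
    have e: "t0 < e i" "e i < \<sigma>" for i
    proof -
      have "(\<sigma> - t0) / real (i + 2) < (\<sigma> - t0) / 1"
        using \<sigma>(1) by (intro divide_strict_left_mono) auto
      then show "t0 < e i" unfolding e_def by simp
      show "e i < \<sigma>" using \<sigma>(1) unfolding e_def by simp
    qed
    have ex_e: "\<exists>i. t < e i" if "t < \<sigma>" for t
    proof -
      obtain i :: nat where "(\<sigma> - t0) / (\<sigma> - t) < real i" using reals_Archimedean2 by blast
      then have "(\<sigma> - t0) < real (i + 2) * (\<sigma> - t)" using that \<sigma>(1) by (simp add: field_simps)
      then have "(\<sigma> - t0) / real (i + 2) < \<sigma> - t" by (simp add: divide_less_eq mult.commute)
      then show ?thesis unfolding e_def by (intro exI[of _ i]) simp
    qed
    \<comment> \<open>Uniform convergence to some solution up to \<open>e i\<close>. It survives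
      passage to subsequences and a change of finitely many terms, as diagonalization
      requires.\<close>
    define P where "P i q \<longleftrightarrow> (\<exists>z. filippov_solution \<Phi> f g t0 x0 {t0..e i} z \<and>
      (\<forall>\<epsilon>>0. \<exists>N. \<forall>n\<ge>N. \<forall>t\<in>{t0..e i}. norm (y (q n) t - z t) < \<epsilon>))" for i and q :: "nat \<Rightarrow> nat"
    obtain \<kappa> :: "nat \<Rightarrow> nat" where \<kappa>: "strict_mono \<kappa>" "\<And>i. P i (id \<circ> \<kappa>)"
    proof (rule subsequence_diagonalization_lemma[where P = P and r = id])
      show "\<exists>\<kappa>. strict_mono (\<kappa> :: nat \<Rightarrow> nat) \<and> P i (q \<circ> \<kappa>)" for i q
      proof -
        obtain R where R: "\<And>z t. ?sol z \<Longrightarrow> t \<in> {t0..e i} \<Longrightarrow> norm (z t) \<le> R"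
          using below[OF less_imp_le[OF e(1)] e(2), of i] unfolding bounded_until_def by blast
        \<comment> \<open>The bound up to \<open>e i\<close> may deteriorate as \<open>e i\<close>
          approaches \<sigma>, so each i gets its own radius and its own dominating
          function.\<close>
        define r where "r = \<bar>R\<bar> + 1"
        have "0 < r" unfolding r_def by simp
        then obtain C hf hg where "filippov_bounds \<Phi> f g t0 b r 0 C hf hg" using bounds by blast
        then interpret filippov_bounds \<Phi> f g t0 b r 0 C hf hg .
        have yr: "norm (y k t) < r" if "t \<in> {t0..e i}" for k t
          using R[OF y(1) that, of k] unfolding r_def by simp
        have ei: "t0 < e i" "e i \<le> b" using e[of i] \<sigma> by auto
        obtain \<kappa> z where "strict_mono (\<kappa> :: nat \<Rightarrow> nat)" "filippov_solution \<Phi> f g t0 x0 {t0..e i} z"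
          "\<And>\<epsilon>. 0 < \<epsilon> \<Longrightarrow> \<exists>N. \<forall>n\<ge>N. \<forall>t\<in>{t0..e i}. norm (y (q (\<kappa> n)) (max t t0) - z t) < \<epsilon>"
          by (rule approx_deriv_compact[OF ei, where s = "\<lambda>_. t0" and \<eta> = "\<lambda>_ _. 0" and x = "\<lambda>k. y (q k)" and ?x0.0 = x0])
            (use ei yr filippov_solution_approx_deriv[OF y(1)] init[OF y(1)] in auto)
        then show ?thesis
          unfolding P_def by (intro exI[of _ \<kappa>] conjI exI[of _ z]) (auto simp: max_absorb1)
      qed
      show "P i (q \<circ> k2)" if "P i (q \<circ> k1)" "\<And>j. N \<le> j \<Longrightarrow> \<exists>j'. j \<le> j' \<and> k2 j = k1 j'" for i q k1 k2 N
      proof -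
        obtain z where z: "filippov_solution \<Phi> f g t0 x0 {t0..e i} z"
          "\<And>\<epsilon>. 0 < \<epsilon> \<Longrightarrow> \<exists>N. \<forall>n\<ge>N. \<forall>t\<in>{t0..e i}. norm (y (q (k1 n)) t - z t) < \<epsilon>"
          using \<open>P i (q \<circ> k1)\<close> unfolding P_def by auto
        have "\<exists>N'. \<forall>n\<ge>N'. \<forall>t\<in>{t0..e i}. norm (y (q (k2 n)) t - z t) < \<epsilon>" if "0 < \<epsilon>" for \<epsilon>
        proof -
          obtain N1 where N1: "\<And>n. n \<ge> N1 \<Longrightarrow> \<forall>t\<in>{t0..e i}. norm (y (q (k1 n)) t - z t) < \<epsilon>"
            using z(2)[OF \<open>0 < \<epsilon>\<close>] by blast
          have "\<forall>t\<in>{t0..e i}. norm (y (q (k2 n)) t - z t) < \<epsilon>" if n: "n \<ge> max N N1" for n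
          proof -
            obtain j' where "n \<le> j'" "k2 n = k1 j'" using \<open>\<And>j. N \<le> j \<Longrightarrow> \<exists>j'. j \<le> j' \<and> k2 j = k1 j'\<close>[of n] n by auto
            then show ?thesis using N1[of j'] n by simp
          qed
          then show ?thesis by blast
        qed
        then show ?thesis using z(1) unfolding P_def by auto
      qed
    qed (rule that)
    have "\<exists>z. filippov_solution \<Phi> f g t0 x0 {t0..e i} z \<and>
      (\<forall>\<epsilon>>0. \<exists>N. \<forall>n\<ge>N. \<forall>t\<in>{t0..e i}. norm (y (\<kappa> n) t - z t) < \<epsilon>)" for i
      using \<kappa>(2)[of i] unfolding P_def by simp
    then have "\<exists>z. \<forall>i. filippov_solution \<Phi> f g t0 x0 {t0..e i} (z i) \<and>
      (\<forall>\<epsilon>>0. \<exists>N. \<forall>n\<ge>N. \<forall>t\<in>{t0..e i}. norm (y (\<kappa> n) t - z i t) < \<epsilon>)"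
      by (intro choice allI)
    then obtain z where z: "\<And>i. filippov_solution \<Phi> f g t0 x0 {t0..e i} (z i)"
      "\<And>i \<epsilon>. 0 < \<epsilon> \<Longrightarrow> \<exists>N. \<forall>n\<ge>N. \<forall>t\<in>{t0..e i}. norm (y (\<kappa> n) t - z i t) < \<epsilon>" by blast
    define z0 where "z0 t = lim (\<lambda>n. y (\<kappa> n) t)" for t
    have z0: "z0 t = z i t" if "t \<in> {t0..e i}" for i t
    proof -
      have "(\<lambda>n. y (\<kappa> n) t) \<longlonglongrightarrow> z i t"
        unfolding LIMSEQ_iff using z(2)[of _ i] that by blast
      then show ?thesis unfolding z0_def by (rule limI)
    qed
    have "filippov_solution \<Phi> f g t0 x0 {t0..<\<sigma>} z0"
      by (rule filippov_solution_exhaust[OF \<sigma>(1) ex_e e(2)]) (auto intro: filippov_solution_cong[OF z(1)] z0)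
    moreover have "{t0..<\<sigma>} \<noteq> {t0}" "{t0..<\<sigma>} \<subseteq> {t0..b}"
    proof -
      have "(t0 + \<sigma>) / 2 \<in> {t0..<\<sigma>}" "(t0 + \<sigma>) / 2 \<noteq> t0" using \<sigma>(1) by auto
      then show "{t0..<\<sigma>} \<noteq> {t0}" by blast
    qed (use \<sigma> in auto)
    ultimately obtain w where w: "?sol w" "\<And>t. t \<in> {t0..<\<sigma>} \<Longrightarrow> w t = z0 t"
      using ext unfolding all_filippov_solutions_exist_until_def by blast
    have "continuous_on {t0..b} w"
      using w(1) unfolding filippov_solution_def by (blast intro: abs_continuous_on_imp_continuous_on)
    then have "bounded (w ` {t0..b})" by (intro compact_imp_bounded compact_continuous_image) auto
    then obtain R where R: "0 < R" "\<And>t. t \<in> {t0..b} \<Longrightarrow> norm (w t) \<le> R"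
      unfolding bounded_pos by auto
    have "0 < R + 3" using R(1) by simp
    then obtain C hf hg where "filippov_bounds \<Phi> f g t0 b (R + 3) 0 C hf hg" using bounds by blast
    then interpret filippov_bounds \<Phi> f g t0 b "R + 3" 0 C hf hg .
    obtain d where d: "0 < d" "\<And>p q. t0 \<le> p \<Longrightarrow> p \<le> q \<Longrightarrow> q \<le> b \<Longrightarrow> q - p < d \<Longrightarrow> integral {p..q} h < 1"
      by (rule h_integral_small) (rule that)
    \<comment> \<open>The estimate restarts less than d/2 before \<sigma> and ends at most d/2 after
      it, an interval shorter than d.\<close>
    obtain i where i: "\<sigma> - d / 2 < e i" using ex_e[of "\<sigma> - d / 2"] d(1) by auto
    define u' where "u' = min b (\<sigma> + d / 2)"
    have u': "e i \<le> u'" "u' \<le> b" "u' - e i < d" using e(2)[of i] \<sigma> d(1) i unfolding u'_def by auto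
    obtain N where N: "\<And>n t. n \<ge> N \<Longrightarrow> t \<in> {t0..e i} \<Longrightarrow> norm (y (\<kappa> n) t - z i t) < 1"
      using z(2)[OF zero_less_one, of i] by blast
    have near: "norm (y (\<kappa> n) t) < R + 1" if n: "n \<ge> N" and t: "t \<in> {t0..e i}" for n t
    proof -
      have "t \<in> {t0..<\<sigma>}" "t \<in> {t0..b}" using t e(2)[of i] \<sigma> by auto
      then have "norm (z i t) \<le> R" using R(2)[of t] w(2)[of t] z0[OF t] by simp
      with N[OF n t] norm_triangle_sub[of "y (\<kappa> n) t" "z i t"] show ?thesis by linarith
    qed
    have bound: "norm (y (\<kappa> n) t) < R + 1 + 1" if n: "n \<ge> N" and t: "t \<in> {t0..u'}" for n t
    proof (rule approx_deriv_a_priori[OF filippov_solution_approx_deriv[OF y(1)] order_refl _ u'(1,2) _ _ _ _ _ t])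
      show "t0 \<le> e i" using e(1)[of i] by simp
      then show "integral {e i..u'} h < 1" using u' by (intro d(2)) auto
    qed (use near[OF n] in auto)
    \<comment> \<open>Two requirements in one: the index must exceed the bound R + 2, and
      \<open>u\<close> at that index must already lie below u', that is, within d/2 of
      \<sigma>.\<close>
    obtain K :: nat where K: "R + 2 + 2 / d < real K" using reals_Archimedean2 by blast
    define n where "n = max N K"
    have "n \<le> \<kappa> n" using strict_mono_imp_increasing[OF \<kappa>(1)] by blast
    then have \<kappa>n: "R + 2 + 2 / d < real (\<kappa> n)" using K unfolding n_def by simp
    have "2 / d < real (Suc (\<kappa> n))" using \<kappa>n R(1) by simp
    then have "1 / real (Suc (\<kappa> n)) < d / 2" using d(1) by (simp add: field_simps)
    then have "u (\<kappa> n) \<le> u'" unfolding u_def u'_def by auto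
    then have "{t0..u (\<kappa> n)} \<subseteq> {t0..u'}" by simp
    with y(2)[of "\<kappa> n"] obtain t where t: "t \<in> {t0..u'}" "real (\<kappa> n) < norm (y (\<kappa> n) t)"
      by blast
    have "norm (y (\<kappa> n) t) < R + 1 + 1" by (rule bound[OF _ t(1)]) (simp add: n_def)
    moreover have "0 < 2 / d" using d(1) by simp
    ultimately show False using t(2) \<kappa>n by linarith
  qed
  then show thesis using that unfolding bounded_until_def by blast
qed

text \<open>The form in which positive measure is used: a close point outside any prescribed null
  set, as \<open>filippov_reg_subset_ess_near\<close> asks.\<close>

lemma closeness_set_avoids_null_sets:
  assumes "emeasure lebesgue (closeness_set f\<mu> g\<mu> f g m t x) > 0" "M \<in> null_sets lebesgue"
  shows "\<exists>z. z \<notin> M \<and> z \<in> closeness_set f\<mu> g\<mu> f g m t x"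
proof (rule ccontr)
  assume "\<nexists>z. z \<notin> M \<and> z \<in> closeness_set f\<mu> g\<mu> f g m t x"
  then have "closeness_set f\<mu> g\<mu> f g m t x \<subseteq> M" by blast
  then have "emeasure lebesgue (closeness_set f\<mu> g\<mu> f g m t x) = 0"
    using assms(2) by (metis emeasure_mono null_setsD1 null_setsD2 le_zero_eq)
  with assms(1) show False by simp
qed

theorem theorem15:
  fixes \<Phi> :: "real \<times> real \<Rightarrow> real^'n^'n"
    and f g :: "real \<times> (real^'n) \<Rightarrow> real^'n"
    and fp gp :: "'m::complete_space \<Rightarrow> real \<times> (real^'n) \<Rightarrow> real^'n"
    and P :: "'m set" and \<mu>0 :: 'm
    and m :: "real \<Rightarrow> real \<Rightarrow> 'm \<Rightarrow> real \<Rightarrow> real"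
    and t0 T :: real and x0 :: "real^'n"
  assumes "\<Phi> \<in> borel_measurable (lebesgue_on Delta)"
    and "locally_ess_bounded_on Delta \<Phi>"
    and "filippov_condition f" and "filippov_condition g"
    and "open P" and "\<mu>0 \<in> P"
    and "\<And>\<mu>. \<mu> \<in> P \<Longrightarrow> fp \<mu> \<in> borel_measurable lebesgue"
    and "\<And>\<mu>. \<mu> \<in> P \<Longrightarrow> gp \<mu> \<in> borel_measurable lebesgue"
    and "f = fp \<mu>0" and "g = gp \<mu>0"
    and "\<And>\<alpha> r \<mu>. \<alpha> > 0 \<Longrightarrow> r > 0 \<Longrightarrow> \<mu> \<in> P \<Longrightarrow> m \<alpha> r \<mu> \<in> Linf_nonneg {-\<alpha><..<\<alpha>}"
    and "\<And>\<alpha> r \<mu>. \<alpha> > 0 \<Longrightarrow> r > 0 \<Longrightarrow> \<mu> \<in> P \<Longrightarrow>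
           (AE t in lebesgue_on {-\<alpha><..<\<alpha>}. AE x in lebesgue_on (ball 0 r).
              emeasure lebesgue (closeness_set (fp \<mu>) (gp \<mu>) f g (m \<alpha> r \<mu>) t x) > 0)"
    and "\<And>\<alpha> r. \<alpha> > 0 \<Longrightarrow> r > 0 \<Longrightarrow> (SUP \<mu>\<in>P. Linf_norm {-\<alpha><..<\<alpha>} (m \<alpha> r \<mu>)) < \<infinity>"
    and "\<And>\<alpha> r. \<alpha> > 0 \<Longrightarrow> r > 0 \<Longrightarrow>
           ((\<lambda>\<mu>. L1_norm {-\<alpha><..<\<alpha>} (m \<alpha> r \<mu>)) \<longlongrightarrow> 0) (at \<mu>0 within P)"
    and "T > 0"
    and "all_filippov_solutions_exist_until \<Phi> f g t0 x0 (t0 + T)"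
  shows "\<forall>\<epsilon>>0. \<exists>\<delta> \<alpha> r. 0 < \<delta> \<and> \<delta> < \<epsilon> \<and> 0 < \<alpha> \<and> {t0..t0 + T} \<subseteq> {-\<alpha><..<\<alpha>} \<and> 0 < r \<and>
    (\<forall>\<mu>\<in>P. \<forall>t\<mu> x\<mu>0 x\<mu>.
       t\<mu> \<in> {t0..t0 + \<delta>} \<and> x\<mu>0 \<in> ball x0 \<delta> \<and>
       L1_norm {t0<..<t0 + T} (m \<alpha> r \<mu>) \<le> \<delta> \<and>
       filippov_solution \<Phi> (fp \<mu>) (gp \<mu>) t\<mu> x\<mu>0 {t\<mu>..t0 + T} x\<mu> \<longrightarrow>
       (\<exists>x. filippov_solution \<Phi> f g t0 x0 {t0..t0 + T} x \<and>
          (SUP t\<in>{t0 + \<delta>..t0 + T}. ereal (norm (x t - x\<mu> t))) \<le> ereal \<epsilon>))"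
proof (intro allI impI)
  fix \<epsilon> :: real assume "\<epsilon> > 0"
  note \<Phi> = assms(2) and f = assms(3) and g = assms(4) and mL = assms(11) and close = assms(12)
    and msup = assms(13) and T = assms(15) and ext = assms(16)
  define b where "b = t0 + T"
  have tb: "t0 < b" using T unfolding b_def by simp
  note ext = ext[folded b_def]
  obtain R0 where R0: "\<And>y t. filippov_solution \<Phi> f g t0 x0 {t0..b} y \<Longrightarrow> t \<in> {t0..b} \<Longrightarrow> norm (y t) \<le> R0"
    by (rule filippov_solutions_bounded[OF \<Phi> f g tb ext]) (rule that)
  \<comment> \<open>R, r and \<alpha> are fixed independently of \<epsilon>, because
    \<open>m\<close> depends on r and \<alpha>; the contradiction argument then concerns \<delta>
    alone.\<close>
  define R where "R = max R0 (norm x0)"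
  define r where "r = R + 3"
  define \<alpha> where "\<alpha> = \<bar>t0\<bar> + \<bar>b\<bar> + 1"
  have "0 \<le> R" unfolding R_def by (simp add: max.coboundedI2)
  then have r: "0 < r" unfolding r_def by simp
  have \<alpha>: "0 < \<alpha>" "{t0..b} \<subseteq> {-\<alpha><..<\<alpha>}" unfolding \<alpha>_def by auto
  have R: "norm x0 \<le> R" "\<And>y t. filippov_solution \<Phi> f g t0 x0 {t0..b} y \<Longrightarrow> t \<in> {t0..b} \<Longrightarrow> norm (y t) \<le> R" "R + 2 < r"
    using R0 unfolding R_def r_def by (auto simp: max.coboundedI1)
  \<comment> \<open>A bound for all enlargements at once, so that a single dominating function h
    serves every parameter.\<close>
  define c where "c = max 0 (real_of_ereal (SUP \<mu>\<in>P. Linf_norm {-\<alpha><..<\<alpha>} (m \<alpha> r \<mu>)))"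
  have meas: "{-\<alpha><..<\<alpha>} \<in> sets lebesgue" "ball (0::real^'n) r \<in> sets lebesgue"
    "{t0<..<b} \<in> sets lebesgue" by auto
  have mc: "AE t in lebesgue. t \<in> {-\<alpha><..<\<alpha>} \<longrightarrow> 0 \<le> m \<alpha> r \<mu> t \<and> m \<alpha> r \<mu> t \<le> c" if "\<mu> \<in> P" for \<mu>
  proof -
    have "AE t in lebesgue_on {-\<alpha><..<\<alpha>}. ereal \<bar>m \<alpha> r \<mu> t\<bar> \<le> Linf_norm {-\<alpha><..<\<alpha>} (m \<alpha> r \<mu>)"
      unfolding Linf_norm_def by (rule esssup_AE)
    moreover have "AE t in lebesgue_on {-\<alpha><..<\<alpha>}. 0 \<le> m \<alpha> r \<mu> t"
      using mL[OF \<alpha>(1) r that] unfolding Linf_nonneg_def by blast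
    ultimately show ?thesis
      unfolding AE_lebesgue_on_iff[OF meas(1)]
    proof eventually_elim
      case (elim t)
      show ?case
      proof
        assume t: "t \<in> {-\<alpha><..<\<alpha>}"
        let ?S = "SUP \<mu>\<in>P. Linf_norm {-\<alpha><..<\<alpha>} (m \<alpha> r \<mu>)"
        have "ereal \<bar>m \<alpha> r \<mu> t\<bar> \<le> Linf_norm {-\<alpha><..<\<alpha>} (m \<alpha> r \<mu>)" using elim(1) t by blast
        also have "\<dots> \<le> ?S" using that by (rule SUP_upper)
        finally have "\<bar>m \<alpha> r \<mu> t\<bar> \<le> c"
          using msup[OF \<alpha>(1) r] unfolding c_def by (cases ?S) auto
        then show "0 \<le> m \<alpha> r \<mu> t \<and> m \<alpha> r \<mu> t \<le> c" using elim(2) t by auto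
      qed
    qed
  qed
  have "0 \<le> c" unfolding c_def by simp
  obtain C hf hg where "filippov_bounds \<Phi> f g t0 b r c C hf hg"
    by (rule filippov_bounds_exist[OF \<Phi> f g r \<open>0 \<le> c\<close>])
  then interpret filippov_bounds \<Phi> f g t0 b r c C hf hg .
  have "\<exists>\<delta> \<alpha> r. 0 < \<delta> \<and> \<delta> < \<epsilon> \<and> 0 < \<alpha> \<and> {t0..b} \<subseteq> {-\<alpha><..<\<alpha>} \<and> 0 < r \<and>
    (\<forall>\<mu>\<in>P. \<forall>t\<mu> x\<mu>0 x\<mu>.
       t\<mu> \<in> {t0..t0 + \<delta>} \<and> x\<mu>0 \<in> ball x0 \<delta> \<and>
       L1_norm {t0<..<b} (m \<alpha> r \<mu>) \<le> \<delta> \<and>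
       filippov_solution \<Phi> (fp \<mu>) (gp \<mu>) t\<mu> x\<mu>0 {t\<mu>..b} x\<mu> \<longrightarrow>
       (\<exists>x. filippov_solution \<Phi> f g t0 x0 {t0..b} x \<and>
          (SUP t\<in>{t0 + \<delta>..b}. ereal (norm (x t - x\<mu> t))) \<le> ereal \<epsilon>))"
  proof (rule ccontr)
    assume contra: "\<not> ?thesis"
    define \<delta> where "\<delta> k = min (\<epsilon> / 2) (1 / real (Suc k))" for k
    have \<delta>: "0 < \<delta> k" "\<delta> k < \<epsilon>" for k using \<open>\<epsilon> > 0\<close> unfolding \<delta>_def by auto
    have \<delta>0: "\<delta> \<longlonglongrightarrow> 0"
    proof (rule tendsto_sandwich[OF _ _ tendsto_const LIMSEQ_Suc[OF lim_1_over_n]])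
      show "\<forall>\<^sub>F k in sequentially. 0 \<le> \<delta> k" by (intro always_eventually allI less_imp_le \<delta>(1))
      show "\<forall>\<^sub>F k in sequentially. \<delta> k \<le> 1 / real (Suc k)" unfolding \<delta>_def by simp
    qed
    \<comment> \<open>The counterexamples are bundled as tuples, so that one choice yields all four
      sequences.\<close>
    define bad where "bad k p \<longleftrightarrow> (case p of (\<mu>, s, z, x) \<Rightarrow>
      \<mu> \<in> P \<and> s \<in> {t0..t0 + \<delta> k} \<and> z \<in> ball x0 (\<delta> k) \<and> L1_norm {t0<..<b} (m \<alpha> r \<mu>) \<le> \<delta> k \<and>
      filippov_solution \<Phi> (fp \<mu>) (gp \<mu>) s z {s..b} x \<and>
      (\<forall>y. filippov_solution \<Phi> f g t0 x0 {t0..b} y \<longrightarrow>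
         \<not> (SUP t\<in>{t0 + \<delta> k..b}. ereal (norm (y t - x t))) \<le> ereal \<epsilon>))" for k p
    have "\<exists>p. bad k p" for k
    proof (rule ccontr)
      assume "\<nexists>p. bad k p"
      then have "\<forall>\<mu>\<in>P. \<forall>t\<mu> x\<mu>0 x\<mu>. t\<mu> \<in> {t0..t0 + \<delta> k} \<and> x\<mu>0 \<in> ball x0 (\<delta> k) \<and>
         L1_norm {t0<..<b} (m \<alpha> r \<mu>) \<le> \<delta> k \<and>
         filippov_solution \<Phi> (fp \<mu>) (gp \<mu>) t\<mu> x\<mu>0 {t\<mu>..b} x\<mu> \<longrightarrow>
         (\<exists>x. filippov_solution \<Phi> f g t0 x0 {t0..b} x \<and>
            (SUP t\<in>{t0 + \<delta> k..b}. ereal (norm (x t - x\<mu> t))) \<le> ereal \<epsilon>)"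
        unfolding bad_def by blast
      with contra \<delta>[of k] \<alpha> r show False by blast
    qed
    then have "\<exists>p. \<forall>k. bad k (p k)" by (intro choice allI)
    then obtain p where p: "\<And>k. bad k (p k)" by blast
    define \<mu> s z x where "\<mu> k = fst (p k)" and "s k = fst (snd (p k))"
      and "z k = fst (snd (snd (p k)))" and "x k = snd (snd (snd (p k)))" for k
    have q: "\<mu> k \<in> P" "s k \<in> {t0..t0 + \<delta> k}" "z k \<in> ball x0 (\<delta> k)" "L1_norm {t0<..<b} (m \<alpha> r (\<mu> k)) \<le> \<delta> k"
      "filippov_solution \<Phi> (fp (\<mu> k)) (gp (\<mu> k)) (s k) (z k) {s k..b} (x k)"
      "\<And>y. filippov_solution \<Phi> f g t0 x0 {t0..b} y \<Longrightarrow>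
         \<not> (SUP t\<in>{t0 + \<delta> k..b}. ereal (norm (y t - x k t))) \<le> ereal \<epsilon>" for k
      using p[of k] unfolding bad_def \<mu>_def s_def z_def x_def by (simp_all add: case_prod_beta)
    \<comment> \<open>A solution interval contains its starting time, so s k cannot exceed
      b.\<close>
    have xs: "x k (s k) = z k" and sb: "s k \<in> {t0..b}" for k
      using q(5)[of k] q(2)[of k] unfolding filippov_solution_def by auto
    have mi: "integrable (lebesgue_on {t0<..<b}) (m \<alpha> r (\<mu> k))" for k
    proof -
      have sub: "{t0<..<b} \<subseteq> {-\<alpha><..<\<alpha>}" using \<alpha>(2) by auto
      have "m \<alpha> r (\<mu> k) \<in> borel_measurable (lebesgue_on {-\<alpha><..<\<alpha>})"
        using mL[OF \<alpha>(1) r q(1)[of k]] unfolding Linf_nonneg_def by blast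
      then have m_meas: "m \<alpha> r (\<mu> k) \<in> borel_measurable (lebesgue_on {t0<..<b})"
        using sub by (rule measurable_restrict_mono)
      have "(\<lambda>_. c) absolutely_integrable_on {t0..b}"
        by (rule absolutely_integrable_continuous_real) simp
      then have "(\<lambda>_. c) absolutely_integrable_on {t0<..<b}"
        by (rule set_integrable_subset) auto
      then have c_int: "integrable (lebesgue_on {t0<..<b}) (\<lambda>_. c)"
        by (rule absolutely_integrable_on_iff[OF meas(3), THEN iffD1])
      have "AE t in lebesgue_on {t0<..<b}. norm (m \<alpha> r (\<mu> k) t) \<le> norm c"
        unfolding AE_lebesgue_on_iff[OF meas(3)] using mc[OF q(1)[of k]]
        by eventually_elim (use sub in auto)
      with c_int m_meas show ?thesis by (rule Bochner_Integration.integrable_bound)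
    qed
    have "(\<lambda>k. LINT t|lebesgue_on {t0<..<b}. norm (m \<alpha> r (\<mu> k) t)) \<longlonglongrightarrow> 0"
    proof (rule tendsto_sandwich[OF _ _ tendsto_const \<delta>0])
      show "\<forall>\<^sub>F k in sequentially. (LINT t|lebesgue_on {t0<..<b}. norm (m \<alpha> r (\<mu> k) t)) \<le> \<delta> k"
        using q(4) unfolding L1_norm_def by simp
    qed simp
    \<comment> \<open>Convergence in L1 gives pointwise convergence only along a subsequence; from
      here on everything is indexed through \<kappa>.\<close>
    from tendsto_L1_AE_subseq[OF mi this]
    obtain \<kappa> :: "nat \<Rightarrow> nat" where \<kappa>: "strict_mono \<kappa>"
      "AE t in lebesgue_on {t0<..<b}. (\<lambda>k. m \<alpha> r (\<mu> (\<kappa> k)) t) \<longlonglongrightarrow> 0" by blast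
    \<comment> \<open>The bounds 0 and c are known almost everywhere for \<open>m\<close> but are
      demanded at every time for an enlargement; changing \<open>m\<close> on a null set reconciles
      the two.\<close>
    define \<eta> where "\<eta> k t = (if 0 \<le> m \<alpha> r (\<mu> (\<kappa> k)) t \<and> m \<alpha> r (\<mu> (\<kappa> k)) t \<le> c then m \<alpha> r (\<mu> (\<kappa> k)) t else 0)" for k t
    have \<eta>: "0 \<le> \<eta> k t" "\<eta> k t \<le> c" for k t unfolding \<eta>_def using \<open>0 \<le> c\<close> by auto
    have \<eta>0: "AE t in lebesgue. t \<in> {t0..b} \<longrightarrow> (\<lambda>k. \<eta> k t) \<longlonglongrightarrow> 0"
      using \<kappa>(2)[unfolded AE_lebesgue_on_iff[OF meas(3)]] AE_singleton[of t0] AE_singleton[of b]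
    proof eventually_elim
      case (elim t)
      show ?case
      proof
        assume "t \<in> {t0..b}"
        then have "(\<lambda>k. m \<alpha> r (\<mu> (\<kappa> k)) t) \<longlonglongrightarrow> 0" using elim by auto
        then have "(\<lambda>k. \<bar>m \<alpha> r (\<mu> (\<kappa> k)) t\<bar>) \<longlonglongrightarrow> 0" by (rule tendsto_rabs_zero)
        then show "(\<lambda>k. \<eta> k t) \<longlonglongrightarrow> 0"
          by (rule Lim_null_comparison[rotated]) (auto simp: \<eta>_def)
      qed
    qed
    have xk: "approx_deriv (\<eta> k) (s (\<kappa> k)) (x (\<kappa> k))" for k
    proof (rule filippov_solution_imp_approx_deriv[OF q(5)])
      let ?\<mu> = "\<mu> (\<kappa> k)"
      show "t0 \<le> s (\<kappa> k)" using sb[of "\<kappa> k"] by auto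
      have inc: "AE t in lebesgue. t \<in> {t0..b} \<longrightarrow> (\<forall>y. norm y < r \<longrightarrow>
        filippov_reg (fp ?\<mu>) t y \<subseteq> ess_near f t y (\<eta> k t) \<and> filippov_reg (gp ?\<mu>) t y \<subseteq> ess_near g t y (\<eta> k t))"
        using close[OF \<alpha>(1) r q(1)[of "\<kappa> k"], unfolded AE_lebesgue_on_iff[OF meas(1)] AE_lebesgue_on_iff[OF meas(2)]]
          mc[OF q(1)[of "\<kappa> k"]]
      proof eventually_elim
        case (elim t)
        show ?case
        proof (intro impI allI)
          fix y :: "real^'n" assume t: "t \<in> {t0..b}" and y: "norm y < r"
          have t\<alpha>: "t \<in> {-\<alpha><..<\<alpha>}" using t \<alpha>(2) by blast
          then have \<eta>m: "\<eta> k t = m \<alpha> r ?\<mu> t" using elim(2) unfolding \<eta>_def by auto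
          have ae: "AE y in lebesgue. y \<in> ball 0 r \<longrightarrow>
            0 < emeasure lebesgue (closeness_set (fp ?\<mu>) (gp ?\<mu>) f g (m \<alpha> r ?\<mu>) t y)"
            using elim(1) t\<alpha> by blast
          show "filippov_reg (fp ?\<mu>) t y \<subseteq> ess_near f t y (\<eta> k t) \<and> filippov_reg (gp ?\<mu>) t y \<subseteq> ess_near g t y (\<eta> k t)"
          proof
            have "AE y in lebesgue. y \<in> ball 0 r \<longrightarrow> (\<forall>M\<in>null_sets lebesgue. \<exists>z. z \<notin> M \<and>
                z \<in> closeness_set (fp ?\<mu>) (gp ?\<mu>) f g (m \<alpha> r ?\<mu>) t y)"
              using ae by eventually_elim (blast intro: closeness_set_avoids_null_sets)
            note ae' = this[unfolded closeness_set_def mem_Collect_eq \<eta>m[symmetric]]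
            show "filippov_reg (fp ?\<mu>) t y \<subseteq> ess_near f t y (\<eta> k t)"
            proof (rule filippov_reg_subset_ess_near[OF _ y])
              show "AE y in lebesgue. y \<in> ball 0 r \<longrightarrow> (\<forall>M\<in>null_sets lebesgue. \<exists>z. z \<notin> M \<and>
                norm (y - z) \<le> \<eta> k t \<and> norm (fp ?\<mu> (t, y) - f (t, z)) \<le> \<eta> k t)"
                using ae' by eventually_elim blast
            qed
            show "filippov_reg (gp ?\<mu>) t y \<subseteq> ess_near g t y (\<eta> k t)"
            proof (rule filippov_reg_subset_ess_near[OF _ y])
              show "AE y in lebesgue. y \<in> ball 0 r \<longrightarrow> (\<forall>M\<in>null_sets lebesgue. \<exists>z. z \<notin> M \<and>
                norm (y - z) \<le> \<eta> k t \<and> norm (gp ?\<mu> (t, y) - g (t, z)) \<le> \<eta> k t)"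
                using ae' by eventually_elim blast
            qed
          qed
        qed
      qed
      show "AE t in lebesgue. t \<in> {t0..b} \<longrightarrow> (\<forall>y. norm y < r \<longrightarrow> filippov_reg (fp ?\<mu>) t y \<subseteq> ess_near f t y (\<eta> k t))"
        "AE t in lebesgue. t \<in> {t0..b} \<longrightarrow> (\<forall>y. norm y < r \<longrightarrow> filippov_reg (gp ?\<mu>) t y \<subseteq> ess_near g t y (\<eta> k t))"
        using inc by (eventually_elim, blast)+
    qed
    have \<delta>\<kappa>: "(\<lambda>k. \<delta> (\<kappa> k)) \<longlonglongrightarrow> 0" using LIMSEQ_subseq_LIMSEQ[OF \<delta>0 \<kappa>(1)] by (simp add: o_def)
    have s0: "(\<lambda>k. s (\<kappa> k)) \<longlonglongrightarrow> t0"
    proof (rule LIM_zero_cancel, rule Lim_null_comparison[OF _ \<delta>\<kappa>])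
      have "norm (s (\<kappa> k) - t0) \<le> \<delta> (\<kappa> k)" for k using q(2)[of "\<kappa> k"] by auto
      then show "\<forall>\<^sub>F k in sequentially. norm (s (\<kappa> k) - t0) \<le> \<delta> (\<kappa> k)" by simp
    qed
    have x0: "(\<lambda>k. x (\<kappa> k) (s (\<kappa> k))) \<longlonglongrightarrow> x0"
    proof (rule LIM_zero_cancel, rule Lim_null_comparison[OF _ \<delta>\<kappa>])
      have "norm (x (\<kappa> k) (s (\<kappa> k)) - x0) \<le> \<delta> (\<kappa> k)" for k
        using q(3)[of "\<kappa> k"] unfolding xs by (simp add: dist_norm norm_minus_commute)
      then show "\<forall>\<^sub>F k in sequentially. norm (x (\<kappa> k) (s (\<kappa> k)) - x0) \<le> \<delta> (\<kappa> k)" by simp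
    qed
    obtain \<sigma> y where y: "strict_mono (\<sigma> :: nat \<Rightarrow> nat)" "filippov_solution \<Phi> f g t0 x0 {t0..b} y"
      "\<And>\<epsilon>. 0 < \<epsilon> \<Longrightarrow> \<exists>N. \<forall>n\<ge>N. \<forall>t\<in>{t0..b}. norm (x (\<kappa> (\<sigma> n)) (max t (s (\<kappa> (\<sigma> n)))) - y t) < \<epsilon>"
    proof (rule approx_deriv_converge[where s = "\<lambda>k. s (\<kappa> k)" and \<eta> = \<eta> and x = "\<lambda>k. x (\<kappa> k)"
          and ?x0.0 = x0 and R = R])
      show "norm (y t) \<le> R" if "filippov_solution \<Phi> f g t0 x0 {t0..b} y" "t \<in> {t0..b}" for y t
        by (rule R(2)[OF that])
    qed (rule tb ext R(1) R(3) sb s0 \<eta>(1) \<eta>(2) \<eta>0 xk x0 that | assumption)+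
    obtain N where N: "\<And>t. t \<in> {t0..b} \<Longrightarrow> norm (x (\<kappa> (\<sigma> N)) (max t (s (\<kappa> (\<sigma> N)))) - y t) < \<epsilon>"
      using y(3)[OF \<open>\<epsilon> > 0\<close>] by blast
    let ?k = "\<kappa> (\<sigma> N)"
    have "(SUP t\<in>{t0 + \<delta> ?k..b}. ereal (norm (y t - x ?k t))) \<le> ereal \<epsilon>"
    proof (rule SUP_least)
      fix t assume t: "t \<in> {t0 + \<delta> ?k..b}"
      \<comment> \<open>By the time t0 + \<delta> the perturbed solution has started, so its frozen
        extension agrees with it; this is why the comparison begins there.\<close>
      have "t \<in> {t0..b}" "max t (s ?k) = t" using t \<delta>(1)[of ?k] q(2)[of ?k] by auto
      with N[of t] show "ereal (norm (y t - x ?k t)) \<le> ereal \<epsilon>" by (simp add: norm_minus_commute)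
    qed
    with q(6)[OF y(2)] show False by blast
  qed
  then show "\<exists>\<delta> \<alpha> r. 0 < \<delta> \<and> \<delta> < \<epsilon> \<and> 0 < \<alpha> \<and> {t0..t0 + T} \<subseteq> {-\<alpha><..<\<alpha>} \<and> 0 < r \<and>
    (\<forall>\<mu>\<in>P. \<forall>t\<mu> x\<mu>0 x\<mu>.
       t\<mu> \<in> {t0..t0 + \<delta>} \<and> x\<mu>0 \<in> ball x0 \<delta> \<and>
       L1_norm {t0<..<t0 + T} (m \<alpha> r \<mu>) \<le> \<delta> \<and>
       filippov_solution \<Phi> (fp \<mu>) (gp \<mu>) t\<mu> x\<mu>0 {t\<mu>..t0 + T} x\<mu> \<longrightarrow>
       (\<exists>x. filippov_solution \<Phi> f g t0 x0 {t0..t0 + T} x \<and>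
          (SUP t\<in>{t0 + \<delta>..t0 + T}. ereal (norm (x t - x\<mu> t))) \<le> ereal \<epsilon>))"
    unfolding b_def .
qed

end
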